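(* Fix an integer $m\ge1$ and $b\in(0,1]$. Let $T_N$, $N\in\mathbb N$, be the $mN\times mN$ real symmetric random block Toeplitz band matrices with bandwidth $b_N$ described in the context, where $b_N\sim bN$ as $N\to\infty$, and let $$X_N=T_N/\sqrt{m(2-b)bN}.$$ Then, as $N\to\infty$, the eigenvalue distribution $\mu_{X_N}$ converges weakly, almost surely, to a symmetric probability distribution $\gamma_T^{(m)}(b)$ on $\mathbb R$ which is determined by its even moments: for every integer $k\ge1$, $$m_{2k}(\gamma_T^{(m)}(b))=\frac1{(2-b)^k}\sum_{\pi\in\mathcal P_2(2k)}m^{k-1-f(\pi)}\int_{[0,1]\times[-1,1]^k}\prod_{j=1}^{2k}I_{[0,1]}\Big(x_0+b\sum_{i=1}^{j}\epsilon_\pi(i)\,x_{\pi(i)}\Big)\prod_{l=0}^{k}\mathrm d x_l .$$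
   Context: Random matrix model. For $m,N\in\mathbb N$ and an integer $b_N<N$ (the bandwidth), $T_N=(A_{i-j})_{i,j=1}^N$ is the $mN\times mN$ block matrix whose $(i,j)$ block is $A_{i-j}$, where $A_s=(a_{ij}(s))_{i,j=1}^m$ are $m\times m$ matrices, $A_s=0$ when $|s|>b_N$, and for $|s|\le b_N$ the entries of $A_s$ are real random variables (the entries may depend on $N$ and $m$; all random variables are defined on a common probability space). Assume: (i) $A_{-s}=(A_s)^T$ for all $s$ (so $T_N$ is symmetric; in particular $A_0$ is symmetric); (ii) for each $N$ and $m$, apart from the identities forced by (i), the entries are independent, i.e. the family $\{a_{ij}(s):1\le s\le b_N,\,1\le i,j\le m\}\cup\{a_{ij}(0):1\le i\le j\le m\}$ is independent; (iii) $E(a_{ij}(s))=0$ and $E(|a_{ij}(s)|^2)=1$ for all $|s|\le b_N$, $1\le i,j\le m$; (iv) for every $k\in\mathbb N$, $C_{k,m}:=\sup\{E|a_{ij}(s)|^k: N\in\mathbb N,\ |s|\le b_N,\ 1\le i,j\le m\}<+\infty$ and $\sup_{m\in\mathbb N}C_{k,m}=C_k<+\infty$. $b_N\sim bN$ means $b_N/N\to b$. Eigenvalue distribution. For a real symmetric $n\times n$ random matrix $A$ with eigenvalues $\lambda_1(\omega),\dots,\lambda_n(\omega)$, here $\mu_A$ is the random probability measure $\frac1n\sum_{j=1}^n\delta_{\lambda_j(\omega)}$. Partitions. $[n]=\{1,\dots,n\}$. $\mathcal P_2(2k)$ is the set of partitions $\pi=\{V_1,\dots,V_k\}$ of $[2k]$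 all of whose blocks have exactly two elements; the blocks are labelled and $\pi(q)=i$ means $q\in V_i$. Put $\epsilon_\pi(q)=1$ if $q$ is the smaller element of $V_{\pi(q)}$ and $\epsilon_\pi(q)=-1$ otherwise. For $\pi=\{V_1,\dots,V_k\}\in\mathcal P_2(2k)$ with $V_r=\{a_r,b_r\}$, $f(\pi)$ is the number of linearly independent equations (the rank) of the linear system in the unknowns $t_1,\dots,t_{2k}$ (with $t_{2k+1}=t_1$): $t_{a_i}=t_{b_i+1}$ and $t_{b_i}=t_{a_i+1}$ for $1\le i\le k$. $I_{[0,1]}$ is the indicator function of $[0,1]$, and $m_{2k}(\gamma)=\int x^{2k}\,d\gamma$. *)

theory Defs
  imports
    "HOL-Probability.Probability"
    "Jordan_Normal_Form.Char_Poly"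
    "Jordan_Normal_Form.DL_Rank"
begin

text \<open>Matrices and vectors are those of Jordan\_Normal\_Form, so that the size may vary
  with N. Their indices start at 0.\<close>

section \<open>The random matrices\<close>

text \<open>The least upper bound of the absolute moments of order k, for block size m. It is taken in
  the extended nonnegative reals, where a divergent moment has the value infinity.\<close>

definition moment_sup ::
  "'w measure \<Rightarrow> (nat \<Rightarrow> int) \<Rightarrow> (nat \<Rightarrow> nat \<Rightarrow> int \<Rightarrow> 'w \<Rightarrow> real mat) \<Rightarrow> nat \<Rightarrow> nat \<Rightarrow> ennreal"
  where
  "moment_sup M bw A k m =
     (SUP (N, s, i, j) \<in> {(N, s, i, j). 1 \<le> N \<and> \<bar>s\<bar> \<le> bw N \<and> i < m \<and> j < m}.
        \<integral>\<^sup>+\<omega>. ennreal (\<bar>A m N s \<omega> $$ (i, j)\<bar> ^ k) \<partial>M)"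

text \<open>Here \<open>A m N s \<omega>\<close> is the block with index s of the matrix with N by N blocks of size m, and
  \<open>bw N\<close> is the bandwidth. Only N and m that are at least 1 matter.\<close>

locale block_toeplitz_band_model = prob_space M
  for M :: "'w measure" +
  fixes bw :: "nat \<Rightarrow> int"
    and A :: "nat \<Rightarrow> nat \<Rightarrow> int \<Rightarrow> 'w \<Rightarrow> real mat"
  assumes bandwidth: "\<And>N. 1 \<le> N \<Longrightarrow> bw N < int N"
    and block_carrier: "\<And>m N s \<omega>. \<lbrakk>1 \<le> m; 1 \<le> N; \<omega> \<in> space M\<rbrakk> \<Longrightarrow>
      A m N s \<omega> \<in> carrier_mat m m"
    and block_outside: "\<And>m N s \<omega>. \<lbrakk>1 \<le> m; 1 \<le> N; bw N < \<bar>s\<bar>; \<omega> \<in> space M\<rbrakk> \<Longrightarrow>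
      A m N s \<omega> = 0\<^sub>m m m"
    and entry_measurable: "\<And>m N s i j. \<lbrakk>1 \<le> m; 1 \<le> N; \<bar>s\<bar> \<le> bw N; i < m; j < m\<rbrakk> \<Longrightarrow>
      random_variable borel (\<lambda>\<omega>. A m N s \<omega> $$ (i, j))"
    and block_transpose: "\<And>m N s \<omega>. \<lbrakk>1 \<le> m; 1 \<le> N; \<omega> \<in> space M\<rbrakk> \<Longrightarrow>
      A m N (- s) \<omega> = transpose_mat (A m N s \<omega>)"
    and entry_indep: "\<And>m N. \<lbrakk>1 \<le> m; 1 \<le> N\<rbrakk> \<Longrightarrow>
      indep_vars (\<lambda>_. borel) (\<lambda>(s, i, j) \<omega>. A m N s \<omega> $$ (i, j))
        ({(s, i, j). 1 \<le> s \<and> s \<le> bw N \<and> i < m \<and> j < m} \<union> {(s, i, j). s = 0 \<and> i \<le> j \<and> j < m})"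
    and entry_mean: "\<And>m N s i j. \<lbrakk>1 \<le> m; 1 \<le> N; \<bar>s\<bar> \<le> bw N; i < m; j < m\<rbrakk> \<Longrightarrow>
      expectation (\<lambda>\<omega>. A m N s \<omega> $$ (i, j)) = 0"
    and entry_variance: "\<And>m N s i j. \<lbrakk>1 \<le> m; 1 \<le> N; \<bar>s\<bar> \<le> bw N; i < m; j < m\<rbrakk> \<Longrightarrow>
      expectation (\<lambda>\<omega>. \<bar>A m N s \<omega> $$ (i, j)\<bar> ^ 2) = 1"
    and moments_finite: "\<And>k m. 1 \<le> m \<Longrightarrow> moment_sup M bw A k m < \<infinity>"
    and moments_uniform: "\<And>k. (SUP m \<in> {1..}. moment_sup M bw A k m) < \<infinity>"

definition block_toeplitz :: "nat \<Rightarrow> nat \<Rightarrow> (int \<Rightarrow> real mat) \<Rightarrow> real mat" where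
  "block_toeplitz m N B =
     mat (m * N) (m * N) (\<lambda>(p, q). B (int (p div m) - int (q div m)) $$ (p mod m, q mod m))"

text \<open>The eigenvalues with multiplicity are the roots of the characteristic polynomial. For a real
  symmetric matrix of size n there are n of them, so each has weight 1/n (times multiplicity).
  The case n = 0 is a junk value.\<close>

definition eigenvalue_distribution :: "real mat \<Rightarrow> real measure" where
  "eigenvalue_distribution B =
     distr (measure_pmf (pmf_of_multiset (proots (char_poly B)))) borel (\<lambda>x. x)"

section \<open>Pair partitions\<close>

definition pair_partitions :: "nat \<Rightarrow> nat set set set" where
  "pair_partitions k = {\<pi>. partition_on {1..2 * k} \<pi> \<and> (\<forall>V\<in>\<pi>. card V = 2)}"

definition block_of :: "nat set set \<Rightarrow> nat \<Rightarrow> nat set" where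
  "block_of \<pi> q = (THE V. V \<in> \<pi> \<and> q \<in> V)"

text \<open>The blocks are labelled 1, ..., k in the order of their least elements; the limiting moments
  do not depend on the labelling.\<close>

definition label :: "nat set set \<Rightarrow> nat \<Rightarrow> nat" where
  "label \<pi> q = card {V \<in> \<pi>. Min V \<le> Min (block_of \<pi> q)}"

definition pair_sign :: "nat set set \<Rightarrow> nat \<Rightarrow> real" where
  "pair_sign \<pi> q = (if q = Min (block_of \<pi> q) then 1 else - 1)"

definition partner :: "nat set set \<Rightarrow> nat \<Rightarrow> nat" where
  "partner \<pi> q = the_elem (block_of \<pi> q - {q})"

text \<open>The two equations of a block \<open>{a, b}\<close> are \<open>t\<^sub>q = t\<^sub>r\<close> with \<open>r = partner q + 1\<close> (cyclically), for
  q = a and q = b, so the equations of the system are indexed by the elements q of 1, ..., 2k.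
  Row q - 1 of the matrix holds the coefficients of equation q, column r - 1 those of the r-th
  unknown; since \<open>partner \<pi> q\<close> is 1-based, \<open>partner \<pi> q mod (2 * k)\<close> is the column of its cyclic
  successor.\<close>

definition system_matrix :: "nat \<Rightarrow> nat set set \<Rightarrow> real mat" where
  "system_matrix k \<pi> = mat (2 * k) (2 * k) (\<lambda>(q, r).
     (if r = q then 1 else 0) - (if r = partner \<pi> (Suc q) mod (2 * k) then 1 else 0))"

definition system_rank :: "nat \<Rightarrow> nat set set \<Rightarrow> nat" where
  "system_rank k \<pi> = vec_space.rank (2 * k) (system_matrix k \<pi>)"

section \<open>The limiting moments\<close>

definition partition_integral :: "real \<Rightarrow> nat \<Rightarrow> nat set set \<Rightarrow> real" where
  "partition_integral b k \<pi> =
     (LINT x : (\<Pi>\<^sub>E l\<in>{0..k}. if l = 0 then {0..1} else {-1..1}) | (\<Pi>\<^sub>M l\<in>{0..k}. lborel).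
        \<Prod>j = 1..2 * k.
          indicator {0..1} (x 0 + b * (\<Sum>i = 1..j. pair_sign \<pi> i * x (label \<pi> i))))"

definition limit_moment :: "nat \<Rightarrow> real \<Rightarrow> nat \<Rightarrow> real" where
  "limit_moment m b k =
     1 / (2 - b) ^ k *
     (\<Sum>\<pi>\<in>pair_partitions k.
        real m powi (int k - 1 - int (system_rank k \<pi>)) * partition_integral b k \<pi>)"

definition symmetric_with_even_moments :: "real measure \<Rightarrow> (nat \<Rightarrow> real) \<Rightarrow> bool" where
  "symmetric_with_even_moments \<gamma> c \<longleftrightarrow>
     real_distribution \<gamma> \<and> distr \<gamma> borel uminus = \<gamma> \<and>
     (\<forall>k\<ge>1. integrable \<gamma> (\<lambda>x. x ^ (2 * k)) \<and> (LINT x|\<gamma>. x ^ (2 * k)) = c k)"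

end

theory Submission
  imports Defs "Jordan_Normal_Form.Schur_Decomposition"
begin

text \<open>
  The n-th moment of the eigenvalue distribution of a symmetric matrix is the normalised trace of its
  n-th power, and for a block Toeplitz matrix that trace is a sum over pairs of closed walks: \<open>I\<close> runs
  through block indices, \<open>t\<close> through the indices inside the blocks, and the q-th factor of the product
  is an entry of the block whose index is the step \<open>I q - I (q + 1)\<close>
  (\<open>trace_block_toeplitz_power\<close>). Entries are identified with independent variables only through
  transposition, so two factors can be the same variable only if the absolute values of their steps
  agree.

  A walk is determined by its start and its steps. If a product has nonzero mean then each absolute
  step occurs at least twice, so a walk of length 2k has at most \<open>1 + k\<close> free parameters, and each
  further relation between the steps costs a factor N. The steps of a closed walk add up to 0; this is
  itself a new relation unless the steps cancel in pairs. Hence up to lower order only walks whose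
  steps cancel along a pair partition \<open>\<pi>\<close> remain (\<open>card_degenerate_walks\<close>). For such a walk the
  mean of the product is 1 if \<open>t q = t (partner q + 1)\<close> for all q and 0 otherwise
  (\<open>mixed_entry_code\<close>). The first condition is the linear system of the context: it says that \<open>t\<close> is
  constant on the cycles of a permutation, so it has \<open>m ^ (2k - rank)\<close> solutions
  (\<open>card_invariant_functions_rank\<close>). The walks themselves are the lattice points of a dilated
  polytope, and their number divided by \<open>N (b N) ^ k\<close> tends to the volume that
  \<open>partition_integral\<close> measures (\<open>card_lattice_points_tendsto\<close>). This gives the limit of the mean
  moments.

  In general the variance of a normalised trace is only of order 1/N, which is not summable, so
  almost sure convergence rests on the fourth central moment. Its expansion runs over four walks, each of which must share an absolute
  step with another one, and then the four equations saying that the steps of a walk add up to 0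
  remove two more parameters (\<open>card_linked_families\<close>). The fourth central moment is therefore of
  order \<open>N ^ (-2)\<close>, which is summable (\<open>AE_tendsto_of_fourth_moment\<close>).

  It remains to pass from moments to measures. There are at most \<open>(2k) ^ k\<close> pair partitions, so
  the limiting moments grow slowly enough that the Taylor polynomials of a characteristic function
  with these moments converge everywhere. The moments thus determine the measure
  (\<open>moments_determine\<close>), and tightness together with Helly's theorem turns convergence of all
  moments into weak convergence (\<open>moment_convergence_theorem\<close>). Since the limit is determined by its
  moments, the exceptional null set may be chosen before the limit measure.
\<close>

section \<open>The moment method\<close>

definition has_moments :: "real measure \<Rightarrow> (nat \<Rightarrow> real) \<Rightarrow> bool" where
  "has_moments \<mu> c \<longleftrightarrow> real_distribution \<mu> \<and> (\<forall>k. integrable \<mu> (\<lambda>x. x ^ k) \<and> (LINT x|\<mu>. x ^ k) = c k)"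

text \<open>The difference of two characteristic functions with equal moments is bounded by twice
  the Taylor remainder of order 2k, which the moment of order 2k controls.\<close>

lemma moments_determine:
  assumes c: "\<And>t::real. (\<lambda>k. t ^ (2 * k) / fact (2 * k) * c (2 * k)) \<longlonglongrightarrow> 0"
    and \<mu>: "has_moments \<mu> c" and \<nu>: "has_moments \<nu> c"
  shows "\<mu> = \<nu>"
proof -
  interpret \<mu>: real_distribution \<mu> using \<mu> by (simp add: has_moments_def)
  interpret \<nu>: real_distribution \<nu> using \<nu> by (simp add: has_moments_def)
  have "char \<mu> t = char \<nu> t" for t
  proof -
    have b: "cmod (char \<rho> t - (\<Sum>j\<le>2*k. ((\<i> * t)^j / fact j) * c j)) \<le> 2 * (t ^ (2*k) / fact (2*k) * c (2*k))"
      if r: "has_moments \<rho> c" for \<rho> k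
    proof -
      interpret real_distribution \<rho> using r by (simp add: has_moments_def)
      have "cmod (char \<rho> t - (\<Sum>j \<le> 2*k. ((\<i> * t)^j / fact j) * expectation (\<lambda>x. x^j))) \<le>
        (2*\<bar>t\<bar>^(2*k) / fact (2*k)) * expectation (\<lambda>x. \<bar>x\<bar>^(2*k))"
        by (rule char_approx1) (use r in \<open>simp add: has_moments_def\<close>)
      with r show ?thesis by (simp add: has_moments_def power_even_abs)
    qed
    have "cmod (char \<mu> t - char \<nu> t) \<le> 4 * (t ^ (2*k) / fact (2*k) * c (2*k))" for k
    proof -
      have "cmod (char \<mu> t - char \<nu> t) \<le> cmod (char \<mu> t - (\<Sum>j\<le>2*k. ((\<i> * t)^j / fact j) * c j))
         + cmod (char \<nu> t - (\<Sum>j\<le>2*k. ((\<i> * t)^j / fact j) * c j))"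
        using dist_triangle2[of "char \<mu> t" "char \<nu> t"] unfolding dist_norm .
      with b[OF \<mu>, of k] b[OF \<nu>, of k] show ?thesis by linarith
    qed
    moreover have "(\<lambda>k. 4 * (t ^ (2*k) / fact (2*k) * c (2*k))) \<longlonglongrightarrow> 4 * 0"
      by (intro tendsto_mult_left c)
    ultimately have "cmod (char \<mu> t - char \<nu> t) \<le> 4 * 0"
      by (intro LIMSEQ_le_const) auto
    thus ?thesis by simp
  qed
  thus ?thesis
    by (intro Levy_uniqueness \<mu>.real_distribution_axioms \<nu>.real_distribution_axioms ext)
qed

text \<open>Powers are unbounded, so weak convergence does not apply to them directly. They are
  replaced by powers of the argument clamped to \<open>[-R, R]\<close>; the error is at most
  \<open>2 x ^ (2k) / R ^ k\<close>, uniformly small because the moments of order 2k are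
  bounded.\<close>

lemma weak_limit_has_moments:
  fixes \<mu> :: "nat \<Rightarrow> real measure"
  assumes rd: "\<And>n. real_distribution (\<mu> n)" and rdn: "real_distribution \<nu>"
    and int: "\<And>n k. integrable (\<mu> n) (\<lambda>x. x ^ k)"
    and lim: "\<And>k. (\<lambda>n. LINT x|\<mu> n. x ^ k) \<longlonglongrightarrow> c k"
    and weak: "weak_conv_m \<mu> \<nu>"
  shows "has_moments \<nu> c"
proof -
  interpret \<nu>: real_distribution \<nu> by fact
  interpret \<mu>: real_distribution "\<mu> n" for n by fact
  have conv: "(\<lambda>n. integral\<^sup>L (\<mu> n) f) \<longlonglongrightarrow> integral\<^sup>L \<nu> f"
    if "\<And>x. isCont f x" "\<And>x. norm (f x) \<le> B" for f :: "real \<Rightarrow> real" and B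
    by (rule weak_conv_imp_integral_bdd_continuous_conv[OF rd rdn weak]) (use that in auto)
  have even: "integrable \<nu> (\<lambda>x. x ^ (2 * k))" for k
  proof -
    define f where "f i x = min (x ^ (2 * k)) (real i)" for i x
    have fc: "\<And>x. isCont (f i) x" for i unfolding f_def by (intro continuous_intros)
    have fb: "\<And>x. norm (f i x) \<le> real i" for i unfolding f_def by auto
    have fm[measurable]: "f i \<in> borel_measurable borel" for i
      unfolding f_def by measurable
    have fi: "integrable \<nu> (f i)" for i
      by (rule \<nu>.integrable_const_bound[where B = "real i"]) (use fb in auto)
    have fin: "integrable (\<mu> n) (f i)" for i n
      by (rule \<mu>.integrable_const_bound[where B = "real i"]) (use fb in auto)
    have bd: "integral\<^sup>L \<nu> (f i) \<le> c (2 * k)" for i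
      by (rule LIMSEQ_le[OF conv[OF fc fb] lim])
        (intro exI[of _ 0] allI impI integral_mono fin int, auto simp: f_def)
    have inc: "incseq (\<lambda>i. integral\<^sup>L \<nu> (f i))"
      by (intro incseq_SucI integral_mono fi) (auto simp: f_def)
    obtain L where L: "(\<lambda>i. integral\<^sup>L \<nu> (f i)) \<longlonglongrightarrow> L"
      using incseq_convergent[OF inc] bd by blast
    show ?thesis
    proof (rule integrable_monotone_convergence[OF fi _ _ L])
      show "AE x in \<nu>. mono (\<lambda>n. f n x)" by (auto simp: f_def mono_def)
      show "AE x in \<nu>. (\<lambda>i. f i x) \<longlonglongrightarrow> x ^ (2 * k)"
      proof (rule AE_I2)
        fix x :: real
        obtain i0 where "x ^ (2 * k) \<le> real i0" using real_arch_simple by blast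
        hence "\<forall>\<^sub>F i in sequentially. f i x = x ^ (2 * k)"
          by (intro eventually_sequentiallyI[of i0]) (auto simp: f_def)
        thus "(\<lambda>i. f i x) \<longlonglongrightarrow> x ^ (2 * k)" by (rule tendsto_eventually)
      qed
    qed auto
  qed
  have all: "integrable \<nu> (\<lambda>x. x ^ k)" for k
  proof (rule Bochner_Integration.integrable_bound[where f = "\<lambda>x. 1 + x ^ (2 * k)"])
    show "AE x in \<nu>. norm (x ^ k) \<le> norm (1 + x ^ (2 * k))"
    proof (rule AE_I2)
      fix x :: real
      have "2 * \<bar>x ^ k\<bar> \<le> 1 + \<bar>x ^ k\<bar>\<^sup>2" using sum_squares_bound[of 1 "\<bar>x ^ k\<bar>"] by simp
      moreover have "\<bar>x ^ k\<bar>\<^sup>2 = x ^ (2 * k)" by (simp add: power_mult[symmetric] mult.commute)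
      ultimately show "norm (x ^ k) \<le> norm (1 + x ^ (2 * k))" by simp
    qed
  qed (auto intro!: even)
  have mom: "(LINT x|\<nu>. x ^ k) = c k" for k
  proof (cases "k = 0")
    case True
    have "(\<lambda>n. LINT x|\<mu> n. x ^ k) \<longlonglongrightarrow> 1" using True \<mu>.prob_space by simp
    with lim[of k] have "c k = 1" using LIMSEQ_unique by blast
    thus ?thesis using True \<nu>.prob_space by simp
  next
    case False
    obtain B where B: "\<And>n. norm (LINT x|\<mu> n. x ^ (2 * k)) \<le> B"
      using BseqE[OF convergent_imp_Bseq[OF convergentI[OF lim[of "2 * k"]]]] by metis
    define D where "D = (LINT x|\<nu>. x ^ (2 * k))"
    define g where "g R x = (max (- R) (min R x)) ^ k" for R x :: real
    have gd: "\<bar>x ^ k - g R x\<bar> \<le> (2 / R ^ k) * x ^ (2 * k)" if "R > 0" for R x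
    proof (cases "\<bar>x\<bar> \<le> R")
      case True
      hence "max (- R) (min R x) = x" by auto
      hence "g R x = x ^ k" by (simp add: g_def)
      thus ?thesis using that by simp
    next
      case False
      have "\<bar>g R x\<bar> \<le> \<bar>x\<bar> ^ k" unfolding g_def power_abs
        by (rule power_mono) (use False that in auto)
      hence "\<bar>x ^ k - g R x\<bar> \<le> 2 * \<bar>x\<bar> ^ k" by (simp add: power_abs[symmetric])
      moreover have "R ^ k * \<bar>x\<bar> ^ k \<le> \<bar>x\<bar> ^ k * \<bar>x\<bar> ^ k"
        using False that by (intro mult_right_mono power_mono) auto
      moreover have "\<bar>x\<bar> ^ k * \<bar>x\<bar> ^ k = x ^ (2 * k)"
        by (metis power_add mult_2 power_even_abs even_mult_iff even_numeral)
      moreover have "R ^ k * \<bar>x ^ k - g R x\<bar> \<le> R ^ k * (2 * \<bar>x\<bar> ^ k)"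
        using that calculation(1) by (intro mult_left_mono) auto
      ultimately have "R ^ k * \<bar>x ^ k - g R x\<bar> \<le> 2 * x ^ (2 * k)" by linarith
      thus ?thesis using that by (simp add: field_simps)
    qed
    have gb: "norm (g R x) \<le> R ^ k" if "R > 0" for R x
      unfolding g_def norm_power by (rule power_mono) (use that in auto)
    have gc: "isCont (g R) x" for R x unfolding g_def by (intro continuous_intros)
    have gm[measurable]: "g R \<in> borel_measurable borel" for R unfolding g_def by measurable
    have est: "\<bar>(LINT x|\<rho>. x ^ k) - integral\<^sup>L \<rho> (g R)\<bar> \<le> (2 / R ^ k) * (LINT x|\<rho>. x ^ (2 * k))"
      if "R > 0" and r: "real_distribution \<rho>" "\<And>j. integrable \<rho> (\<lambda>x. x ^ j)" for R \<rho>
    proof -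
      interpret \<rho>: real_distribution \<rho> by fact
      have gi: "integrable \<rho> (g R)"
        by (rule \<rho>.integrable_const_bound[where B = "R ^ k"]) (use gb that in auto)
      have "\<bar>(LINT x|\<rho>. x ^ k) - integral\<^sup>L \<rho> (g R)\<bar> = \<bar>LINT x|\<rho>. x ^ k - g R x\<bar>"
        using gi r by simp
      also have "\<dots> \<le> (LINT x|\<rho>. \<bar>x ^ k - g R x\<bar>)" by (rule integral_abs_bound)
      also have "\<dots> \<le> (LINT x|\<rho>. (2 / R ^ k) * x ^ (2 * k))"
        by (intro integral_mono integrable_abs Bochner_Integration.integrable_diff integrable_mult_right gi r gd that)
      finally show ?thesis by simp
    qed
    have main: "\<bar>(LINT x|\<nu>. x ^ k) - c k\<bar> \<le> 2 * (B + D) / R ^ k" if R: "R > 0" for R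
    proof -
      have 1: "\<bar>(LINT x|\<nu>. x ^ k) - integral\<^sup>L \<nu> (g R)\<bar> \<le> (2 / R ^ k) * D"
        unfolding D_def by (rule est[OF R rdn all])
      have "\<bar>(LINT x|\<mu> n. x ^ k) - integral\<^sup>L (\<mu> n) (g R)\<bar> \<le> (2 / R ^ k) * B" for n
      proof -
        have "(2 / R ^ k) * (LINT x|\<mu> n. x ^ (2 * k)) \<le> (2 / R ^ k) * B"
          using B[of n] R by (intro mult_left_mono) (auto simp: abs_le_iff)
        with est[OF R rd int, of n] show ?thesis by linarith
      qed
      moreover have "(\<lambda>n. \<bar>(LINT x|\<mu> n. x ^ k) - integral\<^sup>L (\<mu> n) (g R)\<bar>) \<longlonglongrightarrow> \<bar>c k - integral\<^sup>L \<nu> (g R)\<bar>"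
        by (intro tendsto_intros lim conv[OF gc gb[OF R]])
      ultimately have "\<bar>c k - integral\<^sup>L \<nu> (g R)\<bar> \<le> (2 / R ^ k) * B"
        by (intro LIMSEQ_le_const2) auto
      with 1 show ?thesis by (simp add: distrib_left add_divide_distrib)
    qed
    have "((\<lambda>n. 2 * (B + D) * inverse (real (Suc n)) ^ k)) \<longlonglongrightarrow> 2 * (B + D) * 0 ^ k"
      by (intro tendsto_intros LIMSEQ_inverse_real_of_nat)
    hence "\<bar>(LINT x|\<nu>. x ^ k) - c k\<bar> \<le> 2 * (B + D) * 0 ^ k"
      by (rule LIMSEQ_le_const) (intro exI[of _ 0] allI impI, use main[OF of_nat_0_less_iff[THEN iffD2, OF zero_less_Suc]] in \<open>simp add: power_inverse divide_inverse\<close>)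
    also have "\<dots> = 0" using False by (simp add: power_0_left)
    finally show ?thesis by simp
  qed
  show ?thesis unfolding has_moments_def using all mom rdn by blast
qed

text \<open>Chebyshev: the mass outside \<open>[-r, r]\<close> is at most \<open>B /
  r\<^sup>2\<close>.\<close>

lemma bounded_second_moments_tight:
  fixes \<mu> :: "nat \<Rightarrow> real measure"
  assumes rd: "\<And>n. real_distribution (\<mu> n)"
    and int: "\<And>n. integrable (\<mu> n) (\<lambda>x. x\<^sup>2)"
    and bd: "\<And>n. (LINT x|\<mu> n. x\<^sup>2) \<le> B"
  shows "tight \<mu>"
  unfolding tight_def
proof (intro conjI allI impI)
  fix e :: real assume e: "e > 0"
  interpret \<mu>: real_distribution "\<mu> n" for n by fact
  have "0 \<le> (LINT x|\<mu> 0. x\<^sup>2)" by simp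
  hence B0: "B \<ge> 0" using bd[of 0] by linarith
  \<comment> \<open>Any radius with \<open>B / r\<^sup>2 < e\<close> works; the summand 1 keeps it positive if \<open>B = 0\<close>.\<close>
  define r where "r = sqrt (2 * (B + 1) / e)"
  have r: "r > 0" "r\<^sup>2 = 2 * (B + 1) / e" using B0 e by (auto simp: r_def)
  have "measure (\<mu> n) {-r<..r} > 1 - e" for n
  proof -
    have "measure (\<mu> n) {x \<in> space (\<mu> n). x\<^sup>2 \<ge> r\<^sup>2} \<le> (LINT x|\<mu> n. x\<^sup>2) / r\<^sup>2"
      by (rule integral_Markov_inequality_measure[where A = "{}"]) (use int r(1) in auto)
    also have "\<dots> \<le> B / r\<^sup>2" using bd by (intro divide_right_mono) auto
    also have "\<dots> < e" using B0 e add_nonneg_pos[of "B * e" "e * 2"] unfolding r by (simp add: field_simps)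
    finally have 1: "measure (\<mu> n) {x. x\<^sup>2 \<ge> r\<^sup>2} < e" by simp
    have "1 - measure (\<mu> n) {-r<..r} = measure (\<mu> n) (space (\<mu> n) - {-r<..r})"
      by (subst \<mu>.prob_compl) auto
    also have "\<dots> \<le> measure (\<mu> n) {x. x\<^sup>2 \<ge> r\<^sup>2}"
    proof (rule \<mu>.finite_measure_mono)
      show "space (\<mu> n) - {-r<..r} \<subseteq> {x. x\<^sup>2 \<ge> r\<^sup>2}"
        using r(1) by (auto simp: abs_le_square_iff[symmetric])
    qed simp
    finally show ?thesis using 1 by linarith
  qed
  moreover have "-r < r" using r by simp
  ultimately show "\<exists>a b. a < b \<and> (\<forall>n. 1 - e < measure (\<mu> n) {a<..b})" by blast
qed (use rd in auto)

text \<open>Every weakly convergent subsequence has a limit with moments \<open>c\<close>, and there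
  is only one such measure; tightness provides a convergent subsequence and then convergence of the
  whole sequence.\<close>

theorem moment_convergence_theorem:
  fixes \<mu> :: "nat \<Rightarrow> real measure"
  assumes c: "\<And>t::real. (\<lambda>k. t ^ (2 * k) / fact (2 * k) * c (2 * k)) \<longlonglongrightarrow> 0"
    and rd: "\<And>n. real_distribution (\<mu> n)"
    and int: "\<And>n k. integrable (\<mu> n) (\<lambda>x. x ^ k)"
    and lim: "\<And>k. (\<lambda>n. LINT x|\<mu> n. x ^ k) \<longlonglongrightarrow> c k"
  shows "\<exists>\<nu>. has_moments \<nu> c \<and> weak_conv_m \<mu> \<nu>"
proof -
  obtain B where B: "\<And>n. norm (LINT x|\<mu> n. x\<^sup>2) \<le> B"
    using BseqE[OF convergent_imp_Bseq[OF convergentI[OF lim[of 2]]]] by metis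
  have tight: "tight \<mu>"
    by (rule bounded_second_moments_tight[of _ B, OF rd int]) (use B in \<open>auto simp: abs_le_iff\<close>)
  have sub: "has_moments \<nu> c" if "strict_mono s" "real_distribution \<nu>" "weak_conv_m (\<mu> \<circ> s) \<nu>" for s \<nu>
  proof (rule weak_limit_has_moments[OF _ that(2) _ _ that(3)])
    show "(\<lambda>n. LINT x|(\<mu> \<circ> s) n. x ^ k) \<longlonglongrightarrow> c k" for k
      using LIMSEQ_subseq_LIMSEQ[OF lim[of k] that(1)] by (simp add: o_def)
  qed (auto intro: rd int)
  obtain r \<nu> where r: "strict_mono r" "real_distribution \<nu>" "weak_conv_m (\<mu> \<circ> id \<circ> r) \<nu>"
    using tight_imp_convergent_subsubsequence[OF tight strict_mono_id] by blast
  hence \<nu>: "has_moments \<nu> c" using sub[of r \<nu>] by simp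
  have "weak_conv_m \<mu> \<nu>"
  proof (rule tight_subseq_weak_converge[OF rd r(2) tight])
    fix s \<rho> assume s: "strict_mono s" "real_distribution \<rho>" "weak_conv_m (\<mu> \<circ> s) \<rho>"
    have "\<rho> = \<nu>" by (rule moments_determine[OF c sub[OF s] \<nu>])
    thus "weak_conv_m (\<mu> \<circ> s) \<nu>" using s by simp
  qed
  with \<nu> show ?thesis by blast
qed

section \<open>Eigenvalue moments are traces of powers\<close>

definition trace_mat :: "'a::comm_ring_1 mat \<Rightarrow> 'a" where
  "trace_mat B = (\<Sum>i<dim_row B. B $$ (i, i))"

lemma trace_mat_comm:
  assumes "A \<in> carrier_mat n n" "B \<in> carrier_mat n n"
  shows "trace_mat (A * B) = trace_mat (B * A)"
proof -
  have "trace_mat (A * B) = (\<Sum>i<n. \<Sum>j<n. A $$ (i, j) * B $$ (j, i))"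
    using assms by (auto simp: trace_mat_def scalar_prod_def lessThan_atLeast0 intro!: sum.cong)
  also have "\<dots> = (\<Sum>j<n. \<Sum>i<n. B $$ (j, i) * A $$ (i, j))"
    by (subst sum.swap) (simp add: mult.commute)
  also have "\<dots> = trace_mat (B * A)"
    using assms by (auto simp: trace_mat_def scalar_prod_def lessThan_atLeast0 intro!: sum.cong)
  finally show ?thesis .
qed

lemma upper_triangular_mult:
  fixes A B :: "'a::comm_ring_1 mat"
  assumes A: "A \<in> carrier_mat n n" "upper_triangular A"
    and B: "B \<in> carrier_mat n n" "upper_triangular B"
  shows "upper_triangular (A * B)" and "\<And>i. i < n \<Longrightarrow> (A * B) $$ (i, i) = A $$ (i, i) * B $$ (i, i)"
proof -
  have e: "(A * B) $$ (i, j) = (\<Sum>l\<in>{0..<n}. A $$ (i, l) * B $$ (l, j))" if "i < n" "j < n" for i j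
    using that A B by (simp add: scalar_prod_def)
  have z: "A $$ (i, l) * B $$ (l, j) = 0" if "i < n" "l < n" "j < i \<or> (j = i \<and> l \<noteq> i)" for i j l
  proof (cases "l < i")
    case True thus ?thesis using upper_triangularD[OF A(2)] A that by simp
  next
    case False
    hence "j < l" using that by linarith
    thus ?thesis using upper_triangularD[OF B(2), of j l] B that by simp
  qed
  show "upper_triangular (A * B)"
      proof (rule upper_triangularI)
    fix i j assume ij: "j < i" "i < dim_row (A * B)"
    have "(A * B) $$ (i, j) = (\<Sum>l\<in>{0..<n}. A $$ (i, l) * B $$ (l, j))" using ij A by (intro e) auto
    also have "\<dots> = 0" using ij A by (intro sum.neutral ballI z) auto
    finally show "(A * B) $$ (i, j) = 0" .
  qed
  fix i assume i: "i < n"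
  have "(\<Sum>l\<in>{0..<n}. A $$ (i, l) * B $$ (l, i)) = (\<Sum>l\<in>{i}. A $$ (i, l) * B $$ (l, i))"
    using i by (intro sum.mono_neutral_right ballI z) auto
  thus "(A * B) $$ (i, i) = A $$ (i, i) * B $$ (i, i)" using i by (simp add: e)
qed

lemma upper_triangular_pow:
  fixes A :: "'a::comm_ring_1 mat"
  assumes A: "A \<in> carrier_mat n n" "upper_triangular A"
  shows "upper_triangular (A ^\<^sub>m k) \<and> (\<forall>i<n. (A ^\<^sub>m k) $$ (i, i) = A $$ (i, i) ^ k)"
proof (induction k)
  case 0
  show ?case using A by (auto intro!: upper_triangularI)
next
  case (Suc k)
  have "A ^\<^sub>m k \<in> carrier_mat n n" using A by simp
  with upper_triangular_mult[OF this _ A] Suc show ?case by simp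
qed

lemma map_poly_of_real_prod_list:
  "map_poly of_real (\<Prod>e\<leftarrow>es. [:- e, 1:]) = (\<Prod>e\<leftarrow>es. [:- of_real e, 1::complex:])"
proof -
  interpret map_poly_comm_ring_hom "of_real :: real \<Rightarrow> complex" ..
  show ?thesis by (induction es) (auto simp: hom_mult simp del: mult_pCons_left)
qed

text \<open>Over the complex numbers the characteristic polynomial is a product of linear factors. A
  root \<open>a\<close> with eigenvector \<open>v\<close> satisfies \<open>v* B v = a
  |v|\<^sup>2\<close>, and both \<open>v* B v\<close> and \<open>|v|\<^sup>2\<close> are real, so
  all roots are real.\<close>

lemma real_symmetric_char_poly_splits:
  assumes B: "(B :: real mat) \<in> carrier_mat n n" and sym: "\<And>i j. i < n \<Longrightarrow> j < n \<Longrightarrow> B $$ (i, j) = B $$ (j, i)"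
  shows "\<exists>es. char_poly B = (\<Prod>e\<leftarrow>es. [:- e, 1:]) \<and> length es = n"
proof -
  define A :: "complex mat" where "A = map_mat of_real B"
  have A: "A \<in> carrier_mat n n" using B by (simp add: A_def)
  from char_poly_factorized[OF A] obtain as where as: "char_poly A = (\<Prod>a\<leftarrow>as. [:- a, 1:])" "length as = n"
    by blast
  have real: "a \<in> \<real>" if a: "a \<in> set as" for a
  proof -
    have "poly (char_poly A) a = 0" using a unfolding as poly_prod_list prod_list_zero_iff
      unfolding set_map by (intro image_eqI[of _ _ "[:- a, 1:]"]) auto
    then obtain v where v: "eigenvector A v a"
      using eigenvalue_root_char_poly[OF A] unfolding eigenvalue_def by blast
    hence v: "v \<in> carrier_vec n" "v \<noteq> 0\<^sub>v n" "A *\<^sub>v v = a \<cdot>\<^sub>v v"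
      using A unfolding eigenvector_def by auto
    have Av: "(\<Sum>j<n. of_real (B $$ (i, j)) * v $ j) = a * v $ i" if "i < n" for i
    proof -
      have "(A *\<^sub>v v) $ i = (\<Sum>j<n. of_real (B $$ (i, j)) * v $ j)"
        using that A B v(1) by (auto simp: A_def scalar_prod_def lessThan_atLeast0 intro!: sum.cong)
      thus ?thesis using v that by simp
    qed
    define S where "S = (\<Sum>i<n. \<Sum>j<n. cnj (v $ i) * (of_real (B $$ (i, j)) * v $ j))"
    define D where "D = (\<Sum>i<n. (cmod (v $ i))\<^sup>2)"
    have "cnj S = (\<Sum>i<n. \<Sum>j<n. v $ i * (of_real (B $$ (i, j)) * cnj (v $ j)))"
      by (simp add: S_def)
    also have "\<dots> = (\<Sum>j<n. \<Sum>i<n. v $ i * (of_real (B $$ (j, i)) * cnj (v $ j)))"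
      by (subst sum.swap) (intro sum.cong refl, simp add: sym)
    also have "\<dots> = S" by (simp add: S_def mult_ac)
    finally have SR: "S \<in> \<real>" by (rule Reals_cnj_iff[THEN iffD2])
    have "S = (\<Sum>i<n. cnj (v $ i) * (a * v $ i))"
      unfolding S_def sum_distrib_left[symmetric] using Av by (intro sum.cong refl) simp
    also have "\<dots> = a * of_real D"
      unfolding D_def of_real_sum sum_distrib_left
      by (intro sum.cong refl) (simp add: complex_norm_square[symmetric] mult_ac)
    finally have SD: "S = a * of_real D" .
    have "\<exists>i<n. v $ i \<noteq> 0"
    proof (rule ccontr)
      assume "\<not> (\<exists>i<n. v $ i \<noteq> 0)"
      hence "v = 0\<^sub>v n" using v(1) by (intro eq_vecI) auto
      thus False using v(2) by simp
    qed
    then obtain i where i: "i < n" "v $ i \<noteq> 0" by blast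
    have "(cmod (v $ i))\<^sup>2 \<le> D" unfolding D_def using i by (intro member_le_sum) auto
    moreover have "0 < (cmod (v $ i))\<^sup>2" using i by simp
    ultimately have "D > 0" by linarith
    hence "a = S / of_real D" using SD by simp
    thus ?thesis using SR by (simp add: Reals_divide)
  qed
  define es where "es = map Re as"
  have as_es: "as = map of_real es"
    unfolding es_def map_map by (rule map_idI[symmetric]) (use real in \<open>auto simp: of_real_Re\<close>)
  have "map_poly of_real (char_poly B) = char_poly A"
    unfolding A_def by (rule of_real_hom.char_poly_hom[OF B, symmetric])
  also have "\<dots> = map_poly of_real (\<Prod>e\<leftarrow>es. [:- e, 1:])"
    unfolding as(1) as_es map_poly_of_real_prod_list by (simp add: o_def)
  finally have "char_poly B = (\<Prod>e\<leftarrow>es. [:- e, 1:])"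
    by (simp add: poly_eq_iff coeff_map_poly)
  moreover have "length es = n" using as(2) by (simp add: es_def)
  ultimately show ?thesis by blast
qed

lemma sum_mset_eq_sum_count:
  fixes f :: "'a \<Rightarrow> real"
  shows "(\<Sum>x\<in>#X. f x) = (\<Sum>x\<in>set_mset X. real (count X x) * f x)"
proof (induction X)
  case (add x X)
  have "(\<Sum>y\<in>set_mset (add_mset x X). real (count (add_mset x X) y) * f y)
      = (\<Sum>y\<in>set_mset (add_mset x X). real (count X y) * f y + (if y = x then f y else 0))"
    by (intro sum.cong refl) (auto simp: algebra_simps)
  also have "\<dots> = (\<Sum>y\<in>set_mset (add_mset x X). real (count X y) * f y) + f x"
    unfolding sum.distrib by simp
  also have "(\<Sum>y\<in>set_mset (add_mset x X). real (count X y) * f y) = (\<Sum>y\<in>set_mset X. real (count X y) * f y)"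
    by (intro sum.mono_neutral_right) (auto simp: not_in_iff)
  finally show ?case using add by simp
qed simp

lemma real_distribution_eigenvalue_distribution: "real_distribution (eigenvalue_distribution B)"
  unfolding eigenvalue_distribution_def
  by (intro prob_space.real_distribution_distr measure_pmf.prob_space_axioms) auto

text \<open>The Schur decomposition makes the matrix similar to an upper triangular one whose
  diagonal lists the eigenvalues, and the diagonal of a power of that matrix consists of the
  powers.\<close>

lemma moment_eigenvalue_distribution:
  assumes B: "(B :: real mat) \<in> carrier_mat n n" and sym: "\<And>i j. i < n \<Longrightarrow> j < n \<Longrightarrow> B $$ (i, j) = B $$ (j, i)"
    and n: "n > 0"
  shows "integrable (eigenvalue_distribution B) (\<lambda>x. x ^ k)"
    and "(LINT x|eigenvalue_distribution B. x ^ k) = trace_mat (B ^\<^sub>m k) / real n"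
proof -
  obtain es where es: "char_poly B = (\<Prod>e\<leftarrow>es. [:- e, 1:])" "length es = n"
    using real_symmetric_char_poly_splits[OF B sym] by blast
  have pr: "proots (char_poly B) = mset es"
    unfolding es(1)
  proof (induction es)
    case (Cons e es)
    have "(\<Prod>e\<leftarrow>es. [:- e, 1:]) \<noteq> 0" by (auto simp: prod_list_zero_iff)
    hence "proots ([:- e, 1:] * (\<Prod>e\<leftarrow>es. [:- e, 1:])) = proots [:- e, 1:] + mset es"
      using Cons by (subst proots_mult) auto
    thus ?case by (simp del: mult_pCons_left)
  qed simp
  have ne: "mset es \<noteq> {#}" using es(2) n by auto
  obtain U P Q where "schur_decomposition B es = (U, P, Q)" by (cases "schur_decomposition B es") auto
  from schur_decomposition[OF B es(1) this]
  have U: "similar_mat_wit B U P Q" "upper_triangular U" "diag_mat U = es" by auto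
  have c: "U \<in> carrier_mat n n" "P \<in> carrier_mat n n" "Q \<in> carrier_mat n n" "Q * P = 1\<^sub>m n"
    using similar_mat_witD2[OF B U(1)] by auto
  have ck: "U ^\<^sub>m k \<in> carrier_mat n n" using c by simp
  have "trace_mat (B ^\<^sub>m k) = trace_mat (P * (U ^\<^sub>m k * Q))"
    using similar_mat_wit_pow_id[OF U(1), of k] assoc_mult_mat[OF c(2) ck c(3)] by simp
  also have "\<dots> = trace_mat ((U ^\<^sub>m k * Q) * P)" using c ck by (intro trace_mat_comm) auto
  also have "\<dots> = trace_mat (U ^\<^sub>m k)" using assoc_mult_mat[OF ck c(3) c(2)] c(4) right_mult_one_mat[OF ck] by simp
  also have "\<dots> = (\<Sum>i<n. U $$ (i, i) ^ k)"
    using upper_triangular_pow[OF c(1) U(2), of k] ck carrier_matD(1)[OF c(1)] by (simp add: trace_mat_def)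
  also have "\<dots> = (\<Sum>e\<leftarrow>es. e ^ k)"
    using c(1) es(2) unfolding U(3)[symmetric] by (simp add: diag_mat_def sum_list_sum_nth lessThan_atLeast0)
  finally have tr: "trace_mat (B ^\<^sub>m k) = (\<Sum>e\<leftarrow>es. e ^ k)" .
  show "integrable (eigenvalue_distribution B) (\<lambda>x. x ^ k)"
    unfolding eigenvalue_distribution_def pr
    by (subst integrable_distr_eq) (auto intro!: integrable_measure_pmf_finite simp: set_pmf_of_multiset[OF ne])
  have "(LINT x|eigenvalue_distribution B. x ^ k) = (LINT x|measure_pmf (pmf_of_multiset (mset es)). x ^ k)"
    unfolding eigenvalue_distribution_def pr by (subst integral_distr) auto
  also have "\<dots> = (\<Sum>x\<in>set_mset (mset es). x ^ k * pmf (pmf_of_multiset (mset es)) x)"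
    by (rule integral_measure_pmf_real) (auto simp: set_pmf_of_multiset[OF ne])
  also have "\<dots> = (\<Sum>x\<in>set_mset (mset es). real (count (mset es) x) * x ^ k) / real n"
    using es(2) unfolding sum_divide_distrib by (intro sum.cong refl) (simp add: pmf_of_multiset[OF ne])
  also have "\<dots> = (\<Sum>x\<in>#mset es. x ^ k) / real n" unfolding sum_mset_eq_sum_count ..
  also have "\<dots> = trace_mat (B ^\<^sub>m k) / real n" unfolding tr by (simp flip: mset_map add: sum_mset_sum_list)
  finally show "(LINT x|eigenvalue_distribution B. x ^ k) = trace_mat (B ^\<^sub>m k) / real n" .
qed

section \<open>Colourings invariant under a permutation\<close>

text \<open>The equivalence relation generated by \<open>\<sigma> x \<sim> x\<close>. Describing it
  by its invariant predicates avoids paths and orbits: a function is constant on the classes if and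
  only if it is invariant.\<close>

definition merged :: "nat \<Rightarrow> (nat \<Rightarrow> nat) \<Rightarrow> nat \<Rightarrow> nat \<Rightarrow> bool" where
  "merged n \<sigma> r q \<longleftrightarrow> (\<forall>f::nat \<Rightarrow> bool. (\<forall>x<n. f (\<sigma> x) = f x) \<longrightarrow> f r = f q)"

lemma merged_invariant:
  assumes "merged n \<sigma> r q" "\<And>x. x < n \<Longrightarrow> g (\<sigma> x) = g x"
  shows "g r = g q"
proof -
  have "(\<lambda>x. g x = g q) r = (\<lambda>x. g x = g q) q"
    using assms(1)[unfolded merged_def, rule_format, of "\<lambda>x. g x = g q"] assms(2) by auto
  thus ?thesis by simp
qed

lemma merged_refl: "merged n \<sigma> r r"
  and merged_sym: "merged n \<sigma> r q \<Longrightarrow> merged n \<sigma> q r"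
  and merged_trans: "merged n \<sigma> r q \<Longrightarrow> merged n \<sigma> q s \<Longrightarrow> merged n \<sigma> r s"
  and merged_step: "x < n \<Longrightarrow> merged n \<sigma> (\<sigma> x) x"
  by (auto simp: merged_def)

definition merged_rep :: "nat \<Rightarrow> (nat \<Rightarrow> nat) \<Rightarrow> nat \<Rightarrow> nat" where
  "merged_rep n \<sigma> r = (LEAST q. merged n \<sigma> r q)"

lemma merged_merged_rep: "merged n \<sigma> r (merged_rep n \<sigma> r)"
  unfolding merged_rep_def by (rule LeastI[of _ r]) (rule merged_refl)

lemma merged_rep_le: "merged_rep n \<sigma> r \<le> r"
  unfolding merged_rep_def by (rule Least_le) (rule merged_refl)

lemma merged_rep_cong: "merged n \<sigma> r q \<Longrightarrow> merged_rep n \<sigma> r = merged_rep n \<sigma> q"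
proof -
  assume "merged n \<sigma> r q"
  hence "merged n \<sigma> r = merged n \<sigma> q" by (intro ext) (blast intro: merged_trans merged_sym)
  thus ?thesis unfolding merged_rep_def by simp
qed

text \<open>If \<open>\<sigma>\<close> is injective and \<open>r\<close> is fixed, then being equal
  to \<open>r\<close> is an invariant predicate.\<close>

lemma merged_fixed_point:
  assumes "inj_on \<sigma> {..<n}" "r < n" "\<sigma> r = r" "merged n \<sigma> r q"
  shows "q = r"
proof -
  have "(r = r) = (q = r)"
    using assms(4)[unfolded merged_def, rule_format, of "\<lambda>x. x = r"] assms(1-3)
    by (smt (verit) inj_onD lessThan_iff)
  thus ?thesis by simp
qed

text \<open>An invariant function is an arbitrary choice of one value for each class, namely its
  value at the least element.\<close>

lemma card_invariant_functions:
  assumes \<sigma>: "\<And>x. x < n \<Longrightarrow> \<sigma> x < n"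
  defines "R \<equiv> {r. r < n \<and> merged_rep n \<sigma> r = r}"
  shows "card {t \<in> PiE {..<n} (\<lambda>_. {..<m::nat}). \<forall>q<n. t q = t (\<sigma> q)} = m ^ card R"
proof -
  let ?S = "{t \<in> PiE {..<n} (\<lambda>_. {..<m}). \<forall>q<n. t q = t (\<sigma> q)}"
  have RS: "R \<subseteq> {..<n}" by (auto simp: R_def)
  have rep: "merged_rep n \<sigma> q \<in> R" if "q < n" for q
    unfolding R_def using merged_rep_le[of n \<sigma> q] that merged_rep_cong[OF merged_merged_rep, of n \<sigma> q] by simp
  have "bij_betw (\<lambda>t. restrict t R) ?S (PiE R (\<lambda>_. {..<m}))"
  proof (rule bij_betw_byWitness[where f' = "\<lambda>u. restrict (\<lambda>q. u (merged_rep n \<sigma> q)) {..<n}"])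
    show "\<forall>t\<in>?S. restrict (\<lambda>q. restrict t R (merged_rep n \<sigma> q)) {..<n} = t"
    proof
      fix t assume t: "t \<in> ?S"
      have "t (merged_rep n \<sigma> q) = t q" if "q < n" for q
        by (rule merged_invariant[OF merged_sym[OF merged_merged_rep]]) (use t in auto)
      thus "restrict (\<lambda>q. restrict t R (merged_rep n \<sigma> q)) {..<n} = t"
        using t rep by (intro ext) (auto simp: PiE_def extensional_def)
    qed
    show "\<forall>u\<in>PiE R (\<lambda>_. {..<m}). restrict (restrict (\<lambda>q. u (merged_rep n \<sigma> q)) {..<n}) R = u"
    proof
      fix u assume u: "u \<in> PiE R (\<lambda>_. {..<m})"
      show "restrict (restrict (\<lambda>q. u (merged_rep n \<sigma> q)) {..<n}) R = u"
        using u by (intro ext) (auto simp: R_def PiE_def extensional_def)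
    qed
    show "(\<lambda>t. restrict t R) ` ?S \<subseteq> PiE R (\<lambda>_. {..<m})" using RS by (auto simp: PiE_def)
    show "(\<lambda>u. restrict (\<lambda>q. u (merged_rep n \<sigma> q)) {..<n}) ` PiE R (\<lambda>_. {..<m}) \<subseteq> ?S"
    proof (intro image_subsetI)
      fix u assume u: "u \<in> PiE R (\<lambda>_. {..<m})"
      show "restrict (\<lambda>q. u (merged_rep n \<sigma> q)) {..<n} \<in> ?S"
        using u rep \<sigma> merged_rep_cong[OF merged_step, of _ n \<sigma>] by (auto simp: PiE_def Pi_def)
    qed
  qed
  hence "card ?S = card (PiE R (\<lambda>_. {..<m}))" by (rule bij_betw_same_card)
  also have "\<dots> = m ^ card R" using RS finite_subset by (subst card_PiE) auto
  finally show ?thesis .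
qed

text \<open>The rows of this matrix are \<open>e\<^sub>q - e\<^bsub>\<sigma> q\<^esub>\<close>. The
  columns outside the set R of class representatives form a maximal independent set: a relation
  between columns with coefficients \<open>g\<close> says that \<open>g\<close> is invariant, so
  \<open>g\<close> vanishes if it vanishes on R; and the columns of a whole class add up to 0, so no
  column indexed by R can be added.\<close>

lemma rank_functional_graph:
  assumes \<sigma>: "\<And>x. x < n \<Longrightarrow> \<sigma> x < n" and inj: "inj_on \<sigma> {..<n}"
  defines "R \<equiv> {r. r < n \<and> merged_rep n \<sigma> r = r}"
    and "A \<equiv> (mat n n (\<lambda>(q, r). (if r = q then 1 else 0) - (if r = \<sigma> q then 1 else 0)) :: real mat)"
  shows "vec_space.rank n A = n - card R"
proof -
  interpret vec_space "TYPE(real)" n .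
  have A: "A \<in> carrier_mat n n" by (simp add: A_def)
  have RS: "R \<subseteq> {..<n}" by (auto simp: R_def)
  have rep: "merged_rep n \<sigma> q \<in> R" if "q < n" for q
    unfolding R_def using merged_rep_le[of n \<sigma> q] that merged_rep_cong[OF merged_merged_rep, of n \<sigma> q] by simp
  \<comment> \<open>Distinct positions may have equal columns only if they are fixed points, where the column is 0.\<close>
  define c where "c r = col A r" for r
  have cc: "c r \<in> carrier_vec n" for r by (simp add: c_def A_def carrier_vecI)
  have ci: "c r $ q = (if r = q then 1 else 0) - (if r = \<sigma> q then 1 else 0)" if "r < n" "q < n" for r q
    using that by (simp add: c_def A_def)
  have cols: "set (cols A) = c ` {..<n}" unfolding c_def cols_def using A by auto
  have nonfix: "\<sigma> r \<noteq> r" if "r < n" "merged n \<sigma> r q" "q \<noteq> r" for r q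
    using merged_fixed_point[OF inj that(1) _ that(2)] that(3) by blast
  have cinj: "r = r'" if "r < n" "r' < n" "c r = c r'" "\<sigma> r \<noteq> r" for r r'
  proof (rule ccontr)
    assume "r \<noteq> r'"
    hence "c r $ r = 1" "c r' $ r \<le> 0"
      using that(4) ci[OF that(1) that(1)] ci[OF that(2) that(1)] by auto
    thus False using that(3) by simp
  qed
  define S where "S = c ` ({..<n} - R)"
  have nR: "\<sigma> r \<noteq> r" if "r < n" "r \<notin> R" for r
    using nonfix[OF that(1) merged_merged_rep] that by (auto simp: R_def)
  have injS: "inj_on c ({..<n} - R)" by (rule inj_onI) (use cinj nR in auto)
  have Sc: "S \<subseteq> carrier_vec n" using cc by (auto simp: S_def)
  have "maximal S (\<lambda>T. T \<subseteq> set (cols A) \<and> lin_indpt T)"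
    unfolding maximal_def
  proof (intro conjI allI impI)
    show "S \<subseteq> set (cols A)" unfolding cols S_def by auto
    show "lin_indpt S"
    proof (rule finite_lin_indpt2)
      show "finite S" by (simp add: S_def)
      show "S \<subseteq> carrier_vec n" by (rule Sc)
      fix a :: "real vec \<Rightarrow> real" assume a: "lincomb a S = 0\<^sub>v n"
      define g where "g r = (if r \<in> {..<n} - R then a (c r) else 0)" for r
      have "g q = g (\<sigma> q)" if q: "q < n" for q
      proof -
        have "0 = lincomb a S $ q" using a q by simp
        also have "\<dots> = (\<Sum>x\<in>S. a x * x $ q)" by (rule lincomb_index[OF q Sc])
        also have "\<dots> = (\<Sum>r\<in>{..<n} - R. a (c r) * c r $ q)" unfolding S_def by (simp add: sum.reindex[OF injS])
        also have "\<dots> = (\<Sum>r\<in>{..<n} - R. g r * ((if r = q then 1 else 0) - (if r = \<sigma> q then 1 else 0)))"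
          by (intro sum.cong refl) (use ci q in \<open>simp add: g_def\<close>)
        also have "\<dots> = (\<Sum>r\<in>{..<n}. g r * ((if r = q then 1 else 0) - (if r = \<sigma> q then 1 else 0)))"
          by (intro sum.mono_neutral_left) (auto simp: g_def)
        also have "\<dots> = g q - g (\<sigma> q)"
          using q \<sigma>[OF q] by (simp add: right_diff_distrib sum_subtractf if_distrib[of "\<lambda>x. _ * x"] cong: if_cong)
        finally show ?thesis by simp
      qed
      hence g: "g r = 0" if "r < n" for r
        proof -
        have "g r = g (merged_rep n \<sigma> r)"
          by (rule merged_invariant[OF merged_merged_rep]) (use \<open>\<And>q. q < n \<Longrightarrow> g q = g (\<sigma> q)\<close> in auto)
        thus ?thesis using rep[OF that] by (simp add: g_def)
      qed
      show "\<forall>v\<in>S. a v = 0"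
      proof
        fix v assume "v \<in> S"
        then obtain r where "r \<in> {..<n} - R" "v = c r" by (auto simp: S_def)
        thus "a v = 0" using g[of r] by (simp add: g_def)
      qed
    qed
    fix T assume "S \<subseteq> T \<and> T \<subseteq> set (cols A) \<and> lin_indpt T"
    hence ST: "S \<subseteq> T" and T: "T \<subseteq> set (cols A) \<and> lin_indpt T" by auto
    show "T = S"
    proof (rule ccontr)
      assume "T \<noteq> S"
      then obtain r where r: "r < n" "c r \<in> T" "c r \<notin> S" using ST T unfolding cols by blast
      hence rR: "r \<in> R" by (auto simp: S_def)
      define Cl where "Cl = {q. q < n \<and> merged n \<sigma> r q}"
      have rC: "r \<in> Cl" using r by (simp add: Cl_def merged_refl)
      have CR: "q \<notin> R" if "q \<in> Cl" "q \<noteq> r" for q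
        using that rR merged_rep_cong[of n \<sigma> r q] by (auto simp: Cl_def R_def)
      have injC: "inj_on c Cl"
      proof (rule inj_onI)
        fix x y assume xy: "x \<in> Cl" "y \<in> Cl" "c x = c y"
        show "x = y"
        proof (rule ccontr)
          assume "x \<noteq> y"
          moreover have "merged n \<sigma> x y" using xy unfolding Cl_def by (blast intro: merged_trans merged_sym)
          ultimately have "\<sigma> x \<noteq> x" using nonfix xy by (auto simp: Cl_def)
          thus False using cinj xy \<open>x \<noteq> y\<close> by (auto simp: Cl_def)
        qed
      qed
      have CT: "c ` Cl \<subseteq> T" using ST r CR by (auto simp: S_def Cl_def)
      have "lincomb (\<lambda>_. 1) (c ` Cl) = 0\<^sub>v n"
      proof (rule eq_vecI)
        fix q assume "q < dim_vec (0\<^sub>v n :: real vec)"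
        hence q: "q < n" by simp
        have "lincomb (\<lambda>_. 1) (c ` Cl) $ q = (\<Sum>x\<in>c ` Cl. 1 * x $ q)"
          by (rule lincomb_index[OF q]) (use cc in auto)
        also have "\<dots> = (\<Sum>x\<in>Cl. c x $ q)" by (simp add: sum.reindex[OF injC])
        also have "\<dots> = (\<Sum>x\<in>Cl. (if x = q then 1 else 0) - (if x = \<sigma> q then 1 else 0))"
          by (intro sum.cong refl) (use ci q in \<open>auto simp: Cl_def\<close>)
        also have "\<dots> = (if q \<in> Cl then 1 else 0) - (if \<sigma> q \<in> Cl then 1 else 0)"
          by (simp add: sum_subtractf Cl_def)
        also have "\<dots> = 0"
        proof -
          have "q \<in> Cl \<longleftrightarrow> \<sigma> q \<in> Cl"
            using q \<sigma>[OF q] merged_step[OF q, of \<sigma>] unfolding Cl_def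
            by (blast intro: merged_trans merged_sym)
          thus ?thesis by simp
        qed
        finally show "lincomb (\<lambda>_. 1) (c ` Cl) $ q = 0\<^sub>v n $ q" using q by simp
      qed (use cc in \<open>auto intro!: lincomb_dim simp: Cl_def\<close>)
      hence "lin_dep T"
        by (intro lin_dep_crit[where A = "c ` Cl" and S = T and a = "\<lambda>_. 1" and v = "c r"]) (use CT rC in \<open>auto simp: Cl_def\<close>)
      thus False using T by blast
    qed
  qed
  hence "rank A = card S" by (rule rank_card_indpt[OF A])
  also have "\<dots> = n - card R" unfolding S_def
    using RS by (simp add: card_image[OF injS] card_Diff_subset finite_subset)
  finally show ?thesis .
qed

lemma card_invariant_functions_rank:
  assumes \<sigma>: "\<And>x. x < n \<Longrightarrow> \<sigma> x < n" and inj: "inj_on \<sigma> {..<n}"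
  defines "A \<equiv> (mat n n (\<lambda>(q, r). (if r = q then 1 else 0) - (if r = \<sigma> q then 1 else 0)) :: real mat)"
  shows "card {t \<in> PiE {..<n} (\<lambda>_. {..<m::nat}). \<forall>q<n. t q = t (\<sigma> q)} = m ^ (n - vec_space.rank n A)"
    and "vec_space.rank n A \<le> n"
proof -
  let ?R = "{r. r < n \<and> merged_rep n \<sigma> r = r}"
  have r: "vec_space.rank n A = n - card ?R" unfolding A_def by (rule rank_functional_graph[OF \<sigma> inj])
  have "card ?R \<le> card {..<n}" by (rule card_mono) auto
  with r show "vec_space.rank n A \<le> n" "card {t \<in> PiE {..<n} (\<lambda>_. {..<m::nat}). \<forall>q<n. t q = t (\<sigma> q)} = m ^ (n - vec_space.rank n A)"
    using card_invariant_functions[OF \<sigma>, where m = m] by auto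
qed

section \<open>Pair partitions\<close>

definition pairings :: "'a set \<Rightarrow> 'a set set set" where
  "pairings S = {P. partition_on S P \<and> (\<forall>V\<in>P. card V = 2)}"

text \<open>Split off the pair that contains a fixed element.\<close>

lemma pairings_step:
  assumes x: "x \<in> S"
  shows "pairings S \<subseteq> (\<Union>y\<in>S - {x}. insert {x, y} ` pairings (S - {x, y}))"
proof
  fix P assume P: "P \<in> pairings S"
  hence part: "partition_on S P" and two: "\<And>V. V \<in> P \<Longrightarrow> card V = 2" by (auto simp: pairings_def)
  obtain V where V: "V \<in> P" "x \<in> V" using part x unfolding partition_on_def by blast
  have "card V = 2" by (rule two[OF V(1)])
  then obtain y where y: "V = {x, y}" "y \<noteq> x" using V(2) by (auto simp: card_2_iff)
  have yS: "y \<in> S - {x}" using y V part unfolding partition_on_def by blast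
  have "partition_on (S - {x, y}) (P - {V})"
    unfolding partition_on_def
  proof (intro conjI)
    have d: "disjoint P" and un: "\<Union>P = S" and ne: "{} \<notin> P" using part unfolding partition_on_def by auto
    have "W \<inter> V = {}" if "W \<in> P - {V}" for W using d that V(1) unfolding disjoint_def by blast
    thus "\<Union>(P - {V}) = S - {x, y}" using un V(1) unfolding y(1)[symmetric] by blast
    show "disjoint (P - {V})" using d unfolding disjoint_def by blast
    show "{} \<notin> P - {V}" using ne by blast
  qed
  hence "P - {V} \<in> pairings (S - {x, y})" using two unfolding pairings_def by blast
  moreover have "P = insert {x, y} (P - {V})" using V(1) y(1) by blast
  ultimately show "P \<in> (\<Union>y\<in>S - {x}. insert {x, y} ` pairings (S - {x, y}))" using yS by blast
qed

lemma card_pairings: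
  assumes "finite S" "card S = 2 * k"
  shows "finite (pairings S) \<and> card (pairings S) \<le> (2 * k) ^ k"
  using assms
proof (induction k arbitrary: S)
  case 0
  hence "S = {}" by simp
  moreover have "pairings ({} :: 'a set) \<subseteq> {{}}" by (auto simp: pairings_def partition_on_def)
  ultimately have "finite (pairings S)" "card (pairings S) \<le> card {{} :: 'a set set}"
    using finite_subset by (blast, metis card_mono finite.emptyI finite.insertI)
  thus ?case by simp
next
  case (Suc k)
  obtain x where x: "x \<in> S" using Suc.prems by fastforce
  have IH: "finite (pairings (S - {x, y})) \<and> card (pairings (S - {x, y})) \<le> (2 * k) ^ k" if "y \<in> S - {x}" for y
    using Suc.prems x that by (intro Suc.IH) (auto simp: card_Diff_subset)
  let ?U = "\<Union>y\<in>S - {x}. insert {x, y} ` pairings (S - {x, y})"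
  have fU: "finite ?U" using IH Suc.prems by blast
  have "card ?U \<le> (\<Sum>y\<in>S - {x}. card (insert {x, y} ` pairings (S - {x, y})))"
    using Suc.prems by (intro card_UN_le) auto
  also have "\<dots> \<le> (\<Sum>y\<in>S - {x}. (2 * k) ^ k)"
    by (intro sum_mono) (meson IH card_image_le le_trans)
  also have "\<dots> = (2 * k + 1) * (2 * k) ^ k" using Suc.prems x by (simp add: card_Diff_singleton)
  also have "\<dots> \<le> (2 * Suc k) * (2 * Suc k) ^ k" by (intro mult_mono power_mono) auto
  finally have "card ?U \<le> (2 * Suc k) ^ Suc k" by simp
  thus ?case using pairings_step[OF x] fU by (meson card_mono finite_subset le_trans)
qed

lemma pair_partitions_eq_pairings: "pair_partitions k = pairings {1..2 * k}"
  by (simp add: pair_partitions_def pairings_def)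

lemma finite_pair_partitions: "finite (pair_partitions k)"
  and card_pair_partitions_le: "card (pair_partitions k) \<le> (2 * k) ^ k"
  using card_pairings[of "{1..2 * k}" k] unfolding pair_partitions_eq_pairings by auto

text \<open>What the limiting integral uses of a pair partition: an involution \<open>part\<close>
  that reverses the sign \<open>e\<close>, and labels \<open>1, ..., k\<close> of its orbits.
  Positions are 1-based as in the definition of the integral. Signs are integers here, since they
  also act on lattice points.\<close>

locale labelled_pairing =
  fixes k :: nat and e :: "nat \<Rightarrow> int" and lab part :: "nat \<Rightarrow> nat"
  assumes part_in: "q \<in> {1..2 * k} \<Longrightarrow> part q \<in> {1..2 * k}"
    and part_part: "q \<in> {1..2 * k} \<Longrightarrow> part (part q) = q"
    and sign_cases: "e q = 1 \<or> e q = - 1"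
    and sign_part: "q \<in> {1..2 * k} \<Longrightarrow> e (part q) = - e q"
    and lab_image: "lab ` {1..2 * k} = {1..k}"
    and lab_eq_iff: "q \<in> {1..2 * k} \<Longrightarrow> r \<in> {1..2 * k} \<Longrightarrow> lab q = lab r \<longleftrightarrow> r = q \<or> r = part q"
begin

lemma lab_part: "q \<in> {1..2 * k} \<Longrightarrow> lab (part q) = lab q"
  using lab_eq_iff[of q "part q"] part_in by simp

text \<open>The involution \<open>part\<close> pairs each term with its negative.\<close>

lemma signed_sum_zero: "(\<Sum>i\<in>{1..2 * k}. e i * f (lab i)) = (0::int)"
proof -
  have bij: "bij_betw part {1..2 * k} {1..2 * k}"
    by (rule bij_betw_byWitness[where f' = part]) (use part_in part_part in auto)
  have "(\<Sum>i\<in>{1..2 * k}. e i * f (lab i)) = (\<Sum>i\<in>{1..2 * k}. e (part i) * f (lab (part i)))"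
    by (rule sum.reindex_bij_betw[OF bij, symmetric])
  also have "\<dots> = (\<Sum>i\<in>{1..2 * k}. - (e i * f (lab i)))"
    by (intro sum.cong refl) (simp add: sign_part lab_part)
  finally show ?thesis by (simp add: sum_negf)
qed

end

context
  fixes k :: nat and \<pi> :: "nat set set"
  assumes \<pi>: "\<pi> \<in> pair_partitions k"
begin

lemma block_of_eq: "V \<in> \<pi> \<Longrightarrow> q \<in> V \<Longrightarrow> block_of \<pi> q = V"
  using \<pi> unfolding block_of_def pair_partitions_def partition_on_def disjoint_def
  by (intro the_equality) blast+

lemma block_of_in: "q \<in> {1..2 * k} \<Longrightarrow> block_of \<pi> q \<in> \<pi> \<and> q \<in> block_of \<pi> q"
proof -
  assume "q \<in> {1..2 * k}"
  hence "q \<in> \<Union>\<pi>" using \<pi> unfolding pair_partitions_def partition_on_def by blast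
  then obtain V where "V \<in> \<pi>" "q \<in> V" by blast
  thus ?thesis using block_of_eq by simp
qed

lemma block_subset: "V \<in> \<pi> \<Longrightarrow> V \<subseteq> {1..2 * k}"
  using \<pi> unfolding pair_partitions_def partition_on_def by blast

lemma block_card: "V \<in> \<pi> \<Longrightarrow> card V = 2"
  using \<pi> unfolding pair_partitions_def by blast

lemma block_of_pair:
  assumes q: "q \<in> {1..2 * k}"
  shows "block_of \<pi> q = {q, partner \<pi> q}" "partner \<pi> q \<noteq> q"
proof -
  have "card (block_of \<pi> q) = 2" "q \<in> block_of \<pi> q" using block_of_in[OF q] block_card by auto
  hence "card (block_of \<pi> q - {q}) = 1" by (simp add: card_Diff_singleton)
  then obtain r where r': "block_of \<pi> q - {q} = {r}" by (rule card_1_singletonE)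
  hence r: "block_of \<pi> q = {q, r}" "r \<noteq> q" using \<open>q \<in> block_of \<pi> q\<close> by auto
  from r' have "partner \<pi> q = r" unfolding partner_def by simp
  with r show "block_of \<pi> q = {q, partner \<pi> q}" "partner \<pi> q \<noteq> q" by auto
qed

lemma partner_in: "q \<in> {1..2 * k} \<Longrightarrow> partner \<pi> q \<in> {1..2 * k}"
  using block_of_pair[of q] block_of_in[of q] block_subset by blast

lemma block_of_partner: "q \<in> {1..2 * k} \<Longrightarrow> block_of \<pi> (partner \<pi> q) = block_of \<pi> q"
  using block_of_pair[of q] block_of_in[of q] by (intro block_of_eq) auto

lemma partner_partner: "q \<in> {1..2 * k} \<Longrightarrow> partner \<pi> (partner \<pi> q) = q"
  using block_of_pair[of q] block_of_pair[of "partner \<pi> q"] block_of_partner[of q] partner_in[of q]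
  by (metis doubleton_eq_iff)

lemma blocks_finite: "finite \<pi>"
  using \<pi> finite_elements[of "{1..2 * k}" \<pi>] unfolding pair_partitions_def by simp

lemma blocks_image: "\<pi> = block_of \<pi> ` {1..2 * k}"
proof -
  have "V \<in> block_of \<pi> ` {1..2 * k}" if "V \<in> \<pi>" for V
  proof -
    have "V \<noteq> {}" using block_card[OF that] by auto
    then obtain q where "q \<in> V" by blast
    thus ?thesis using block_of_eq[OF that] block_subset[OF that] by blast
  qed
  thus ?thesis using block_of_in by blast
qed

lemma card_blocks: "card \<pi> = k"
proof -
  have "card (\<Union>\<pi>) = sum card \<pi>"
    using \<pi> block_subset unfolding pair_partitions_def partition_on_def
    by (intro card_Union_disjoint) (auto intro: finite_subset simp: disjoint_def pairwise_def disjnt_def)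
  also have "\<dots> = 2 * card \<pi>" using block_card by simp
  also have "\<Union>\<pi> = {1..2 * k}" using \<pi> unfolding pair_partitions_def partition_on_def by blast
  finally show ?thesis by simp
qed

lemma Min_block_inj: "inj_on Min \<pi>"
proof (rule inj_onI)
  fix V W assume VW: "V \<in> \<pi>" "W \<in> \<pi>" "Min V = Min W"
  have "Min V \<in> V" "Min W \<in> W"
    using block_card[OF VW(1)] block_card[OF VW(2)] by (auto intro!: Min_in simp: card_eq_0_iff intro: card_ge_0_finite)
  thus "V = W" using block_of_eq VW by metis
qed

text \<open>The label of a block is its rank in the order of least elements, and these are
  distinct.\<close>

lemma rank_of_block: "bij_betw (\<lambda>V. card {W \<in> \<pi>. Min W \<le> Min V}) \<pi> {1..k}"
proof -
  let ?r = "\<lambda>V. card {W \<in> \<pi>. Min W \<le> Min V}"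
  have inj: "inj_on ?r \<pi>"
  proof (rule inj_onI, rule ccontr)
    fix V W assume VW: "V \<in> \<pi>" "W \<in> \<pi>" "?r V = ?r W" "V \<noteq> W"
    have ne: "Min V \<noteq> Min W" using VW Min_block_inj by (auto dest: inj_onD)
    have less: "?r X < ?r Y" if "X \<in> \<pi>" "Y \<in> \<pi>" "Min X < Min Y" for X Y
    proof (rule psubset_card_mono)
      have "Y \<in> {W \<in> \<pi>. Min W \<le> Min Y}" "Y \<notin> {W \<in> \<pi>. Min W \<le> Min X}" using that by auto
      moreover have "{W \<in> \<pi>. Min W \<le> Min X} \<subseteq> {W \<in> \<pi>. Min W \<le> Min Y}" using that(3) by auto
      ultimately show "{W \<in> \<pi>. Min W \<le> Min X} \<subset> {W \<in> \<pi>. Min W \<le> Min Y}" by blast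
    qed (use blocks_finite in simp)
    show False using less[of V W] less[of W V] VW ne by linarith
  qed
  have "?r ` \<pi> \<subseteq> {1..k}"
  proof (intro image_subsetI)
    fix V assume V: "V \<in> \<pi>"
    have "card {V} \<le> ?r V" by (rule card_mono) (use V blocks_finite in auto)
    moreover have "?r V \<le> card \<pi>" by (rule card_mono) (use blocks_finite in auto)
    ultimately show "?r V \<in> {1..k}" using card_blocks by simp
  qed
  moreover have "card (?r ` \<pi>) = card {1..k}" using card_image[OF inj] card_blocks by simp
  ultimately have "?r ` \<pi> = {1..k}" by (intro card_subset_eq) auto
  thus ?thesis using inj unfolding bij_betw_def by blast
qed

lemma labelled_pairing_of_partition:
  "labelled_pairing k (\<lambda>q. if q = Min (block_of \<pi> q) then 1 else - 1) (label \<pi>) (partner \<pi>)"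
proof
  have lab: "label \<pi> q = (\<lambda>V. card {W \<in> \<pi>. Min W \<le> Min V}) (block_of \<pi> q)" for q
    unfolding label_def by simp
  fix q assume q: "q \<in> {1..2 * k}"
  show "partner \<pi> q \<in> {1..2 * k}" "partner \<pi> (partner \<pi> q) = q" by (fact partner_in[OF q], fact partner_partner[OF q])
  show "(if partner \<pi> q = Min (block_of \<pi> (partner \<pi> q)) then 1 else - 1) = - (if q = Min (block_of \<pi> q) then 1 else - 1 :: int)"
    unfolding block_of_partner[OF q] block_of_pair(1)[OF q]
    using block_of_pair(2)[OF q] by (auto simp: min_def)
  fix r assume r: "r \<in> {1..2 * k}"
  have "label \<pi> q = label \<pi> r \<longleftrightarrow> block_of \<pi> q = block_of \<pi> r"
    unfolding lab using inj_on_eq_iff[OF bij_betw_imp_inj_on[OF rank_of_block]] block_of_in q r by blast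
  also have "block_of \<pi> q = block_of \<pi> r \<longleftrightarrow> r = q \<or> r = partner \<pi> q"
    using block_of_pair(1)[OF q] block_of_in[OF r] block_of_partner[OF q] by auto
  finally show "label \<pi> q = label \<pi> r \<longleftrightarrow> r = q \<or> r = partner \<pi> q" .
next
  have "label \<pi> ` {1..2 * k} = (\<lambda>V. card {W \<in> \<pi>. Min W \<le> Min V}) ` block_of \<pi> ` {1..2 * k}"
    unfolding image_image by (simp add: label_def)
  also have "\<dots> = {1..k}" unfolding blocks_image[symmetric] by (rule bij_betw_imp_surj_on[OF rank_of_block])
  finally show "label \<pi> ` {1..2 * k} = {1..k}" .
qed auto

end

lemma pair_partition_eqI:
  assumes "\<pi> \<in> pair_partitions k" "\<rho> \<in> pair_partitions k"
    "\<And>q. q \<in> {1..2 * k} \<Longrightarrow> partner \<pi> q = partner \<rho> q"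
  shows "\<pi> = \<rho>"
proof -
  have "block_of \<pi> ` {1..2 * k} = block_of \<rho> ` {1..2 * k}"
    by (intro image_cong refl) (simp add: block_of_pair(1)[OF assms(1)] block_of_pair(1)[OF assms(2)] assms(3))
  thus ?thesis using blocks_image[OF assms(1)] blocks_image[OF assms(2)] by simp
qed

lemma pair_partition_of_involution:
  assumes f: "\<And>q. q \<in> {1..2 * k} \<Longrightarrow> f q \<in> {1..2 * k} \<and> f q \<noteq> q \<and> f (f q) = q"
  shows "\<exists>\<pi>\<in>pair_partitions k. \<forall>q\<in>{1..2 * k}. partner \<pi> q = f q"
proof -
  define \<pi> where "\<pi> = (\<lambda>q. {q, f q}) ` {1..2 * k}"
  have "partition_on {1..2 * k} \<pi>"
    unfolding partition_on_def
  proof (intro conjI)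
    show "\<Union>\<pi> = {1..2 * k}" using f unfolding \<pi>_def by blast
    show "{} \<notin> \<pi>" unfolding \<pi>_def by blast
    show "disjoint \<pi>"
    proof (rule disjointI)
      fix V W assume "V \<in> \<pi>" "W \<in> \<pi>" "V \<noteq> W"
      moreover have "U = {x, f x}" if U: "U \<in> \<pi>" "x \<in> U" for U x
      proof -
        obtain q where q: "q \<in> {1..2 * k}" "U = {q, f q}" using U(1) unfolding \<pi>_def by blast
        consider "x = q" | "x = f q" using U(2) q by blast
        thus ?thesis using f[OF q(1)] q(2) by cases auto
      qed
      ultimately show "V \<inter> W = {}" by blast
    qed
  qed
  moreover have "card V = 2" if "V \<in> \<pi>" for V
  proof -
    from that obtain q where q: "q \<in> {1..2 * k}" "V = {q, f q}" unfolding \<pi>_def by (rule imageE) simp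
    have "q \<noteq> f q" using f[OF q(1)] by metis
    thus ?thesis unfolding q(2) by (rule card_2_iff[THEN iffD2, OF exI, OF exI, OF conjI, OF refl])
  qed
  ultimately have \<pi>: "\<pi> \<in> pair_partitions k" unfolding pair_partitions_def by blast
  have "partner \<pi> q = f q" if q: "q \<in> {1..2 * k}" for q
  proof -
    have "block_of \<pi> q = {q, f q}" by (rule block_of_eq[OF \<pi>]) (use q in \<open>auto simp: \<pi>_def\<close>)
    hence "{q, partner \<pi> q} = {q, f q}" using block_of_pair(1)[OF \<pi> q] by simp
    thus ?thesis using block_of_pair(2)[OF \<pi> q] unfolding doubleton_eq_iff by auto
  qed
  with \<pi> show ?thesis by blast
qed

section \<open>Counting closed walks by their steps\<close>

text \<open>The step is taken from position q to its cyclic successor and has the sign of the block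
  index in row \<open>I q\<close> and column \<open>I (Suc q)\<close>.\<close>

definition closed_step :: "nat \<Rightarrow> (nat \<Rightarrow> nat) \<Rightarrow> nat \<Rightarrow> int" where
  "closed_step n I q = int (I q) - int (I (Suc q mod n))"

abbreviation walks :: "nat \<Rightarrow> nat \<Rightarrow> (nat \<Rightarrow> nat) set" where
  "walks n N \<equiv> PiE {..<n} (\<lambda>_. {..<N})"

lemma sum_cyclic_shift:
  fixes f :: "nat \<Rightarrow> 'a::comm_monoid_add"
  shows "(\<Sum>q<n. f (Suc q mod n)) = (\<Sum>q<n. f q)"
proof (cases n)
  case (Suc k)
  have "(\<Sum>q<n. f (Suc q mod n)) = (\<Sum>q<k. f (Suc q)) + f 0"
    unfolding Suc by (simp add: Suc_lessI)
  also have "\<dots> = (\<Sum>q<n. f q)" unfolding Suc sum.lessThan_Suc_shift by (simp add: add.commute)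
  finally show ?thesis .
qed simp

lemma sum_closed_step: "(\<Sum>q<n. closed_step n I q) = 0"
  unfolding closed_step_def sum_subtractf sum_cyclic_shift[of "\<lambda>q. int (I q)"] by simp

lemma closed_step_bound:
  assumes "I \<in> walks n N" "q < n"
  shows "\<bar>closed_step n I q\<bar> \<le> int N"
proof -
  have "Suc q mod n < n" using assms by auto
  hence "I q < N" "I (Suc q mod n) < N"
    using PiE_mem[OF assms(1), of q] PiE_mem[OF assms(1), of "Suc q mod n"] assms(2) by simp_all
  thus ?thesis unfolding closed_step_def by linarith
qed

lemma walk_determined:
  assumes "I \<in> walks n N" "I' \<in> walks n N" "I 0 = I' 0"
    "\<And>q. q < n \<Longrightarrow> closed_step n I q = closed_step n I' q"
  shows "I = I'"
proof (rule PiE_ext[OF assms(1,2)])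
  fix q assume "q \<in> {..<n}"
  hence "q < n" by simp
  thus "I q = I' q"
  proof (induction q)
    case (Suc q)
    have "closed_step n I q = closed_step n I' q" using Suc by (intro assms) auto
    thus ?case using Suc by (simp add: closed_step_def)
  qed (use assms in simp)
qed

text \<open>Several closed walks at once; the argument is the pair of a walk and a position in
  it.\<close>

definition family_step :: "nat \<Rightarrow> (nat \<Rightarrow> nat \<Rightarrow> nat) \<Rightarrow> nat \<times> nat \<Rightarrow> int" where
  "family_step n g x = closed_step n (g (fst x)) (snd x)"

text \<open>The homogeneous linear relations that hold for the difference \<open>u\<close> of two
  families of steps with the same coincidences \<open>s x = s y\<close> and \<open>s x = - s
  y\<close>.\<close>

definition step_relation :: "nat \<Rightarrow> nat set \<Rightarrow> (nat \<times> nat \<Rightarrow> int) \<Rightarrow> (nat \<times> nat \<Rightarrow> int) \<Rightarrow> bool" where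
  "step_relation n J s u \<longleftrightarrow>
     (\<forall>x\<in>J \<times> {..<n}. \<forall>y\<in>J \<times> {..<n}. (s x = s y \<longrightarrow> u x = u y) \<and> (s x = - s y \<longrightarrow> u x = - u y)) \<and>
     (\<forall>j\<in>J. (\<Sum>q<n. u (j, q)) = 0)"

lemma step_relation_sum: "step_relation n J s u \<Longrightarrow> j \<in> J \<Longrightarrow> (\<Sum>q<n. u (j, q)) = 0"
  unfolding step_relation_def by blast

text \<open>A family is determined by its starting points and its steps, so it suffices to know the
  steps on F.\<close>

lemma card_determined_families:
  assumes J: "finite J" and F: "F \<subseteq> J \<times> {..<n}" and n: "n > 0"
    and S: "S \<subseteq> PiE J (\<lambda>_. walks n N)"
    and det: "\<And>g g' x. g \<in> S \<Longrightarrow> g' \<in> S \<Longrightarrow> (\<And>y. y \<in> F \<Longrightarrow> family_step n g y = family_step n g' y) \<Longrightarrow>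
        x \<in> J \<times> {..<n} \<Longrightarrow> family_step n g x = family_step n g' x"
  shows "card S \<le> N ^ card J * (2 * N + 1) ^ card F"
proof -
  have fF: "finite F" using F J finite_subset by blast
  let ?\<phi> = "\<lambda>g. (restrict (\<lambda>j. g j 0) J, restrict (family_step n g) F)"
  let ?T = "PiE J (\<lambda>_. {..<N}) \<times> PiE F (\<lambda>_. {- int N..int N})"
  have "inj_on ?\<phi> S"
  proof (rule inj_onI)
    fix g g' assume g: "g \<in> S" "g' \<in> S" and eq: "?\<phi> g = ?\<phi> g'"
    have s0: "g j 0 = g' j 0" if "j \<in> J" for j
      using eq that by (auto dest!: fun_cong[of _ _ j])
    have sF: "family_step n g y = family_step n g' y" if "y \<in> F" for y
      using eq that by (auto dest!: fun_cong[of _ _ y])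
    have st: "family_step n g x = family_step n g' x" if "x \<in> J \<times> {..<n}" for x
      by (rule det[OF g sF that])
    show "g = g'"
    proof (rule PiE_ext)
      show "g \<in> PiE J (\<lambda>_. walks n N)" "g' \<in> PiE J (\<lambda>_. walks n N)" using S g by auto
      fix j assume j: "j \<in> J"
      have "closed_step n (g j) q = closed_step n (g' j) q" if "q < n" for q
        using st[of "(j, q)"] that j by (simp add: family_step_def)
      moreover have "g j \<in> walks n N" "g' j \<in> walks n N" using S g j by auto
      ultimately show "g j = g' j" using walk_determined s0[OF j] by blast
    qed
  qed
  moreover have "?\<phi> ` S \<subseteq> ?T"
  proof (intro image_subsetI)
    fix g assume g: "g \<in> S"
    have w: "g j \<in> walks n N" if "j \<in> J" for j using S g that by auto
    have "family_step n g y \<in> {- int N..int N}" if "y \<in> F" for y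
      using closed_step_bound[OF w, of "fst y" "snd y"] that F unfolding family_step_def
      by (auto simp: abs_le_iff)
    moreover have "g j 0 \<in> {..<N}" if "j \<in> J" for j using w[OF that] n by (auto simp: PiE_def)
    ultimately show "?\<phi> g \<in> ?T" by auto
  qed
  moreover have "finite ?T" using J fF by (intro finite_cartesian_product finite_PiE) auto
  ultimately have "card S \<le> card ?T" by (rule card_inj_on_le)
  also have "\<dots> = N ^ card J * (2 * N + 1) ^ card F"
  proof -
    have "card {- int N..int N} = 2 * N + 1" by simp
    thus ?thesis using J fF by (simp add: card_cartesian_product card_PiE)
  qed
  finally show ?thesis .
qed

text \<open>The first factor counts the possible patterns of coincidences \<open>s x = \<plusminus>
  s y\<close>; the second absorbs the replacement of \<open>2 N + 1\<close> by \<open>3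
  N\<close>.\<close>

definition step_value_constant :: "nat \<Rightarrow> nat \<Rightarrow> nat \<Rightarrow> nat" where
  "step_value_constant l n f = 2 ^ (2 * (l * n)\<^sup>2) * 3 ^ f"

text \<open>The counting principle for walks. Families are sorted by their pattern of coincidences,
  of which there are boundedly many. Within a pattern, a family is determined by its starting points
  and by one step for each absolute value in a set V, provided that a solution of the linear
  relations of the pattern that vanishes on the classes of V vanishes identically. The exponent of N
  is the number of walks plus the size of V.\<close>

lemma card_families_by_free_values:
  assumes J: "finite J" and n: "n > 0" and N: "N > 0"
    and S: "S \<subseteq> PiE J (\<lambda>_. walks n N)"
    and free: "\<And>g. g \<in> S \<Longrightarrow> \<exists>V \<subseteq> (\<lambda>x. \<bar>family_step n g x\<bar>) ` (J \<times> {..<n}). card V \<le> f \<and>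
       (\<forall>u. step_relation n J (family_step n g) u \<longrightarrow>
          (\<forall>x\<in>J \<times> {..<n}. \<bar>family_step n g x\<bar> \<in> V \<longrightarrow> u x = 0) \<longrightarrow> (\<forall>x\<in>J \<times> {..<n}. u x = 0))"
  shows "card S \<le> step_value_constant (card J) n f * N ^ (card J + f)"
proof -
  let ?Q = "J \<times> {..<n}"
  have fQ: "finite ?Q" using J by simp
  \<comment> \<open>The pattern of coincidences of a family.\<close>
  define cert where "cert g = ({(x, y) \<in> ?Q \<times> ?Q. family_step n g x = family_step n g y},
     {(x, y) \<in> ?Q \<times> ?Q. family_step n g x = - family_step n g y})" for g
  define C where "C = Pow (?Q \<times> ?Q) \<times> Pow (?Q \<times> ?Q)"
  have certC: "cert g \<in> C" for g by (auto simp: cert_def C_def)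
  have fC: "finite C" using fQ by (auto simp: C_def)
  have cC: "card C = 2 ^ (2 * (card J * n)\<^sup>2)"
    unfolding C_def using fQ
    by (simp add: card_cartesian_product card_Pow power2_eq_square flip: power_add)
  have fS: "finite S" by (rule finite_subset[OF S]) (intro finite_PiE J finite_lessThan)
  have bound: "card {g\<in>S. cert g = c} \<le> N ^ card J * (3 * N) ^ f" for c
  proof (cases "{g\<in>S. cert g = c} = {}")
    case False
    then obtain g0 where g0: "g0 \<in> S" "cert g0 = c" by auto
    let ?D = "(\<lambda>x. \<bar>family_step n g0 x\<bar>) ` ?Q"
    from free[OF g0(1)] obtain V where V: "V \<subseteq> ?D" "card V \<le> f"
      and Vd: "\<forall>u. step_relation n J (family_step n g0) u \<longrightarrow>
         (\<forall>x\<in>?Q. \<bar>family_step n g0 x\<bar> \<in> V \<longrightarrow> u x = 0) \<longrightarrow> (\<forall>x\<in>?Q. u x = 0)"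
      by (elim exE conjE)
    \<comment> \<open>One position for each value in V.\<close>
    obtain F where F: "F \<subseteq> ?Q" "inj_on (\<lambda>x. \<bar>family_step n g0 x\<bar>) F" "(\<lambda>x. \<bar>family_step n g0 x\<bar>) ` F = V"
      using V(1) unfolding subset_image_inj by blast
    have cF: "card F = card V" using card_image[OF F(2)] F(3) by simp
    have "card {g\<in>S. cert g = c} \<le> N ^ card J * (2 * N + 1) ^ card F"
    proof (rule card_determined_families[OF J F(1) n])
      show "{g\<in>S. cert g = c} \<subseteq> PiE J (\<lambda>_. walks n N)" using S by auto
      fix g g' x assume g: "g \<in> {g\<in>S. cert g = c}" "g' \<in> {g\<in>S. cert g = c}"
        and eq: "\<And>y. y \<in> F \<Longrightarrow> family_step n g y = family_step n g' y" and x: "x \<in> ?Q"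
      define u where "u = (\<lambda>x. family_step n g x - family_step n g' x)"
      have ce: "(family_step n h y = family_step n h z \<longleftrightarrow> family_step n g0 y = family_step n g0 z) \<and>
           (family_step n h y = - family_step n h z \<longleftrightarrow> family_step n g0 y = - family_step n g0 z)"
        if "h \<in> {g\<in>S. cert g = c}" "y \<in> ?Q" "z \<in> ?Q" for h y z
      proof -
        have "cert h = cert g0" using that g0 by auto
        hence "(y, z) \<in> fst (cert h) \<longleftrightarrow> (y, z) \<in> fst (cert g0)" "(y, z) \<in> snd (cert h) \<longleftrightarrow> (y, z) \<in> snd (cert g0)"
          by auto
        thus ?thesis using that(2,3) by (simp add: cert_def)
      qed
      have rel: "step_relation n J (family_step n g0) u"
        unfolding step_relation_def
      proof (intro conjI ballI)
        fix y z assume yz: "y \<in> ?Q" "z \<in> ?Q"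
        show "(family_step n g0 y = family_step n g0 z \<longrightarrow> u y = u z)"
          "(family_step n g0 y = - family_step n g0 z \<longrightarrow> u y = - u z)"
          using ce[OF g(1) yz] ce[OF g(2) yz] by (auto simp: u_def)
      next
        fix j
        show "(\<Sum>q<n. u (j, q)) = 0"
          by (simp add: u_def family_step_def sum_subtractf sum_closed_step)
      qed
      have "u x = 0" if x: "x \<in> ?Q" for x
      proof (rule Vd[rule_format, OF rel])
        fix y assume y: "y \<in> ?Q" "\<bar>family_step n g0 y\<bar> \<in> V"
        then obtain z where z: "z \<in> F" "\<bar>family_step n g0 y\<bar> = \<bar>family_step n g0 z\<bar>" using F(3) by auto
        have "u z = 0" using eq[OF z(1)] by (simp add: u_def)
        moreover have "family_step n g0 y = family_step n g0 z \<or> family_step n g0 y = - family_step n g0 z"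
          using z(2) by linarith
        moreover have "z \<in> ?Q" using z F by auto
        ultimately show "u y = 0" using rel y(1) unfolding step_relation_def by (metis neg_equal_0_iff_equal)
      qed (rule x)
      thus "family_step n g x = family_step n g' x" using x by (simp add: u_def)
    qed
    also have "\<dots> \<le> N ^ card J * (3 * N) ^ f"
    proof (rule mult_left_mono)
      have "(2 * N + 1) ^ card F \<le> (3 * N) ^ card F" using N by (intro power_mono) auto
      also have "\<dots> \<le> (3 * N) ^ f" using V(2) cF N by (intro power_increasing) auto
      finally show "(2 * N + 1) ^ card F \<le> (3 * N) ^ f" .
    qed simp
    finally show ?thesis .
  qed (simp only: card.empty)
  have "(\<Union>c\<in>C. {g\<in>S. cert g = c}) = S" using certC by blast
  hence "card S \<le> (\<Sum>c\<in>C. card {g\<in>S. cert g = c})"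
    using card_UN_le[OF fC, of "\<lambda>c. {g\<in>S. cert g = c}"] by simp
  also have "\<dots> \<le> card C * (N ^ card J * (3 * N) ^ f)"
    using sum_bounded_above[of C "\<lambda>c. card {g\<in>S. cert g = c}" "N ^ card J * (3 * N) ^ f"] bound by simp
  also have "\<dots> = step_value_constant (card J) n f * N ^ (card J + f)"
    unfolding cC step_value_constant_def by (simp add: power_mult_distrib power_add)
  finally show ?thesis .
qed

lemma single_term_zero:
  fixes u :: "nat \<times> nat \<Rightarrow> int"
  assumes "(\<Sum>q<n. u (j, q)) = 0" "q0 < n" "\<And>q. q < n \<Longrightarrow> q \<noteq> q0 \<Longrightarrow> u (j, q) = 0"
  shows "u (j, q0) = 0"
proof -
  have "(\<Sum>q<n. u (j, q)) = (\<Sum>q\<in>{q0}. u (j, q))"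
    by (rule sum.mono_neutral_right) (use assms in auto)
  thus ?thesis using assms by simp
qed

lemma sum_card_fibres:
  assumes "finite A"
  shows "(\<Sum>v\<in>s ` A. card {x\<in>A. s x = v}) = card A"
  using assms sum.image_gen[OF assms, of "\<lambda>_. 1::nat" s] by simp

definition repeated :: "'a set \<Rightarrow> ('a \<Rightarrow> 'b) \<Rightarrow> bool" where
  "repeated A s \<longleftrightarrow> (\<forall>x\<in>A. \<exists>y\<in>A. y \<noteq> x \<and> s y = s x)"

lemma repeated_fibre:
  assumes "finite A" "repeated A s" "v \<in> s ` A"
  shows "2 \<le> card {x\<in>A. s x = v}"
proof -
  obtain x where x: "x \<in> A" "s x = v" using assms by auto
  then obtain y where "y \<in> A" "y \<noteq> x" "s y = s x" using assms unfolding repeated_def by blast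
  hence "{x, y} \<subseteq> {x\<in>A. s x = v}" "card {x, y} = 2" using x by auto
  thus ?thesis using card_mono[of "{x\<in>A. s x = v}" "{x, y}"] assms(1) by simp
qed

lemma repeated_card_image:
  assumes "finite A" "repeated A s" 
  shows "2 * card (s ` A) \<le> card A"
proof -
  have "(\<Sum>v\<in>s ` A. 2) \<le> (\<Sum>v\<in>s ` A. card {x\<in>A. s x = v})"
    by (intro sum_mono repeated_fibre assms)
  thus ?thesis unfolding sum_card_fibres[OF assms(1)] by simp
qed

text \<open>Two classes that are larger than 2 reduce the number of values.\<close>

lemma repeated_card_image2:
  assumes A: "finite A" "repeated A s" and v: "v \<in> s ` A" "w \<in> s ` A" "v \<noteq> w"
  shows "2 * card (s ` A) + card {x\<in>A. s x = v} + card {x\<in>A. s x = w} \<le> card A + 4"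
proof -
  let ?c = "\<lambda>v. card {x\<in>A. s x = v}"
  have f: "finite (s ` A)" using A by simp
  have "(\<Sum>v\<in>s ` A. ?c v) = ?c v + (?c w + (\<Sum>v\<in>s ` A - {v} - {w}. ?c v))"
    using v f by (simp add: sum.remove[of _ v] sum.remove[of _ w])
  moreover have "(\<Sum>v\<in>s ` A - {v} - {w}. 2) \<le> (\<Sum>v\<in>s ` A - {v} - {w}. ?c v)"
    by (intro sum_mono repeated_fibre A) auto
  moreover have "(\<Sum>v\<in>s ` A - {v} - {w}. 2) + 4 = 2 * card (s ` A)"
  proof -
    have "card {v, w} \<le> card (s ` A)" using v f by (intro card_mono) auto
    hence "2 \<le> card (s ` A)" using v by simp
    thus ?thesis using v f by (simp add: card_Diff_subset)
  qed
  ultimately show ?thesis unfolding sum_card_fibres[OF A(1)] by linarith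
qed

lemma repeated_card_image1:
  assumes A: "finite A" "repeated A s" and v: "v \<in> s ` A"
  shows "2 * card (s ` A) + card {x\<in>A. s x = v} \<le> card A + 2"
proof -
  let ?c = "\<lambda>v. card {x\<in>A. s x = v}"
  have f: "finite (s ` A)" using A by simp
  have "(\<Sum>v\<in>s ` A. ?c v) = ?c v + (\<Sum>v\<in>s ` A - {v}. ?c v)"
    using v f by (simp add: sum.remove[of _ v])
  moreover have "(\<Sum>v\<in>s ` A - {v}. 2) \<le> (\<Sum>v\<in>s ` A - {v}. ?c v)"
    by (intro sum_mono repeated_fibre A) auto
  moreover have "(\<Sum>v\<in>s ` A - {v}. 2) + 2 = 2 * card (s ` A)"
  proof -
    have "s ` A \<noteq> {}" using v by blast
    hence "0 < card (s ` A)" using f by (simp add: card_gt_0_iff)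
    thus ?thesis using v f by (simp add: card_Diff_subset)
  qed
  ultimately show ?thesis unfolding sum_card_fibres[OF A(1)] by linarith
qed

abbreviation repeated_steps :: "nat \<Rightarrow> (nat \<Rightarrow> nat) \<Rightarrow> bool" where
  "repeated_steps n I \<equiv> repeated {..<n} (\<lambda>q. \<bar>closed_step n I q\<bar>)"

text \<open>Two ways in which the absolute steps of a walk can fail to be matched into pairs of
  opposite nonzero steps. A step equal to 0 is covered by the second one, since its partner is then
  equal to it.\<close>

definition degenerate_walk :: "nat \<Rightarrow> (nat \<Rightarrow> nat) \<Rightarrow> bool" where
  "degenerate_walk n I \<longleftrightarrow>
     (\<exists>p q r. {p, q, r} \<subseteq> {..<n} \<and> card {p, q, r} = 3 \<and>
        \<bar>closed_step n I p\<bar> = \<bar>closed_step n I q\<bar> \<and> \<bar>closed_step n I q\<bar> = \<bar>closed_step n I r\<bar>) \<or>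
     (\<exists>p q. p < n \<and> q < n \<and> p \<noteq> q \<and> closed_step n I p = closed_step n I q)"

text \<open>Either there are fewer than n/2 absolute steps, or they come in pairs exactly and two
  partners p and q have the same sign. In the second case the sum of the steps is a relation with
  coefficient 2 at the class of p, so this class can be dropped from the free values.\<close>

lemma card_degenerate_walks:
  assumes n: "n > 0" and N: "N > 0"
  shows "card {I \<in> walks n N. repeated_steps n I \<and> degenerate_walk n I}
    \<le> step_value_constant 1 n ((n + 1) div 2 - 1) * N ^ ((n + 1) div 2)"
    (is "card ?B \<le> _")
proof -
  define S where "S = (\<lambda>I. restrict (\<lambda>_. I) {0::nat}) ` ?B"
  have inj: "inj_on (\<lambda>I. restrict (\<lambda>_. I) {0::nat}) ?B"
  proof (rule inj_onI)
    fix I I' assume "restrict (\<lambda>_. I) {0::nat} = restrict (\<lambda>_. I') {0}"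
    from fun_cong[OF this, of 0] show "I = I'" by simp
  qed
  have "card ?B = card S" unfolding S_def by (rule card_image[OF inj, symmetric])
  also have "\<dots> \<le> step_value_constant (card {0::nat}) n ((n + 1) div 2 - 1) * N ^ (card {0::nat} + ((n + 1) div 2 - 1))"
  proof (rule card_families_by_free_values[OF _ n N])
    show "S \<subseteq> PiE {0} (\<lambda>_. walks n N)"
      unfolding S_def by (intro image_subsetI) (simp add: restrict_PiE_iff)
    fix g assume "g \<in> S"
    then obtain I where I: "I \<in> ?B" and g: "g = restrict (\<lambda>_. I) {0}"
      unfolding S_def by (rule imageE)
    let ?Q = "{0::nat} \<times> {..<n}" and ?s = "\<lambda>q. \<bar>closed_step n I q\<bar>"
    have fs: "family_step n g x = closed_step n I (snd x)" if "x \<in> ?Q" for x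
      using that by (auto simp: family_step_def g)
    have im: "(\<lambda>x. \<bar>family_step n g x\<bar>) ` ?Q = ?s ` {..<n}"
      using fs by (force simp: image_iff)
    have rep: "repeated {..<n} ?s" using I by blast
    have half: "2 * card (?s ` {..<n}) \<le> n" using repeated_card_image[OF _ rep] by simp
    show "\<exists>V\<subseteq>(\<lambda>x. \<bar>family_step n g x\<bar>) ` ?Q. card V \<le> (n + 1) div 2 - 1 \<and>
       (\<forall>u. step_relation n {0} (family_step n g) u \<longrightarrow>
          (\<forall>x\<in>?Q. \<bar>family_step n g x\<bar> \<in> V \<longrightarrow> u x = 0) \<longrightarrow> (\<forall>x\<in>?Q. u x = 0))"
    proof (cases "2 * card (?s ` {..<n}) < n")
      case True
      thus ?thesis unfolding im by (intro exI[of _ "?s ` {..<n}"]) (auto simp: fs)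
    next
      case False
      hence eq: "2 * card (?s ` {..<n}) = n" using half by simp
      have two: "card {x\<in>{..<n}. ?s x = v} = 2" if "v \<in> ?s ` {..<n}" for v
        using repeated_card_image1[OF _ rep that] repeated_fibre[OF _ rep that] eq by simp
      have no3: "\<not> (\<exists>p q r. {p, q, r} \<subseteq> {..<n} \<and> card {p, q, r} = 3 \<and> ?s p = ?s q \<and> ?s q = ?s r)"
      proof
        assume "\<exists>p q r. {p, q, r} \<subseteq> {..<n} \<and> card {p, q, r} = 3 \<and> ?s p = ?s q \<and> ?s q = ?s r"
        then obtain p q r where pqr: "{p, q, r} \<subseteq> {..<n}" "card {p, q, r} = 3" "?s p = ?s q" "?s q = ?s r"
          by blast
        have "card {p, q, r} \<le> card {x\<in>{..<n}. ?s x = ?s p}"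
          by (rule card_mono) (use pqr in auto)
        thus False using two[of "?s p"] pqr by auto
      qed
      then obtain p q where pq: "p < n" "q < n" "p \<noteq> q" "closed_step n I p = closed_step n I q"
        using I unfolding degenerate_walk_def by blast
      define v where "v = ?s p"
      have v: "v \<in> ?s ` {..<n}" using pq by (auto simp: v_def)
      have fib: "{x\<in>{..<n}. ?s x = v} = {p, q}"
        by (rule card_seteq[symmetric]) (use two[OF v] pq in \<open>auto simp: v_def\<close>)
      show ?thesis unfolding im
      proof (intro exI[of _ "?s ` {..<n} - {v}"] conjI allI impI)
        show "card (?s ` {..<n} - {v}) \<le> (n + 1) div 2 - 1" using eq v by (simp add: card_Diff_singleton)
        fix u assume rel: "step_relation n {0} (family_step n g) u"
          and z: "\<forall>x\<in>?Q. \<bar>family_step n g x\<bar> \<in> ?s ` {..<n} - {v} \<longrightarrow> u x = 0"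
        have z': "u (0, r) = 0" if "r < n" "r \<noteq> p" "r \<noteq> q" for r
        proof -
          have m: "(0, r) \<in> ?Q" using that by simp
          have "?s r \<noteq> v" using that fib by blast
          hence "\<bar>family_step n g (0, r)\<bar> \<in> ?s ` {..<n} - {v}" using that fs[OF m] by simp
          thus ?thesis using z m by blast
        qed
        have "u (0, p) = u (0, q)"
        proof -
          have m: "(0, p) \<in> ?Q" "(0, q) \<in> ?Q" using pq by auto
          have "family_step n g (0, p) = family_step n g (0, q)" using pq fs[OF m(1)] fs[OF m(2)] by simp
          thus ?thesis using rel m unfolding step_relation_def by blast
        qed
        moreover have "(\<Sum>r<n. u (0, r)) = (\<Sum>r\<in>{p, q}. u (0, r))"
          by (rule sum.mono_neutral_right) (use pq z' in auto)
        moreover have "(\<Sum>r<n. u (0, r)) = 0" by (rule step_relation_sum[OF rel]) simp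
        moreover have "(\<Sum>r\<in>{p, q}. u (0, r)) = u (0, p) + u (0, q)" using pq(3) by simp
        ultimately have "u (0, p) = 0" "u (0, q) = 0" by linarith+
        hence "u (0, r) = 0" if "r < n" for r using z'[OF that] by blast
        thus "\<forall>x\<in>?Q. u x = 0" by auto
      qed (rule Diff_subset)
    qed
  qed simp
  also have "\<dots> = step_value_constant 1 n ((n + 1) div 2 - 1) * N ^ ((n + 1) div 2)"
  proof -
    have "card {0::nat} + ((n + 1) div 2 - 1) = (n + 1) div 2" using n by simp
    thus ?thesis by simp
  qed
  finally show ?thesis .
qed

text \<open>Every walk of the family shares a value with another one.\<close>

definition linked :: "nat \<Rightarrow> nat set \<Rightarrow> (nat \<times> nat \<Rightarrow> 'b) \<Rightarrow> bool" where
  "linked n J s \<longleftrightarrow> (\<forall>j\<in>J. \<exists>q<n. \<exists>y\<in>J \<times> {..<n}. fst y \<noteq> j \<and> s y = s (j, q))"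

lemma linkedE:
  assumes "linked n J s" "j \<in> J"
  obtains q j' q' where "q < n" "j' \<in> J" "j' \<noteq> j" "q' < n" "s (j', q') = s (j, q)"
  using assms unfolding linked_def by fastforce

text \<open>Without further relations there would be \<open>4 + 2 n\<close> parameters: four
  starting points and at most \<open>2 n\<close> absolute steps. The proof finds two more relations
  in all cases. If there are at most \<open>2 n - 2\<close> absolute steps, nothing is left to show.
  If there are \<open>2 n - 1\<close> of them, some class meets some walk exactly once, and the
  closing equation of that walk determines it. If there are \<open>2 n\<close>, all classes are
  pairs, and two linking pairs are determined one after the other by two closing equations.\<close>

lemma card_linked_families:
  fixes n N :: nat
  assumes n: "n > 0" and N: "N > 0"
  defines "J \<equiv> {..<4::nat}"
  shows "card {g \<in> PiE J (\<lambda>_. walks n N).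
      repeated (J \<times> {..<n}) (\<lambda>x. \<bar>family_step n g x\<bar>) \<and> linked n J (\<lambda>x. \<bar>family_step n g x\<bar>)}
    \<le> step_value_constant 4 n (2 * n - 2) * N ^ (2 * n + 2)"
    (is "card ?S \<le> _")
proof -
  let ?Q = "J \<times> {..<n}"
  have J: "finite J" "card J = 4" and fQ: "finite ?Q" and cQ: "card ?Q = 4 * n" by (auto simp: J_def)
  have "card ?S \<le> step_value_constant (card J) n (2 * n - 2) * N ^ (card J + (2 * n - 2))"
  proof (rule card_families_by_free_values[OF J(1) n N])
    fix g assume g: "g \<in> ?S"
    define s where "s = (\<lambda>x. \<bar>family_step n g x\<bar>)"
    have rep: "repeated ?Q s" and link: "linked n J s" using g unfolding s_def by auto
    let ?D = "s ` ?Q" and ?K = "\<lambda>v. {x\<in>?Q. s x = v}"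
    have half: "card ?D \<le> 2 * n" using repeated_card_image[OF fQ rep] cQ by simp
    have fK: "finite (?K v)" for v using fQ by simp
    have eqv: "u x = 0 \<longleftrightarrow> u y = 0" if "step_relation n J (family_step n g) u" "x \<in> ?Q" "y \<in> ?Q" "s x = s y" for u x y
    proof -
      have "family_step n g x = family_step n g y \<or> family_step n g x = - family_step n g y"
        using that(4) unfolding s_def by linarith
      hence "u x = u y \<or> u x = - u y" using that(1-3) unfolding step_relation_def by blast
      thus ?thesis by auto
    qed
    have "\<exists>V\<subseteq>?D. card V \<le> 2 * n - 2 \<and>
       (\<forall>u. step_relation n J (family_step n g) u \<longrightarrow> (\<forall>x\<in>?Q. s x \<in> V \<longrightarrow> u x = 0) \<longrightarrow> (\<forall>x\<in>?Q. u x = 0))"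
    proof -
      consider "card ?D \<le> 2 * n - 2" | "card ?D = 2 * n - 1" | "card ?D = 2 * n" using half by linarith
      thus ?thesis
      proof cases
        case 1
        thus ?thesis by (intro exI[of _ ?D]) auto
      next
        case 2
        \<comment> \<open>Otherwise a class linking walk 0 to a walk a has two elements in each of them, hence exactly these four, and a class linking a third walk has at least three elements; together they leave too few values.\<close>
        have "\<exists>j\<in>J. \<exists>q<n. \<forall>q'<n. q' \<noteq> q \<longrightarrow> s (j, q') \<noteq> s (j, q)"
        proof (rule ccontr)
          assume "\<not> ?thesis"
          hence twice: "\<exists>q'<n. q' \<noteq> q \<and> s (j, q') = s (j, q)" if "j \<in> J" "q < n" for j q
            using that by blast
          have 0: "0 \<in> J" by (simp add: J_def)
          obtain q0 a p0 where v0: "q0 < n" "a \<in> J" "a \<noteq> 0" "p0 < n" "s (a, p0) = s (0, q0)"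
            by (rule linkedE[OF link 0])
          obtain q1 where q1: "q1 < n" "q1 \<noteq> q0" "s (0, q1) = s (0, q0)" using twice[OF 0 v0(1)] by blast
          obtain p1 where p1: "p1 < n" "p1 \<noteq> p0" "s (a, p1) = s (a, p0)" using twice[OF v0(2,4)] by blast
          let ?X = "{(0, q0), (0, q1), (a, p0), (a, p1)}"
          have X: "?X \<subseteq> ?K (s (0, q0))" "card ?X = 4" using v0 q1 p1 0 by auto
          have vD: "s (0, q0) \<in> ?D" by (rule imageI) (use 0 v0 in simp)
          have c4: "card (?K (s (0, q0))) \<le> 4"
            using repeated_card_image1[OF fQ rep vD] cQ 2 n by linarith
          have KX: "?K (s (0, q0)) = ?X" using card_seteq[OF fK X(1)] X(2) c4 by simp
          define c where "c = (if a = 1 then 2 else 1 :: nat)"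
          have c: "c \<in> J" "c \<noteq> 0" "c \<noteq> a" by (auto simp: c_def J_def)
          obtain q2 d p2 where v2: "q2 < n" "d \<in> J" "d \<noteq> c" "p2 < n" "s (d, p2) = s (c, q2)"
            by (rule linkedE[OF link c(1)])
          obtain q3 where q3: "q3 < n" "q3 \<noteq> q2" "s (c, q3) = s (c, q2)" using twice[OF c(1) v2(1)] by blast
          have wD: "s (c, q2) \<in> ?D" by (rule imageI) (use c v2 in simp)
          have ne: "s (0, q0) \<noteq> s (c, q2)"
          proof
            assume "s (0, q0) = s (c, q2)"
            hence "(c, q2) \<in> ?K (s (0, q0))" using c v2 by simp
            hence "(c, q2) \<in> ?X" unfolding KX .
            thus False using c by auto
          qed
          have "{(c, q2), (c, q3), (d, p2)} \<subseteq> ?K (s (c, q2))" using c v2 q3 by auto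
          from card_mono[OF fK this] have "3 \<le> card (?K (s (c, q2)))" using q3 v2 by auto
          moreover have "4 \<le> card (?K (s (0, q0)))" using card_mono[OF fK X(1)] X(2) by simp
          ultimately show False using repeated_card_image2[OF fQ rep vD wD ne] cQ 2 n by linarith
        qed
        then obtain j q where jq: "j \<in> J" "q < n" and uniq: "\<And>q'. q' < n \<Longrightarrow> q' \<noteq> q \<Longrightarrow> s (j, q') \<noteq> s (j, q)"
          by blast
        show ?thesis
        proof (intro exI[of _ "?D - {s (j, q)}"] conjI allI impI ballI)
          have "s (j, q) \<in> ?D" by (rule imageI) (use jq in simp)
          thus "card (?D - {s (j, q)}) \<le> 2 * n - 2" using 2 by (simp add: card_Diff_singleton)
          fix u x assume rel: "step_relation n J (family_step n g) u"
            and z: "\<forall>x\<in>?Q. s x \<in> ?D - {s (j, q)} \<longrightarrow> u x = 0" and x: "x \<in> ?Q"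
          have "u (j, q) = 0"
          proof (rule single_term_zero[OF step_relation_sum[OF rel jq(1)] jq(2)])
            fix q' assume q': "q' < n" "q' \<noteq> q"
            have m: "(j, q') \<in> ?Q" using jq q' by simp
            have "s (j, q') \<in> ?D" using m by (rule imageI)
            thus "u (j, q') = 0" using z m uniq[OF q'] by blast
          qed
          moreover have "s x \<in> ?D" using x by (rule imageI)
          moreover have "(j, q) \<in> ?Q" using jq by simp
          ultimately show "u x = 0" using z x eqv[OF rel x, of "(j, q)"] by (cases "s x = s (j, q)") blast+
        qed (rule Diff_subset)
      next
        case 3
        have two: "card (?K v) = 2" if "v \<in> ?D" for v
          using repeated_card_image1[OF fQ rep that] repeated_fibre[OF fQ rep that] cQ 3 by simp
        have pair: "?K (s x) = {x, y}" if "x \<in> ?Q" "y \<in> ?Q" "x \<noteq> y" "s y = s x" for x y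
          by (rule card_seteq[symmetric]) (use two[of "s x"] that fK in auto)
        have 0: "0 \<in> J" by (simp add: J_def)
        obtain q0 a p0 where v0: "q0 < n" "a \<in> J" "a \<noteq> 0" "p0 < n" "s (a, p0) = s (0, q0)"
          by (rule linkedE[OF link 0])
        define c where "c = (if a = 1 then 2 else 1 :: nat)"
        have c: "c \<in> J" "c \<noteq> 0" "c \<noteq> a" by (auto simp: c_def J_def)
        obtain q2 d p2 where v2: "q2 < n" "d \<in> J" "d \<noteq> c" "p2 < n" "s (d, p2) = s (c, q2)"
          by (rule linkedE[OF link c(1)])
        have K1: "?K (s (0, q0)) = {(0, q0), (a, p0)}" by (rule pair) (use v0 0 in auto)
        have K2: "?K (s (c, q2)) = {(c, q2), (d, p2)}" by (rule pair) (use v2 c in auto)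
        have ne: "s (0, q0) \<noteq> s (c, q2)"
        proof
          assume "s (0, q0) = s (c, q2)"
          hence "(c, q2) \<in> ?K (s (0, q0))" using c v2 by simp
          hence "(c, q2) \<in> {(0, q0), (a, p0)}" unfolding K1 .
          thus False using c by auto
        qed
        \<comment> \<open>One end of the first linking pair lies in a walk that the second pair avoids; its closing equation determines the first pair, and then that of walk c determines the second.\<close>
        obtain j q where jq: "(j, q) \<in> {(0, q0), (a, p0)}" "j \<noteq> d" "j \<noteq> c"
          using v0(3) c by (cases "d = 0") auto
        have jJ: "j \<in> J" "q < n" "s (j, q) = s (0, q0)" using jq v0 0 by auto
        have uniq1: "s (j, q') \<noteq> s (0, q0)" if "q' < n" "q' \<noteq> q" for q'
        proof
          assume "s (j, q') = s (0, q0)"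
          hence "(j, q') \<in> ?K (s (0, q0))" using jJ that by simp
          hence "(j, q') \<in> {(0, q0), (a, p0)}" unfolding K1 .
          thus False using jq(1) that v0(3) by auto
        qed
        have uniq2: "s (j, q') \<noteq> s (c, q2)" if "q' < n" for q'
        proof
          assume "s (j, q') = s (c, q2)"
          hence "(j, q') \<in> ?K (s (c, q2))" using jJ that by simp
          hence "(j, q') \<in> {(c, q2), (d, p2)}" unfolding K2 .
          thus False using jq by auto
        qed
        have uniq3: "s (c, q') \<noteq> s (c, q2)" if "q' < n" "q' \<noteq> q2" for q'
        proof
          assume "s (c, q') = s (c, q2)"
          hence "(c, q') \<in> ?K (s (c, q2))" using c that by simp
          hence "(c, q') \<in> {(c, q2), (d, p2)}" unfolding K2 .
          thus False using v2 that by auto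
        qed
        show ?thesis
        proof (intro exI[of _ "?D - {s (0, q0)} - {s (c, q2)}"] conjI allI impI ballI)
          have "s (0, q0) \<in> ?D" by (rule imageI) (use 0 v0 in simp)
          moreover have "s (c, q2) \<in> ?D" by (rule imageI) (use c v2 in simp)
          ultimately show "card (?D - {s (0, q0)} - {s (c, q2)}) \<le> 2 * n - 2" using 3 ne by (simp add: card_Diff_singleton)
          fix u x assume rel: "step_relation n J (family_step n g) u"
            and z: "\<forall>x\<in>?Q. s x \<in> ?D - {s (0, q0)} - {s (c, q2)} \<longrightarrow> u x = 0" and x: "x \<in> ?Q"
          have "u (j, q) = 0"
          proof (rule single_term_zero[OF step_relation_sum[OF rel jJ(1)] jJ(2)])
            fix q' assume q': "q' < n" "q' \<noteq> q"
            have m: "(j, q') \<in> ?Q" using jJ q' by simp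
            have "s (j, q') \<in> ?D" using m by (rule imageI)
            thus "u (j, q') = 0" using z m uniq1[OF q'] uniq2[OF q'(1)] by blast
          qed
          hence z1: "u y = 0" if "y \<in> ?Q" "s y = s (0, q0)" for y
          proof -
            have "(j, q) \<in> ?Q" using jJ by simp
            from eqv[OF rel that(1) this] show ?thesis using \<open>u (j, q) = 0\<close> jJ(3) that(2) by simp
          qed
          have zc: "u (c, q') = 0" if q': "q' < n" "q' \<noteq> q2" for q'
          proof -
            have m: "(c, q') \<in> ?Q" using c q' by simp
            show ?thesis
            proof (cases "s (c, q') = s (0, q0)")
              case True thus ?thesis by (rule z1[OF m])
            next
              case False
              have "s (c, q') \<in> ?D" using m by (rule imageI)
              thus ?thesis using z m False uniq3[OF q'] by simp
            qed
          qed
          have "u (c, q2) = 0"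
            by (rule single_term_zero[OF step_relation_sum[OF rel c(1)] v2(1)]) (rule zc)
          hence z2: "u y = 0" if "y \<in> ?Q" "s y = s (c, q2)" for y
          proof -
            have "(c, q2) \<in> ?Q" using c v2 by simp
            from eqv[OF rel that(1) this] show ?thesis using \<open>u (c, q2) = 0\<close> that(2) by simp
          qed
          have "s x \<in> ?D" using x by (rule imageI)
          thus "u x = 0" using z z1[OF x] z2[OF x] x by blast
        qed blast
      qed
    qed
    thus "\<exists>V\<subseteq>(\<lambda>x. \<bar>family_step n g x\<bar>) ` ?Q. card V \<le> 2 * n - 2 \<and>
       (\<forall>u. step_relation n J (family_step n g) u \<longrightarrow>
          (\<forall>x\<in>?Q. \<bar>family_step n g x\<bar> \<in> V \<longrightarrow> u x = 0) \<longrightarrow> (\<forall>x\<in>?Q. u x = 0))"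
      unfolding s_def .
  qed auto
  also have "\<dots> = step_value_constant 4 n (2 * n - 2) * N ^ (2 * n + 2)"
  proof -
    have "card J + (2 * n - 2) = 2 * n + 2" using n J by simp
    thus ?thesis using J by simp
  qed
  finally show ?thesis .
qed

section \<open>Lattice points and the limiting integral\<close>

definition (in labelled_pairing) partial_pos :: "(nat \<Rightarrow> 'a::comm_ring_1) \<Rightarrow> nat \<Rightarrow> 'a" where
  "partial_pos u j = u 0 + (\<Sum>i\<in>{1..j}. of_int (e i) * u (lab i))"

text \<open>The integer analogue of the domain of the limiting integral: a starting point \<open>u
  0\<close> and one step for each label.\<close>

definition (in labelled_pairing) lattice_points :: "nat \<Rightarrow> int \<Rightarrow> (nat \<Rightarrow> int) set" where
  "lattice_points N w = {u \<in> PiE {0..k} (\<lambda>_. UNIV). (\<forall>j\<in>{0..2*k}. 0 \<le> partial_pos u j \<and> partial_pos u j < int N) \<and>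
      (\<forall>l\<in>{1..k}. \<bar>u l\<bar> \<le> w)}"

text \<open>Walks are indexed from 0 and \<open>part\<close> acts on positions counted from 1, hence
  the shifts.\<close>

definition (in labelled_pairing) paired_walks :: "nat \<Rightarrow> int \<Rightarrow> (nat \<Rightarrow> nat) set" where
  "paired_walks N w = {I \<in> walks (2 * k) N. \<forall>q<2*k. closed_step (2 * k) I (part (Suc q) - 1) = - closed_step (2 * k) I q
      \<and> \<bar>closed_step (2 * k) I q\<bar> \<le> w}"

context labelled_pairing begin

lemma partial_pos_0 [simp]: "partial_pos u 0 = u 0"
  by (simp add: partial_pos_def)

lemma partial_pos_Suc: "partial_pos u (Suc j) = partial_pos u j + of_int (e (Suc j)) * u (lab (Suc j))"
  by (simp add: partial_pos_def)

lemma partial_pos_end: "partial_pos u (2 * k) = (u 0 :: int)"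
  using signed_sum_zero[of u] by (simp add: partial_pos_def)

lemma lab_in: "q \<in> {1..2 * k} \<Longrightarrow> lab q \<in> {1..k}"
  using lab_image by blast

lemma sign_square: "e q * e q = 1"
  using sign_cases[of q] by auto

text \<open>A walk whose steps cancel in pairs is given by its starting point and by one step for
  each pair; the walk returns to its start because the signed steps cancel.\<close>

lemma lattice_points_paired_walks:
  assumes k: "k > 0"
  shows "bij_betw (\<lambda>u. restrict (\<lambda>q. nat (partial_pos u q)) {..<2 * k}) (lattice_points N w) (paired_walks N w)"
proof -
  let ?\<Phi> = "\<lambda>u. restrict (\<lambda>q. nat (partial_pos u q)) {..<2 * k}"
  have rng: "0 \<le> partial_pos u j" "partial_pos u j < int N" if "u \<in> lattice_points N w" "j \<le> 2 * k" for u j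
    using that unfolding lattice_points_def by auto
  have step: "closed_step (2 * k) (?\<Phi> u) q = - (e (Suc q) * u (lab (Suc q)))"
    if u: "u \<in> lattice_points N w" and q: "q < 2 * k" for u q
  proof -
    have "int (?\<Phi> u (Suc q mod (2 * k))) = partial_pos u (Suc q)"
    proof (cases "Suc q = 2 * k")
      case True
      thus ?thesis using rng[OF u, of 0] k partial_pos_end[of u] by simp
    next
      case False
      hence "Suc q < 2 * k" using q by simp
      thus ?thesis using rng[OF u, of "Suc q"] by simp
    qed
    moreover have "int (?\<Phi> u q) = partial_pos u q" using rng[OF u, of q] q by simp
    ultimately show ?thesis unfolding closed_step_def by (simp add: partial_pos_Suc)
  qed
  show ?thesis
    unfolding bij_betw_def
  proof
    show "inj_on ?\<Phi> (lattice_points N w)"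
    proof (rule inj_onI)
      fix u v assume uv: "u \<in> lattice_points N w" "v \<in> lattice_points N w" "?\<Phi> u = ?\<Phi> v"
      show "u = v"
      proof (rule PiE_ext)
        show "u \<in> PiE {0..k} (\<lambda>_. UNIV)" "v \<in> PiE {0..k} (\<lambda>_. UNIV)"
          using uv unfolding lattice_points_def by blast+
        fix l assume l: "l \<in> {0..k}"
        show "u l = v l"
        proof (cases "l = 0")
          case True
          have "?\<Phi> u 0 = ?\<Phi> v 0" using uv(3) by simp
          thus ?thesis using rng[OF uv(1), of 0] rng[OF uv(2), of 0] True k by simp
        next
          case False
          hence "l \<in> lab ` {1..2 * k}" using l lab_image by simp
          then obtain q' where q': "q' \<in> {1..2 * k}" "l = lab q'" by blast
          define q where "q = q' - 1"
          have q: "q < 2 * k" "Suc q = q'" using q' by (auto simp: q_def)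
          have "e (Suc q) * u (lab (Suc q)) = e (Suc q) * v (lab (Suc q))"
            using step[OF uv(1) q(1)] step[OF uv(2) q(1)] unfolding uv(3) by linarith
          hence "(e (Suc q) * e (Suc q)) * u l = (e (Suc q) * e (Suc q)) * v l"
            using q q' by (simp add: mult.assoc)
          thus ?thesis by (simp add: sign_square)
        qed
      qed
    qed
    show "?\<Phi> ` lattice_points N w = paired_walks N w"
    proof (intro subset_antisym image_subsetI subsetI)
      fix u assume u: "u \<in> lattice_points N w"
      have w: "?\<Phi> u \<in> walks (2 * k) N"
      proof (rule restrict_PiE_iff[THEN iffD2], intro ballI)
        fix q assume "q \<in> {..<2 * k}"
        thus "nat (partial_pos u q) \<in> {..<N}" using rng[OF u, of q] by simp
      qed
      have "closed_step (2 * k) (?\<Phi> u) (part (Suc q) - 1) = - closed_step (2 * k) (?\<Phi> u) q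
         \<and> \<bar>closed_step (2 * k) (?\<Phi> u) q\<bar> \<le> w" if q: "q < 2 * k" for q
      proof
        have m: "Suc q \<in> {1..2 * k}" using q by simp
        have p: "part (Suc q) - 1 < 2 * k" "Suc (part (Suc q) - 1) = part (Suc q)"
          using part_in[OF m] by auto
        show "closed_step (2 * k) (?\<Phi> u) (part (Suc q) - 1) = - closed_step (2 * k) (?\<Phi> u) q"
          unfolding step[OF u q] step[OF u p(1)] p(2) by (simp add: sign_part[OF m] lab_part[OF m])
        have "\<bar>closed_step (2 * k) (?\<Phi> u) q\<bar> = \<bar>u (lab (Suc q))\<bar>"
          unfolding step[OF u q] using sign_cases[of "Suc q"] by auto
        also have "\<dots> \<le> w" using u lab_in[OF m] unfolding lattice_points_def by simp
        finally show "\<bar>closed_step (2 * k) (?\<Phi> u) q\<bar> \<le> w" .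
      qed
      thus "?\<Phi> u \<in> paired_walks N w" using w unfolding paired_walks_def by (intro CollectI conjI allI impI) simp_all
    next
      fix I assume I: "I \<in> paired_walks N w"
      hence I': "I \<in> walks (2 * k) N \<and> (\<forall>q<2*k. closed_step (2 * k) I (part (Suc q) - 1) = - closed_step (2 * k) I q
          \<and> \<bar>closed_step (2 * k) I q\<bar> \<le> w)"
        unfolding paired_walks_def by (rule CollectD)
      note Iw = conjunct1[OF I'] and Iq = conjunct2[OF I', rule_format]
      have Ip: "closed_step (2 * k) I (part (Suc q) - 1) = - closed_step (2 * k) I q" if "q < 2 * k" for q
        by (rule conjunct1[OF Iq[OF that]])
      have Ib: "\<bar>closed_step (2 * k) I q\<bar> \<le> w" if "q < 2 * k" for q
        by (rule conjunct2[OF Iq[OF that]])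
      \<comment> \<open>A position with label l; both choices give the same \<open>u l\<close>, since sign and step are reversed together.\<close>
      define c where "c l = (SOME q. q \<in> {1..2 * k} \<and> lab q = l)" for l
      have c: "c l \<in> {1..2 * k}" "lab (c l) = l" if "l \<in> {1..k}" for l
      proof -
        have "l \<in> lab ` {1..2 * k}" using that unfolding lab_image .
        then obtain q where "q \<in> {1..2 * k} \<and> lab q = l" by (elim imageE) (metis (lifting))
        from someI[of "\<lambda>q. q \<in> {1..2 * k} \<and> lab q = l", OF this]
        show "c l \<in> {1..2 * k}" "lab (c l) = l" unfolding c_def by (rule conjunct1, rule conjunct2)
      qed
      define u where "u = restrict (\<lambda>l. if l = 0 then int (I 0) else - (e (c l) * closed_step (2 * k) I (c l - 1))) {0..k}"
      have u0: "u 0 = int (I 0)" by (simp add: u_def)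
      have us: "e (Suc q) * u (lab (Suc q)) = - closed_step (2 * k) I q" if q: "q < 2 * k" for q
      proof -
        have m: "Suc q \<in> {1..2 * k}" using q by simp
        define l where "l = lab (Suc q)"
        have l: "l \<in> {1..k}" unfolding l_def by (rule lab_in[OF m])
        have "lab (Suc q) = lab (c l)" using c[OF l] by (simp add: l_def)
        hence "c l = Suc q \<or> c l = part (Suc q)" using lab_eq_iff[OF m c(1)[OF l]] by simp
        hence "e (c l) * closed_step (2 * k) I (c l - 1) = e (Suc q) * closed_step (2 * k) I q"
          using Ip[OF q] sign_part[OF m] by auto
        hence "e (Suc q) * u l = - ((e (Suc q) * e (Suc q)) * closed_step (2 * k) I q)"
          using l by (simp add: u_def mult.assoc)
        thus ?thesis unfolding l_def sign_square by simp
      qed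
      have pos: "partial_pos u q = int (I q)" if "q < 2 * k" for q
        using that
      proof (induction q)
        case (Suc q)
        thus ?case using us[of q] unfolding partial_pos_Suc by (simp add: closed_step_def)
      qed (simp add: u0)
      have Ir: "I q < N" if "q < 2 * k" for q using PiE_mem[OF Iw, of q] that by simp
      have "u \<in> lattice_points N w"
        unfolding lattice_points_def
      proof (intro CollectI conjI ballI)
        show "u \<in> PiE {0..k} (\<lambda>_. UNIV)" unfolding u_def by simp
        fix j assume j: "j \<in> {0..2 * k}"
        have "\<exists>q<2*k. partial_pos u j = int (I q)"
        proof (cases "j = 2 * k")
          case True
          thus ?thesis using partial_pos_end[of u] u0 k by (intro exI[of _ 0]) simp
        next
          case False
          thus ?thesis using j pos[of j] by (intro exI[of _ j]) simp
        qed
        thus "0 \<le> partial_pos u j" "partial_pos u j < int N" using Ir by auto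
      next
        fix l assume l: "l \<in> {1..k}"
        have "\<bar>u l\<bar> = \<bar>closed_step (2 * k) I (c l - 1)\<bar>"
          using l sign_cases[of "c l"] by (auto simp: u_def)
        also have "\<dots> \<le> w" using c(1)[OF l] by (intro Ib) auto
        finally show "\<bar>u l\<bar> \<le> w" .
      qed
      moreover have "?\<Phi> u = I"
        using Iw pos by (intro ext) (auto simp: PiE_def extensional_def)
      ultimately show "I \<in> ?\<Phi> ` lattice_points N w" by blast
    qed
  qed
qed

lemma card_paired_walks: "k > 0 \<Longrightarrow> card (paired_walks N w) = card (lattice_points N w)"
  using bij_betw_same_card[OF lattice_points_paired_walks] by simp

lemma finite_lattice_points: "finite (lattice_points N w)"
proof (rule finite_subset)
  show "lattice_points N w \<subseteq> PiE {0..k} (\<lambda>_. {- (int N + \<bar>w\<bar>)..int N + \<bar>w\<bar>})"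
  proof
    fix u assume u: "u \<in> lattice_points N w"
    have "u l \<in> {- (int N + \<bar>w\<bar>)..int N + \<bar>w\<bar>}" if l: "l \<in> {0..k}" for l
    proof (cases "l = 0")
      case True
      have "0 \<le> partial_pos u 0 \<and> partial_pos u 0 < int N"
        using u unfolding lattice_points_def by (simp del: partial_pos_0)
      hence "0 \<le> u l \<and> u l < int N" using True by simp
      thus ?thesis unfolding atLeastAtMost_iff by linarith
    next
      case False
      hence "\<bar>u l\<bar> \<le> w" using u l unfolding lattice_points_def by simp
      thus ?thesis unfolding atLeastAtMost_iff by linarith
    qed
    moreover have "u \<in> PiE {0..k} (\<lambda>_. UNIV)" using u unfolding lattice_points_def by blast
    ultimately show "u \<in> PiE {0..k} (\<lambda>_. {- (int N + \<bar>w\<bar>)..int N + \<bar>w\<bar>})" by (auto simp: PiE_iff)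
  qed
qed (intro finite_PiE, auto)

end

text \<open>A graph over the other coordinates is a null set: integrate over coordinate i
  first.\<close>

lemma AE_coordinate_neq:
  fixes f :: "(nat \<Rightarrow> real) \<Rightarrow> real"
  assumes I: "finite I" "i \<in> I" and f[measurable]: "f \<in> borel_measurable (\<Pi>\<^sub>M l\<in>I. lborel)"
    and indep: "\<And>x t. f (x(i := t)) = f x"
  shows "AE x in (\<Pi>\<^sub>M l\<in>I. lborel). x i \<noteq> f x"
proof -
  interpret product_sigma_finite "\<lambda>_::nat. lborel :: real measure" ..
  let ?P = "\<Pi>\<^sub>M l\<in>I. lborel :: real measure" and ?J = "I - {i}"
  have ins: "insert i ?J = I" using I by auto
  have [measurable]: "(\<lambda>x. x i) \<in> borel_measurable ?P" using I by measurable
  have set[measurable]: "{x \<in> space ?P. x i = f x} \<in> sets ?P" by measurable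
  have "emeasure ?P {x \<in> space ?P. x i = f x} = (\<integral>\<^sup>+x. indicator {x \<in> space ?P. x i = f x} x \<partial>?P)"
    by (simp add: nn_integral_indicator[OF set])
  also have "\<dots> = (\<integral>\<^sup>+x. (\<integral>\<^sup>+t. indicator {x \<in> space ?P. x i = f x} (x(i := t)) \<partial>lborel) \<partial>(\<Pi>\<^sub>M l\<in>?J. lborel))"
    using product_nn_integral_insert[of ?J i "indicator {x \<in> space ?P. x i = f x}"] I set
    unfolding ins by simp
  also have "\<dots> = (\<integral>\<^sup>+x. 0 \<partial>(\<Pi>\<^sub>M l\<in>?J. lborel :: real measure))"
  proof (rule nn_integral_cong)
    fix x :: "nat \<Rightarrow> real"
    have "(\<integral>\<^sup>+t. indicator {x \<in> space ?P. x i = f x} (x(i := t)) \<partial>lborel) \<le> (\<integral>\<^sup>+t. indicator {f x} t \<partial>lborel)"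
      by (rule nn_integral_mono) (auto simp: indicator_def indep)
    also have "\<dots> = 0" by simp
    finally show "(\<integral>\<^sup>+t. indicator {x \<in> space ?P. x i = f x} (x(i := t)) \<partial>lborel) = 0" by simp
  qed
  finally have "emeasure ?P {x \<in> space ?P. x i = f x} = 0" by simp
  thus ?thesis by (intro AE_I[OF _ _ set]) auto
qed

lemma floor_scaled_tendsto: "(\<lambda>N. of_int \<lfloor>a * real N * x\<rfloor> / real N) \<longlonglongrightarrow> a * x"
proof (rule tendsto_sandwich)
  show "\<forall>\<^sub>F N in sequentially. a * x - 1 / real N \<le> of_int \<lfloor>a * real N * x\<rfloor> / real N"
    using eventually_gt_at_top[of 0]
  proof eventually_elim
    case (elim N)
    have "a * real N * x - 1 \<le> of_int \<lfloor>a * real N * x\<rfloor>" by linarith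
    hence "(a * real N * x - 1) / real N \<le> of_int \<lfloor>a * real N * x\<rfloor> / real N" by (rule divide_right_mono) simp
    thus ?case using elim by (simp add: diff_divide_distrib)
  qed
  show "\<forall>\<^sub>F N in sequentially. of_int \<lfloor>a * real N * x\<rfloor> / real N \<le> a * x"
    using eventually_gt_at_top[of 0]
  proof eventually_elim
    case (elim N)
    have "of_int \<lfloor>a * real N * x\<rfloor> \<le> a * real N * x" by linarith
    hence "of_int \<lfloor>a * real N * x\<rfloor> / real N \<le> a * real N * x / real N" by (rule divide_right_mono) simp
    thus ?case using elim by simp
  qed
  have "(\<lambda>N. a * x - 1 / real N) \<longlonglongrightarrow> a * x - 0" by (intro tendsto_intros lim_1_over_n)
  thus "(\<lambda>N. a * x - 1 / real N) \<longlonglongrightarrow> a * x" by simp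
qed simp

context labelled_pairing begin

text \<open>The lattice point below \<open>y\<close> after scaling by N in coordinate 0 and by
  \<open>b N\<close> in the others. The factor 1 gives both branches the same form.\<close>

definition scaled_floor :: "real \<Rightarrow> nat \<Rightarrow> (nat \<Rightarrow> real) \<Rightarrow> nat \<Rightarrow> int" where
  "scaled_floor b N y = restrict (\<lambda>l. if l = 0 then \<lfloor>1 * real N * y l\<rfloor> else \<lfloor>b * real N * y l\<rfloor>) {0..k}"

abbreviation coord_measure :: "(nat \<Rightarrow> real) measure" where
  "coord_measure \<equiv> \<Pi>\<^sub>M l\<in>{0..k}. lborel"

text \<open>The integrand is constant on boxes of volume \<open>1 / (N (b N) ^ k)\<close>, one box
  for each lattice point. This writes the normalised count as an integral, so that its limit becomes
  a matter of dominated convergence.\<close>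

lemma integral_lattice_indicator:
  assumes b: "b > 0" and N: "N > 0"
  shows "integrable coord_measure (\<lambda>y. indicator (lattice_points N w) (scaled_floor b N y) :: real)"
    and "(LINT y|coord_measure. indicator (lattice_points N w) (scaled_floor b N y))
     = real (card (lattice_points N w)) / (real N * (b * real N) ^ k)"
proof -
  interpret product_sigma_finite "\<lambda>_::nat. lborel :: real measure" ..
  define \<alpha> where "\<alpha> l = (if l = 0 then real N else b * real N)" for l :: nat
  have \<alpha>: "\<alpha> l > 0" for l using b N by (simp add: \<alpha>_def)
  define cell where "cell u = PiE {0..k} (\<lambda>l. {of_int (u l) / \<alpha> l..<(of_int (u l) + 1) / \<alpha> l})" for u :: "nat \<Rightarrow> int"
  have cell_sets: "cell u \<in> sets coord_measure" for u
    unfolding cell_def by (intro sets_PiM_I_finite) auto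
  have cell_emeasure: "emeasure coord_measure (cell u) = ennreal (\<Prod>l\<in>{0..k}. 1 / \<alpha> l)" for u
  proof -
    have "emeasure coord_measure (cell u) = (\<Prod>l\<in>{0..k}. emeasure lborel {of_int (u l) / \<alpha> l..<(of_int (u l) + 1) / \<alpha> l})"
      unfolding cell_def by (intro emeasure_PiM) auto
    also have "\<dots> = (\<Prod>l\<in>{0..k}. ennreal (1 / \<alpha> l))"
    proof (intro prod.cong refl)
      fix l
      have "of_int (u l) / \<alpha> l \<le> (of_int (u l) + 1) / \<alpha> l" using \<alpha>[of l] by (intro divide_right_mono) auto
      thus "emeasure lborel {of_int (u l) / \<alpha> l..<(of_int (u l) + 1) / \<alpha> l} = ennreal (1 / \<alpha> l)"
        by (simp add: add_divide_distrib)
    qed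
    also have "\<dots> = ennreal (\<Prod>l\<in>{0..k}. 1 / \<alpha> l)" using \<alpha> by (intro prod_ennreal) (simp add: less_imp_le)
    finally show ?thesis .
  qed
  have prod_\<alpha>: "(\<Prod>l\<in>{0..k}. 1 / \<alpha> l) = 1 / (real N * (b * real N) ^ k)"
  proof -
    have "{0..k} = insert 0 {1..k}" by auto
    hence "(\<Prod>l\<in>{0..k}. \<alpha> l) = real N * (\<Prod>l\<in>{1..k}. b * real N)"
      by (simp add: \<alpha>_def)
    thus ?thesis by (simp add: prod_dividef)
  qed
  have cell_measure: "measure coord_measure (cell u) = 1 / (real N * (b * real N) ^ k)" for u
    unfolding measure_def cell_emeasure prod_\<alpha> using b by simp
  have mem: "scaled_floor b N y = u \<longleftrightarrow> y \<in> cell u" if y: "y \<in> space coord_measure" and u: "u \<in> PiE {0..k} (\<lambda>_. UNIV)" for y u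
  proof -
    have fl: "\<lfloor>\<alpha> l * y l\<rfloor> = u l \<longleftrightarrow> y l \<in> {of_int (u l) / \<alpha> l..<(of_int (u l) + 1) / \<alpha> l}" for l
      using \<alpha>[of l] by (simp add: floor_eq_iff field_simps)
    have "scaled_floor b N y = u \<longleftrightarrow> (\<forall>l\<in>{0..k}. scaled_floor b N y l = u l)"
      using u unfolding scaled_floor_def by (auto simp: PiE_def extensional_def fun_eq_iff)
    also have "\<dots> \<longleftrightarrow> (\<forall>l\<in>{0..k}. \<lfloor>\<alpha> l * y l\<rfloor> = u l)"
      by (intro ball_cong refl) (simp add: scaled_floor_def \<alpha>_def)
    also have "\<dots> \<longleftrightarrow> y \<in> cell u"
      unfolding fl cell_def using y by (auto simp: space_PiM PiE_iff)
    finally show ?thesis .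
  qed
  have sum: "indicator (lattice_points N w) (scaled_floor b N y) = (\<Sum>u\<in>lattice_points N w. indicator (cell u) y :: real)"
    if y: "y \<in> space coord_measure" for y
  proof -
    have "(\<Sum>u\<in>lattice_points N w. indicator (cell u) y :: real) = (\<Sum>u\<in>lattice_points N w. if scaled_floor b N y = u then 1 else 0)"
    proof (intro sum.cong refl)
      fix u assume "u \<in> lattice_points N w"
      hence "u \<in> PiE {0..k} (\<lambda>_. UNIV)" unfolding lattice_points_def by blast
      from mem[OF y this] show "indicator (cell u) y = (if scaled_floor b N y = u then 1 else 0 :: real)"
        by (simp add: indicator_def)
    qed
    also have "\<dots> = indicator (lattice_points N w) (scaled_floor b N y)"
      using finite_lattice_points by (simp add: indicator_def)
    finally show ?thesis by simp
  qed
  have int: "integrable coord_measure (indicator (cell u) :: _ \<Rightarrow> real)" for u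
    by (rule integrable_real_indicator[OF cell_sets]) (simp add: cell_emeasure)
  have "integrable coord_measure (\<lambda>y. \<Sum>u\<in>lattice_points N w. indicator (cell u) y :: real)"
    by (intro Bochner_Integration.integrable_sum int)
  thus "integrable coord_measure (\<lambda>y. indicator (lattice_points N w) (scaled_floor b N y) :: real)"
    by (subst Bochner_Integration.integrable_cong[OF refl sum]) auto
  have "(LINT y|coord_measure. indicator (lattice_points N w) (scaled_floor b N y))
     = (LINT y|coord_measure. (\<Sum>u\<in>lattice_points N w. indicator (cell u) y :: real))"
    by (intro Bochner_Integration.integral_cong refl sum)
  also have "\<dots> = (\<Sum>u\<in>lattice_points N w. measure coord_measure (cell u))"
    using cell_sets by (subst Bochner_Integration.integral_sum) (auto intro!: int sum.cong sets.Int_space_eq2 simp: sets.Int_space_eq2)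
  also have "\<dots> = real (card (lattice_points N w)) / (real N * (b * real N) ^ k)"
    by (simp add: cell_measure)
  finally show "(LINT y|coord_measure. indicator (lattice_points N w) (scaled_floor b N y))
     = real (card (lattice_points N w)) / (real N * (b * real N) ^ k)" .
qed

definition scale_tail :: "real \<Rightarrow> (nat \<Rightarrow> real) \<Rightarrow> nat \<Rightarrow> real" where
  "scale_tail b y l = (if l = 0 then y l else b * y l)"

abbreviation unit_box :: "(nat \<Rightarrow> real) set" where
  "unit_box \<equiv> PiE {0..k} (\<lambda>l. if l = 0 then {0..1} else {-1..1})"

definition region_indicator :: "real \<Rightarrow> (nat \<Rightarrow> real) \<Rightarrow> real" where
  "region_indicator b y = indicator (unit_box) y *
     (\<Prod>j = 1..2 * k. indicator {0..1} (y 0 + b * (\<Sum>i = 1..j. of_int (e i) * y (lab i))))"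

lemma partial_pos_scale_tail:
  assumes "j \<le> 2 * k"
  shows "partial_pos (scale_tail b y) j = y 0 + b * (\<Sum>i = 1..j. of_int (e i) * y (lab i))"
proof -
  have "(\<Sum>i = 1..j. of_int (e i) * scale_tail b y (lab i)) = (\<Sum>i = 1..j. b * (of_int (e i) * y (lab i)))"
  proof (intro sum.cong refl)
    fix i assume "i \<in> {1..j}"
    hence "lab i \<in> {1..k}" using assms by (intro lab_in) auto
    thus "of_int (e i) * scale_tail b y (lab i) = b * (of_int (e i) * y (lab i))" by (simp add: scale_tail_def)
  qed
  thus ?thesis by (simp add: partial_pos_def scale_tail_def sum_distrib_left)
qed

lemma region_indicator_zero:
  assumes j: "j \<in> {0..2*k}" and out: "partial_pos (scale_tail b y) j \<notin> {0..1}"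
  shows "region_indicator b y = 0"
proof (cases "j = 0")
  case True
  hence "y 0 \<notin> {0..1}" using out by (simp add: scale_tail_def)
  hence "y \<notin> unit_box"
    by (auto dest!: PiE_mem[of _ _ _ 0])
  thus ?thesis unfolding region_indicator_def by simp
next
  case False
  hence "j \<in> {1..2*k}" "indicator {0..1} (y 0 + b * (\<Sum>i = 1..j. of_int (e i) * y (lab i))) = (0::real)"
    using j out partial_pos_scale_tail[of j b y] by auto
  hence "(\<Prod>j = 1..2 * k. indicator {0..1} (y 0 + b * (\<Sum>i = 1..j. of_int (e i) * y (lab i)))) = (0::real)"
    by (intro prod_zero) auto
  thus ?thesis unfolding region_indicator_def by simp
qed

text \<open>The boundary of the domain of integration lies in finitely many graphs: each position
  has coefficient 1 at coordinate 0.\<close>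

lemma AE_generic_point:
  "AE y in coord_measure. (\<forall>j\<in>{0..2*k}. partial_pos (scale_tail b y) j \<noteq> 0 \<and> partial_pos (scale_tail b y) j \<noteq> 1)
     \<and> (\<forall>l\<in>{1..k}. \<bar>y l\<bar> \<noteq> 1)"
proof -
  have meas: "(\<lambda>y. y l) \<in> borel_measurable coord_measure" if "l \<in> {0..k}" for l
    using that measurable_component_singleton[of l "{0..k}" "\<lambda>_. lborel :: real measure"] by simp
  have pos: "AE y in coord_measure. partial_pos (scale_tail b y) j \<noteq> c" if j: "j \<in> {0..2*k}" for j c
  proof -
    \<comment> \<open>The position equals c exactly on the graph of this function of the other coordinates.\<close>
    let ?f = "\<lambda>y. c - b * (\<Sum>i = 1..j. of_int (e i) * y (lab i))"
    have l: "lab i \<in> {1..k}" if "i \<in> {1..j}" for i using that j by (intro lab_in) auto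
    have "AE y in coord_measure. y 0 \<noteq> ?f y"
    proof (rule AE_coordinate_neq)
      show "?f \<in> borel_measurable coord_measure"
        by (intro borel_measurable_diff borel_measurable_times borel_measurable_sum borel_measurable_const meas)
           (use l in force)
      show "?f (y(0 := t)) = ?f y" for y t
        using l by (intro arg_cong2[where f = "(-)"] arg_cong2[where f = "(*)"] sum.cong refl) fastforce
    qed auto
    thus ?thesis by eventually_elim (use j in \<open>simp add: partial_pos_scale_tail algebra_simps\<close>)
  qed
  have edge: "AE y in coord_measure. y l \<noteq> c" if l: "l \<in> {1..k}" for l c
    by (rule AE_coordinate_neq) (use l in auto)
  have "AE y in coord_measure. \<forall>j\<in>{0..2*k}. partial_pos (scale_tail b y) j \<noteq> 0"
    by (intro AE_finite_allI pos) auto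
  moreover have "AE y in coord_measure. \<forall>j\<in>{0..2*k}. partial_pos (scale_tail b y) j \<noteq> 1"
    by (intro AE_finite_allI pos) auto
  moreover have "AE y in coord_measure. \<forall>l\<in>{1..k}. y l \<noteq> 1" by (intro AE_finite_allI edge) auto
  moreover have "AE y in coord_measure. \<forall>l\<in>{1..k}. y l \<noteq> -1" by (intro AE_finite_allI edge) auto
  ultimately show ?thesis by eventually_elim (auto simp: abs_if split: if_splits)
qed

text \<open>Away from the boundary all inequalities that define the domain, or the violation of one
  of them, are strict, so they persist for the scaled lattice points of large N.\<close>

lemma lattice_indicator_tendsto:
  fixes w :: "nat \<Rightarrow> int"
  assumes b: "b > 0" and w: "(\<lambda>N. real_of_int (w N) / real N) \<longlonglongrightarrow> b"
    and y: "y \<in> space coord_measure"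
    and gen: "(\<forall>j\<in>{0..2*k}. partial_pos (scale_tail b y) j \<noteq> 0 \<and> partial_pos (scale_tail b y) j \<noteq> 1)
     \<and> (\<forall>l\<in>{1..k}. \<bar>y l\<bar> \<noteq> 1)"
  shows "(\<lambda>N. indicator (lattice_points N (w N)) (scaled_floor b N y) :: real) \<longlonglongrightarrow> region_indicator b y"
proof -
  let ?u = "\<lambda>N. scaled_floor b N y" and ?a = "\<lambda>j. partial_pos (scale_tail b y) j"
  have ul: "(\<lambda>N. of_int (?u N l) / real N) \<longlonglongrightarrow> scale_tail b y l" if "l \<in> {0..k}" for l
  proof (cases "l = 0")
    case True
    thus ?thesis using floor_scaled_tendsto[of 1 "y 0"] by (simp add: scaled_floor_def scale_tail_def)
  next
    case False
    thus ?thesis using that floor_scaled_tendsto[of b "y l"] by (simp add: scaled_floor_def scale_tail_def)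
  qed
  have pl: "(\<lambda>N. of_int (partial_pos (?u N) j) / real N) \<longlonglongrightarrow> ?a j" if j: "j \<in> {0..2*k}" for j
  proof -
    have "(\<lambda>N. of_int (?u N 0) / real N + (\<Sum>i = 1..j. of_int (e i) * (of_int (?u N (lab i)) / real N)))
       \<longlonglongrightarrow> scale_tail b y 0 + (\<Sum>i = 1..j. of_int (e i) * scale_tail b y (lab i))"
    proof (intro tendsto_add tendsto_sum tendsto_mult_left ul)
      fix i assume "i \<in> {1..j}"
      hence "lab i \<in> {1..k}" using j by (intro lab_in) auto
      thus "lab i \<in> {0..k}" by simp
    qed simp
    thus ?thesis by (simp add: partial_pos_def add_divide_distrib sum_divide_distrib)
  qed
  have wl: "(\<lambda>N. of_int (w N - \<bar>?u N l\<bar>) / real N) \<longlonglongrightarrow> b * (1 - \<bar>y l\<bar>)" if l: "l \<in> {1..k}" for l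
  proof -
    have "(\<lambda>N. real_of_int (w N) / real N - \<bar>of_int (?u N l) / real N\<bar>) \<longlonglongrightarrow> b - \<bar>scale_tail b y l\<bar>"
      using l by (intro tendsto_intros w ul) auto
    moreover have "b - \<bar>scale_tail b y l\<bar> = b * (1 - \<bar>y l\<bar>)"
      using l b by (simp add: scale_tail_def abs_mult algebra_simps)
    ultimately show ?thesis by (simp add: diff_divide_distrib)
  qed
  have ext: "?u N \<in> PiE {0..k} (\<lambda>_. UNIV)" for N by (simp add: scaled_floor_def)
  have N0: "\<forall>\<^sub>F N in sequentially. N > (0::nat)" by (rule eventually_gt_at_top)
  consider (inside) "\<forall>j\<in>{0..2*k}. 0 < ?a j \<and> ?a j < 1" "\<forall>l\<in>{1..k}. \<bar>y l\<bar> < 1"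
    | (low) j where "j \<in> {0..2*k}" "?a j < 0" | (high) j where "j \<in> {0..2*k}" "?a j > 1"
    | (wide) l where "l \<in> {1..k}" "\<bar>y l\<bar> > 1"
    using gen by (meson linorder_less_linear)
  thus ?thesis
  proof cases
    case inside
    have "\<forall>\<^sub>F N in sequentially. \<forall>j\<in>{0..2*k}. 0 < of_int (partial_pos (?u N) j) / real N \<and> of_int (partial_pos (?u N) j) / real N < 1"
      by (intro eventually_ball_finite ballI eventually_conj order_tendstoD[OF pl]) (use inside in auto)
    moreover have "\<forall>\<^sub>F N in sequentially. \<forall>l\<in>{1..k}. 0 < of_int (w N - \<bar>?u N l\<bar>) / real N"
      by (intro eventually_ball_finite ballI order_tendstoD(1)[OF wl]) (use inside b in auto)
    ultimately have "\<forall>\<^sub>F N in sequentially. indicator (lattice_points N (w N)) (?u N) = (1::real)"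
      using N0
    proof eventually_elim
      case (elim N)
      have "?u N \<in> lattice_points N (w N)"
        unfolding lattice_points_def
      proof (intro CollectI conjI ballI ext)
        fix j assume "j \<in> {0..2 * k}"
        hence "0 < real_of_int (partial_pos (?u N) j) / real N \<and> real_of_int (partial_pos (?u N) j) / real N < 1" using elim by blast
        thus "0 \<le> partial_pos (?u N) j" "partial_pos (?u N) j < int N"
          using elim(3) by (simp_all add: zero_less_divide_iff divide_less_eq)
      next
        fix l assume "l \<in> {1..k}"
        hence "0 < real_of_int (w N - \<bar>?u N l\<bar>) / real N" using elim by blast
        thus "\<bar>?u N l\<bar> \<le> w N" using elim(3) unfolding zero_less_divide_iff by linarith
      qed
      thus ?case by simp
    qed
    moreover have "region_indicator b y = 1"
    proof -
      have "y \<in> unit_box"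
      proof (rule PiE_I)
        fix l assume l: "l \<in> {0..k}"
        show "y l \<in> (if l = 0 then {0..1} else {-1..1})"
        proof (cases "l = 0")
          case True
          have "0 < ?a 0 \<and> ?a 0 < 1" by (rule inside(1)[rule_format]) simp
          thus ?thesis using True by (simp add: scale_tail_def)
        next
          case False
          hence "\<bar>y l\<bar> < 1" using l inside(2) by simp
          thus ?thesis using False by auto
        qed
      next
        fix l assume "l \<notin> {0..k}"
        thus "y l = undefined" using y by (auto simp: space_PiM PiE_def extensional_def)
      qed
      moreover have "(\<Prod>j = 1..2 * k. indicator {0..1} (y 0 + b * (\<Sum>i = 1..j. of_int (e i) * y (lab i)))) = (1::real)"
      proof (rule prod.neutral, intro ballI)
        fix j assume "j \<in> {1..2 * k}"
        hence "0 < ?a j \<and> ?a j < 1" "j \<le> 2 * k" using inside(1) by auto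
        thus "indicator {0..1} (y 0 + b * (\<Sum>i = 1..j. of_int (e i) * y (lab i))) = (1::real)"
          by (simp add: partial_pos_scale_tail)
      qed
      ultimately show ?thesis unfolding region_indicator_def by simp
    qed
    ultimately show ?thesis by (simp add: tendsto_eventually)
  next
    case (low j)
    have "\<forall>\<^sub>F N in sequentially. of_int (partial_pos (?u N) j) / real N < 0"
      by (rule order_tendstoD(2)[OF pl[OF low(1)] low(2)])
    hence "\<forall>\<^sub>F N in sequentially. indicator (lattice_points N (w N)) (?u N) = (0::real)"
      using N0
    proof eventually_elim
      case (elim N)
      hence "partial_pos (?u N) j < 0" by (simp add: divide_less_0_iff)
      hence "?u N \<notin> lattice_points N (w N)" using low(1) unfolding lattice_points_def by force
      thus ?case by simp
    qed
    moreover have "region_indicator b y = 0"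
      using region_indicator_zero[OF low(1)] low(2) by auto
    ultimately show ?thesis by (simp add: tendsto_eventually)
  next
    case (high j)
    have "\<forall>\<^sub>F N in sequentially. of_int (partial_pos (?u N) j) / real N > 1"
      by (rule order_tendstoD(1)[OF pl[OF high(1)] high(2)])
    hence "\<forall>\<^sub>F N in sequentially. indicator (lattice_points N (w N)) (?u N) = (0::real)"
      using N0
    proof eventually_elim
      case (elim N)
      hence "partial_pos (?u N) j > int N" by (simp add: less_divide_eq)
      hence "?u N \<notin> lattice_points N (w N)" using high(1) unfolding lattice_points_def by force
      thus ?case by simp
    qed
    moreover have "region_indicator b y = 0"
      using region_indicator_zero[OF high(1)] high(2) by auto
    ultimately show ?thesis by (simp add: tendsto_eventually)
  next
    case (wide l)
    have "b * (1 - \<bar>y l\<bar>) < 0" using wide b by (simp add: mult_pos_neg)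
    hence "\<forall>\<^sub>F N in sequentially. of_int (w N - \<bar>?u N l\<bar>) / real N < 0"
      by (rule order_tendstoD(2)[OF wl[OF wide(1)]])
    hence "\<forall>\<^sub>F N in sequentially. indicator (lattice_points N (w N)) (?u N) = (0::real)"
      using N0
    proof eventually_elim
      case (elim N)
      hence "\<bar>?u N l\<bar> > w N" unfolding divide_less_0_iff by linarith
      hence "?u N \<notin> lattice_points N (w N)" using wide(1) unfolding lattice_points_def by force
      thus ?case by simp
    qed
    moreover have "region_indicator b y = 0"
    proof -
      have "y l \<notin> {-1..1}" using wide(2) by auto
      hence "y \<notin> unit_box"
        using wide(1) by (auto dest!: PiE_mem[of _ _ _ l])
      thus ?thesis unfolding region_indicator_def by simp
    qed
    ultimately show ?thesis by (simp add: tendsto_eventually)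
  qed
qed

text \<open>Dominated convergence for the step functions of
  \<open>integral_lattice_indicator\<close>; the dominating function is the indicator of a
  cube.\<close>

lemma card_lattice_points_tendsto:
  fixes w :: "nat \<Rightarrow> int"
  assumes b: "b > 0" and w: "(\<lambda>N. real_of_int (w N) / real N) \<longlonglongrightarrow> b"
  shows "(\<lambda>N. real (card (lattice_points N (w N))) / (real N * (b * real N) ^ k)) \<longlonglongrightarrow> (LINT y|coord_measure. region_indicator b y)"
proof -
  interpret product_sigma_finite "\<lambda>_::nat. lborel :: real measure" ..
  \<comment> \<open>The boxes behind \<open>integral_lattice_indicator\<close> have finite volume for positive N, so the term for \<open>N = 0\<close> is set to 0.\<close>
  let ?h = "\<lambda>N y. if N = 0 then 0 else indicator (lattice_points N (w N)) (scaled_floor b N y) :: real"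
  have "(\<lambda>N. (real_of_int (w N) / real N + 1 / real N) / b) \<longlonglongrightarrow> (b + 0) / b"
    by (intro tendsto_intros w lim_1_over_n) (use b in auto)
  hence "Bseq (\<lambda>N. (real_of_int (w N) / real N + 1 / real N) / b)"
    by (intro convergent_imp_Bseq convergentI)
  then obtain K where K: "\<And>N. norm ((real_of_int (w N) / real N + 1 / real N) / b) \<le> K"
    by (rule BseqE) blast
  \<comment> \<open>K bounds \<open>(w N + 1) / (b N)\<close>, hence all coordinates except coordinate 0 of a point whose scaled floor lies in the domain.\<close>
  define Kbox where "Kbox = PiE {0..k} (\<lambda>l. {- (K + 1)..K + 1})"
  have K0: "K \<ge> 0" using K[of 0] by simp
  have Kfin: "emeasure coord_measure Kbox < \<infinity>"
  proof -
    have "emeasure coord_measure Kbox = (\<Prod>l\<in>{0..k}. emeasure lborel {- (K + 1)..K + 1})"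
      unfolding Kbox_def by (intro emeasure_PiM) auto
    also have "\<dots> = (\<Prod>l\<in>{0..k}. ennreal (2 * (K + 1)))" using K0 by (intro prod.cong refl) simp
    also have "\<dots> = ennreal (\<Prod>l\<in>{0..k}. 2 * (K + 1))" using K0 by (intro prod_ennreal) simp
    finally show ?thesis by simp
  qed
  have Kset: "Kbox \<in> sets coord_measure" unfolding Kbox_def by (intro sets_PiM_I_finite) auto
  have h_int: "integrable coord_measure (?h N)" for N
    using integral_lattice_indicator(1)[OF b, of N "w N"] by (cases "N = 0") auto
  have dom: "norm (?h N y) \<le> indicator Kbox y" if y: "y \<in> space coord_measure" for N y
  proof (cases "N > 0 \<and> scaled_floor b N y \<in> lattice_points N (w N)")
    case True
    hence N: "real N > 0" and u: "scaled_floor b N y \<in> lattice_points N (w N)" by auto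
    have "y l \<in> {- (K + 1)..K + 1}" if l: "l \<in> {0..k}" for l
    proof (cases "l = 0")
      case True
      have "0 \<le> partial_pos (scaled_floor b N y) 0 \<and> partial_pos (scaled_floor b N y) 0 < int N"
        using u unfolding lattice_points_def by (simp del: partial_pos_0)
      hence "0 \<le> \<lfloor>real N * y 0\<rfloor> \<and> \<lfloor>real N * y 0\<rfloor> < int N" by (simp add: scaled_floor_def)
      hence "0 \<le> real N * y 0 \<and> real N * y 0 < real N * 1" by linarith
      hence "0 \<le> y 0 \<and> y 0 < 1" using N by (simp add: zero_le_mult_iff)
      thus ?thesis using True K0 by simp
    next
      case False
      have "\<bar>scaled_floor b N y l\<bar> \<le> w N" using u l False unfolding lattice_points_def by simp
      hence "\<bar>\<lfloor>b * real N * y l\<rfloor>\<bar> \<le> w N" using l False by (simp add: scaled_floor_def)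
      hence "\<bar>b * real N * y l\<bar> \<le> real_of_int (w N) + 1" by linarith
      hence "b * real N * \<bar>y l\<bar> \<le> real_of_int (w N) + 1" using b N by (simp add: abs_mult)
      hence "\<bar>y l\<bar> \<le> (real_of_int (w N) / real N + 1 / real N) / b" using b N by (simp add: field_simps)
      hence "\<bar>y l\<bar> \<le> K" using K[of N] unfolding real_norm_def by linarith
      thus ?thesis unfolding atLeastAtMost_iff by linarith
    qed
    hence "y \<in> Kbox" using y unfolding Kbox_def by (auto simp: space_PiM PiE_iff)
    thus ?thesis by (simp add: indicator_def)
  qed (auto simp: indicator_def)
  have lim: "AE y in coord_measure. (\<lambda>N. ?h N y) \<longlonglongrightarrow> region_indicator b y"
    using AE_generic_point[of b] AE_space[of coord_measure]
  proof eventually_elim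
    case (elim y)
    have "\<forall>\<^sub>F N in sequentially. indicator (lattice_points N (w N)) (scaled_floor b N y) = ?h N y"
      using eventually_gt_at_top[of 0] by eventually_elim simp
    from Lim_transform_eventually[OF lattice_indicator_tendsto[OF b w elim(2,1)] this] show ?case .
  qed
  have rm: "region_indicator b \<in> borel_measurable coord_measure"
  proof -
    have meas: "(\<lambda>y. y l) \<in> borel_measurable coord_measure" if "l \<in> {0..k}" for l
      using that measurable_component_singleton[of l "{0..k}" "\<lambda>_. lborel :: real measure"] by simp
    have box: "unit_box \<in> sets coord_measure"
      by (intro sets_PiM_I_finite) auto
    have "(\<lambda>y. indicator {0..1} (y 0 + b * (\<Sum>i = 1..j. of_int (e i) * y (lab i))) :: real) \<in> borel_measurable coord_measure"
      if j: "j \<in> {1..2*k}" for j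
    proof -
      have l: "lab i \<in> {0..k}" if "i \<in> {1..j}" for i
        using lab_in[of i] that j by auto
      have "(\<lambda>y. y 0 + b * (\<Sum>i = 1..j. of_int (e i) * y (lab i))) \<in> borel_measurable coord_measure"
        by (intro borel_measurable_add borel_measurable_times borel_measurable_sum borel_measurable_const meas l) simp
      from measurable_compose[OF this, of "indicator {0..1}" borel] show ?thesis by simp
    qed
    hence "(\<lambda>y. \<Prod>j = 1..2 * k. indicator {0..1} (y 0 + b * (\<Sum>i = 1..j. of_int (e i) * y (lab i))) :: real) \<in> borel_measurable coord_measure"
      by (rule borel_measurable_prod)
    thus ?thesis unfolding region_indicator_def using box
      by (intro borel_measurable_times borel_measurable_indicator)
  qed
  have Kint: "integrable coord_measure (indicator Kbox :: _ \<Rightarrow> real)"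
    by (rule integrable_real_indicator[OF Kset Kfin])
  note dct = rm borel_measurable_integrable[OF h_int] Kint lim AE_I2[OF dom]
  have "(\<lambda>N. integral\<^sup>L coord_measure (?h N)) \<longlonglongrightarrow> (LINT y|coord_measure. region_indicator b y)"
    by (rule integral_dominated_convergence[OF dct])
  moreover have "\<forall>\<^sub>F N in sequentially. integral\<^sup>L coord_measure (?h N) = real (card (lattice_points N (w N))) / (real N * (b * real N) ^ k)"
    using eventually_gt_at_top[of 0] by eventually_elim (simp add: integral_lattice_indicator(2)[OF b])
  ultimately show "(\<lambda>N. real (card (lattice_points N (w N))) / (real N * (b * real N) ^ k)) \<longlonglongrightarrow> (LINT y|coord_measure. region_indicator b y)"
    by (rule Lim_transform_eventually)
qed

end

section \<open>Traces of powers as sums over closed walks\<close>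

text \<open>Summing against an arbitrary kernel F keeps both end points of the path free, which is
  what makes the induction on the length go through; the trace is the case where F closes the
  path.\<close>

lemma bilinear_power_expansion:
  fixes B :: "real mat"
  assumes B: "B \<in> carrier_mat d d"
  shows "(\<Sum>i<d. \<Sum>j<d. F i j * (B ^\<^sub>m n) $$ (i, j)) =
    (\<Sum>p\<in>PiE {..n} (\<lambda>_. {..<d}). F (p 0) (p n) * (\<Prod>q<n. B $$ (p q, p (Suc q))))"
proof (induction n arbitrary: F)
  case 0
  have "(\<Sum>i<d. \<Sum>j<d. F i j * (B ^\<^sub>m 0) $$ (i, j)) = (\<Sum>i<d. \<Sum>j<d. if j = i then F i i else 0)"
    using B by (intro sum.cong refl) auto
  also have "\<dots> = (\<Sum>i<d. F i i)" by simp
  also have "\<dots> = (\<Sum>p\<in>PiE {..0::nat} (\<lambda>_. {..<d}). F (p 0) (p 0))"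
    by (rule sum.reindex_bij_witness[where i = "\<lambda>p. p 0" and j = "\<lambda>x. restrict (\<lambda>_. x) {..0}"])
      (auto simp: PiE_def extensional_def)
  finally show ?case by simp
next
  case (Suc n)
  have Bn: "B ^\<^sub>m n \<in> carrier_mat d d" using B by simp
  let ?W = "\<lambda>p. \<Prod>q<n. B $$ (p q, p (Suc q))"
  have "(\<Sum>i<d. \<Sum>j<d. F i j * (B ^\<^sub>m Suc n) $$ (i, j))
      = (\<Sum>i<d. \<Sum>j<d. \<Sum>l<d. F i j * ((B ^\<^sub>m n) $$ (i, l) * B $$ (l, j)))"
    using B Bn by (intro sum.cong refl) (auto simp: scalar_prod_def lessThan_atLeast0 sum_distrib_left)
  also have "\<dots> = (\<Sum>i<d. \<Sum>l<d. (\<Sum>j<d. F i j * B $$ (l, j)) * (B ^\<^sub>m n) $$ (i, l))"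
  proof (rule sum.cong[OF refl])
    fix i
    have "(\<Sum>j<d. \<Sum>l<d. F i j * ((B ^\<^sub>m n) $$ (i, l) * B $$ (l, j)))
        = (\<Sum>l<d. \<Sum>j<d. F i j * ((B ^\<^sub>m n) $$ (i, l) * B $$ (l, j)))" by (rule sum.swap)
    also have "\<dots> = (\<Sum>l<d. (\<Sum>j<d. F i j * B $$ (l, j)) * (B ^\<^sub>m n) $$ (i, l))"
      unfolding sum_distrib_right by (intro sum.cong refl) (simp add: mult_ac)
    finally show "(\<Sum>j<d. \<Sum>l<d. F i j * ((B ^\<^sub>m n) $$ (i, l) * B $$ (l, j)))
        = (\<Sum>l<d. (\<Sum>j<d. F i j * B $$ (l, j)) * (B ^\<^sub>m n) $$ (i, l))" .
  qed
  also have "\<dots> = (\<Sum>p\<in>PiE {..n} (\<lambda>_. {..<d}). (\<Sum>j<d. F (p 0) j * B $$ (p n, j)) * ?W p)"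
    by (rule Suc.IH)
  also have "\<dots> = (\<Sum>p\<in>PiE {..n} (\<lambda>_. {..<d}). \<Sum>j<d. F (p 0) j * (?W p * B $$ (p n, j)))"
    unfolding sum_distrib_right by (intro sum.cong refl) (simp add: mult_ac)
  also have "\<dots> = (\<Sum>j<d. \<Sum>p\<in>PiE {..n} (\<lambda>_. {..<d}). F (p 0) j * (?W p * B $$ (p n, j)))"
    by (rule sum.swap)
  also have "\<dots> = (\<Sum>(j, p)\<in>{..<d} \<times> PiE {..n} (\<lambda>_. {..<d}). F (p 0) j * (?W p * B $$ (p n, j)))"
    by (rule sum.cartesian_product)
  also have "\<dots> = (\<Sum>p\<in>PiE {..Suc n} (\<lambda>_. {..<d}). F (p 0) (p (Suc n)) * (\<Prod>q<Suc n. B $$ (p q, p (Suc q))))"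
  proof (rule sum.reindex_bij_witness[where j = "\<lambda>(j, p). p(Suc n := j)" and i = "\<lambda>p. (p (Suc n), restrict p {..n})"])
    fix a assume "a \<in> {..<d} \<times> PiE {..n} (\<lambda>_. {..<d})"
    then obtain j p where a: "a = (j, p)" "j < d" "p \<in> PiE {..n} (\<lambda>_. {..<d})" by auto
    have r: "restrict (p(Suc n := j)) {..n} = p"
      using a(3) by (intro ext) (auto simp: PiE_def extensional_def)
    show "((case a of (j, p) \<Rightarrow> p(Suc n := j)) (Suc n), restrict (case a of (j, p) \<Rightarrow> p(Suc n := j)) {..n}) = a"
      using a r by simp
    show "(case a of (j, p) \<Rightarrow> p(Suc n := j)) \<in> PiE {..Suc n} (\<lambda>_. {..<d})"
      using a by (auto simp: PiE_def extensional_def Pi_def)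
    have "(\<Prod>q<n. B $$ ((p(Suc n := j)) q, (p(Suc n := j)) (Suc q))) = ?W p"
      by (intro prod.cong refl) auto
    thus "F ((case a of (j, p) \<Rightarrow> p(Suc n := j)) 0) ((case a of (j, p) \<Rightarrow> p(Suc n := j)) (Suc n)) *
        (\<Prod>q<Suc n. B $$ ((case a of (j, p) \<Rightarrow> p(Suc n := j)) q, (case a of (j, p) \<Rightarrow> p(Suc n := j)) (Suc q)))
       = (case a of (j, p) \<Rightarrow> F (p 0) j * (?W p * B $$ (p n, j)))"
      using a by simp
  next
    fix p assume p: "p \<in> PiE {..Suc n} (\<lambda>_. {..<d})"
    show "(case (p (Suc n), restrict p {..n}) of (j, p) \<Rightarrow> p(Suc n := j)) = p"
      using p by (intro ext) (auto simp: PiE_def extensional_def)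
    show "(p (Suc n), restrict p {..n}) \<in> {..<d} \<times> PiE {..n} (\<lambda>_. {..<d})"
      using p by (auto simp: PiE_def Pi_def)
  qed
  finally show ?case .
qed

lemma trace_power_expansion:
  fixes B :: "real mat"
  assumes B: "B \<in> carrier_mat d d" and n: "n > 0"
  shows "trace_mat (B ^\<^sub>m n) = (\<Sum>p\<in>PiE {..<n} (\<lambda>_. {..<d}). \<Prod>q<n. B $$ (p q, p (Suc q mod n)))"
proof -
  obtain r where r: "n = Suc r" using n by (cases n) auto
  have Br: "B ^\<^sub>m r \<in> carrier_mat d d" using B by simp
  have "trace_mat (B ^\<^sub>m n) = (\<Sum>i<d. \<Sum>l<d. B $$ (l, i) * (B ^\<^sub>m r) $$ (i, l))"
    using B Br by (auto simp: r trace_mat_def scalar_prod_def lessThan_atLeast0 mult.commute intro!: sum.cong)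
  also have "\<dots> = (\<Sum>p\<in>PiE {..r} (\<lambda>_. {..<d}). B $$ (p r, p 0) * (\<Prod>q<r. B $$ (p q, p (Suc q))))"
    by (rule bilinear_power_expansion[OF B, of "\<lambda>i l. B $$ (l, i)"])
  also have "\<dots> = (\<Sum>p\<in>PiE {..<n} (\<lambda>_. {..<d}). \<Prod>q<n. B $$ (p q, p (Suc q mod n)))"
  proof (intro sum.cong)
    show "PiE {..r} (\<lambda>_. {..<d}) = PiE {..<n} (\<lambda>_. {..<d})" by (simp add: r lessThan_Suc_atMost)
    fix p :: "nat \<Rightarrow> nat"
    have "(\<Prod>q<r. B $$ (p q, p (Suc q))) = (\<Prod>q<r. B $$ (p q, p (Suc q mod n)))"
      by (intro prod.cong refl) (auto simp: r)
    thus "B $$ (p r, p 0) * (\<Prod>q<r. B $$ (p q, p (Suc q))) = (\<Prod>q<n. B $$ (p q, p (Suc q mod n)))"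
      by (simp add: r mult.commute)
  qed
  finally show ?thesis .
qed

lemma block_toeplitz_carrier: "block_toeplitz m N B \<in> carrier_mat (m * N) (m * N)"
  by (simp add: block_toeplitz_def)

text \<open>A matrix index is split into its block index (quotient by m) and its index inside the
  block (remainder).\<close>

lemma trace_block_toeplitz_power:
  assumes n: "n > 0" and m: "m > 0"
  shows "trace_mat (block_toeplitz m N B ^\<^sub>m n) =
    (\<Sum>(I, t)\<in>walks n N \<times> walks n m. \<Prod>q<n. B (closed_step n I q) $$ (t q, t (Suc q mod n)))"
proof -
  have "trace_mat (block_toeplitz m N B ^\<^sub>m n) =
    (\<Sum>p\<in>walks n (m * N). \<Prod>q<n. block_toeplitz m N B $$ (p q, p (Suc q mod n)))"
    by (rule trace_power_expansion[OF block_toeplitz_carrier n])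
  also have "\<dots> = (\<Sum>(I, t)\<in>walks n N \<times> walks n m. \<Prod>q<n. B (closed_step n I q) $$ (t q, t (Suc q mod n)))"
  proof (rule sum.reindex_bij_witness[where i = "\<lambda>(I, t). restrict (\<lambda>q. I q * m + t q) {..<n}"
        and j = "\<lambda>p. (restrict (\<lambda>q. p q div m) {..<n}, restrict (\<lambda>q. p q mod m) {..<n})"])
    fix p assume p: "p \<in> walks n (m * N)"
    have pm: "p q < m * N" if "q < n" for q using PiE_mem[OF p, of q] that by simp
    show "(case (restrict (\<lambda>q. p q div m) {..<n}, restrict (\<lambda>q. p q mod m) {..<n}) of (I, t) \<Rightarrow>
        restrict (\<lambda>q. I q * m + t q) {..<n}) = p"
      using p by (intro ext) (auto simp: PiE_def extensional_def)
    have "p q div m < N" if "q < n" for q using pm[OF that] by (simp add: less_mult_imp_div_less mult.commute)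
    thus "(restrict (\<lambda>q. p q div m) {..<n}, restrict (\<lambda>q. p q mod m) {..<n}) \<in> walks n N \<times> walks n m"
      using m by (auto simp: restrict_PiE_iff)
    have "B (closed_step n (restrict (\<lambda>q. p q div m) {..<n}) q) $$
        (restrict (\<lambda>q. p q mod m) {..<n} q, restrict (\<lambda>q. p q mod m) {..<n} (Suc q mod n)) =
        block_toeplitz m N B $$ (p q, p (Suc q mod n))" if q: "q < n" for q
    proof -
      have q': "Suc q mod n < n" using n by simp
      show ?thesis using pm[OF q] pm[OF q'] q q' by (simp add: block_toeplitz_def closed_step_def)
    qed
    thus "(case (restrict (\<lambda>q. p q div m) {..<n}, restrict (\<lambda>q. p q mod m) {..<n}) of (I, t) \<Rightarrow>
         \<Prod>q<n. B (closed_step n I q) $$ (t q, t (Suc q mod n))) = (\<Prod>q<n. block_toeplitz m N B $$ (p q, p (Suc q mod n)))"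
      by (simp only: prod.case) (intro prod.cong refl, simp)
  next
    fix It assume "It \<in> walks n N \<times> walks n m"
    then obtain I t where It: "It = (I, t)" "I \<in> walks n N" "t \<in> walks n m" by auto
    have b: "I q < N" "t q < m" if "q < n" for q using PiE_mem[OF It(2), of q] PiE_mem[OF It(3), of q] that by auto
    have d: "(I q * m + t q) div m = I q" "(I q * m + t q) mod m = t q" if "q < n" for q
      using b[OF that] m by auto
    have lt: "I q * m + t q < m * N" if "q < n" for q
    proof -
      have "I q * m + t q < (I q + 1) * m" using b[OF that] by simp
      also have "\<dots> \<le> N * m" using b[OF that] by (intro mult_right_mono) auto
      finally show ?thesis by (simp add: mult.commute)
    qed
    have "restrict (\<lambda>q. (I q * m + t q) div m) {..<n} = I" "restrict (\<lambda>q. (I q * m + t q) mod m) {..<n} = t"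
      using It(2,3) d by (auto simp: PiE_def extensional_def fun_eq_iff)
    moreover have "restrict (\<lambda>q. restrict (\<lambda>q. I q * m + t q) {..<n} q div m) {..<n} = restrict (\<lambda>q. (I q * m + t q) div m) {..<n}"
      "restrict (\<lambda>q. restrict (\<lambda>q. I q * m + t q) {..<n} q mod m) {..<n} = restrict (\<lambda>q. (I q * m + t q) mod m) {..<n}"
      by (auto simp: fun_eq_iff)
    ultimately show "(restrict (\<lambda>q. (case It of (I, t) \<Rightarrow> restrict (\<lambda>q. I q * m + t q) {..<n}) q div m) {..<n},
        restrict (\<lambda>q. (case It of (I, t) \<Rightarrow> restrict (\<lambda>q. I q * m + t q) {..<n}) q mod m) {..<n}) = It"
      using It by simp
    show "(case It of (I, t) \<Rightarrow> restrict (\<lambda>q. I q * m + t q) {..<n}) \<in> walks n (m * N)"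
      using It lt by (auto simp: restrict_PiE_iff)
  qed
  finally show ?thesis .
qed

section \<open>Mixed moments of independent entries\<close>

lemma prod_abs_le_sum_power:
  fixes x :: "'i \<Rightarrow> real"
  assumes "finite Q" "Q \<noteq> {}"
  shows "(\<Prod>q\<in>Q. \<bar>x q\<bar>) \<le> (\<Sum>q\<in>Q. \<bar>x q\<bar> ^ card Q)"
proof -
  have "Max ((\<lambda>q. \<bar>x q\<bar>) ` Q) \<in> (\<lambda>q. \<bar>x q\<bar>) ` Q" using assms by (intro Max_in) auto
  then obtain r where r: "r \<in> Q" "\<bar>x r\<bar> = Max ((\<lambda>q. \<bar>x q\<bar>) ` Q)" by auto
  have "(\<Prod>q\<in>Q. \<bar>x q\<bar>) \<le> (\<Prod>q\<in>Q. \<bar>x r\<bar>)"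
    unfolding r(2) using assms by (intro prod_mono conjI Max_ge) auto
  also have "\<dots> = \<bar>x r\<bar> ^ card Q" by simp
  also have "\<dots> \<le> (\<Sum>q\<in>Q. \<bar>x q\<bar> ^ card Q)" using assms r by (intro member_le_sum) auto
  finally show ?thesis .
qed

text \<open>Independent variables with mean 0 and variance 1 whose moments have a common bound
  \<open>\<kappa>\<close>.\<close>

locale independent_entries = prob_space M for M :: "'w measure" +
  fixes X :: "'v \<Rightarrow> 'w \<Rightarrow> real" and V :: "'v set" and \<kappa> :: "nat \<Rightarrow> real"
  assumes indep: "indep_vars (\<lambda>_. borel) X V"
    and power_integrable: "\<And>v k. v \<in> V \<Longrightarrow> integrable M (\<lambda>\<omega>. X v \<omega> ^ k)"
    and mean_zero: "\<And>v. v \<in> V \<Longrightarrow> expectation (X v) = 0"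
    and variance_one: "\<And>v. v \<in> V \<Longrightarrow> expectation (\<lambda>\<omega>. X v \<omega> ^ 2) = 1"
    and moment_bound: "\<And>v k. v \<in> V \<Longrightarrow> expectation (\<lambda>\<omega>. \<bar>X v \<omega>\<bar> ^ k) \<le> \<kappa> k"
begin

text \<open>Factors may coincide: \<open>c\<close> assigns to each position the variable that stands
  there.\<close>

definition mixed :: "'i set \<Rightarrow> ('i \<Rightarrow> 'v) \<Rightarrow> real" where
  "mixed Q c = expectation (\<lambda>\<omega>. \<Prod>q\<in>Q. X (c q) \<omega>)"

lemma
  assumes Q: "finite Q" and c: "c ` Q \<subseteq> V"
  shows mixed_integrable: "integrable M (\<lambda>\<omega>. \<Prod>q\<in>Q. X (c q) \<omega>)"
    and mixed_eq: "mixed Q c = (\<Prod>v\<in>c ` Q. expectation (\<lambda>\<omega>. X v \<omega> ^ card {q\<in>Q. c q = v}))"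
proof -
  have e: "(\<Prod>q\<in>Q. X (c q) \<omega>) = (\<Prod>v\<in>c ` Q. X v \<omega> ^ card {q\<in>Q. c q = v})" for \<omega>
  proof -
    have "(\<Prod>q\<in>Q. X (c q) \<omega>) = (\<Prod>v\<in>c ` Q. \<Prod>q\<in>{q\<in>Q. c q = v}. X (c q) \<omega>)"
      by (rule prod.image_gen[OF Q])
    also have "\<dots> = (\<Prod>v\<in>c ` Q. X v \<omega> ^ card {q\<in>Q. c q = v})"
      by (intro prod.cong refl) simp
    finally show ?thesis .
  qed
  have i: "indep_vars (\<lambda>_. borel) (\<lambda>v \<omega>. X v \<omega> ^ card {q\<in>Q. c q = v}) (c ` Q)"
    by (rule indep_vars_compose2[OF indep_vars_subset[OF indep c]]) simp
  have int: "integrable M (\<lambda>\<omega>. X v \<omega> ^ card {q\<in>Q. c q = v})" if "v \<in> c ` Q" for v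
    using power_integrable that c by blast
  show "integrable M (\<lambda>\<omega>. \<Prod>q\<in>Q. X (c q) \<omega>)"
    unfolding e by (rule indep_vars_integrable[OF _ i int]) (use Q in auto)
  show "mixed Q c = (\<Prod>v\<in>c ` Q. expectation (\<lambda>\<omega>. X v \<omega> ^ card {q\<in>Q. c q = v}))"
    unfolding mixed_def e by (rule indep_vars_lebesgue_integral[OF _ i int]) (use Q in auto)
qed

lemma abs_power_integrable: "v \<in> V \<Longrightarrow> integrable M (\<lambda>\<omega>. \<bar>X v \<omega>\<bar> ^ k)"
  using integrable_abs[OF power_integrable[of v k]] by (simp add: power_abs)

text \<open>A product of \<open>card Q\<close> numbers is at most the largest of their powers of
  order \<open>card Q\<close>.\<close>

lemma abs_mixed_le:
  assumes Q: "finite Q" and c: "c ` Q \<subseteq> V"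
  shows "\<bar>mixed Q c\<bar> \<le> 1 + real (card Q) * \<bar>\<kappa> (card Q)\<bar>"
proof (cases "Q = {}")
  case True
  thus ?thesis by (simp add: mixed_def prob_space)
next
  case False
  have cV: "c q \<in> V" if "q \<in> Q" for q using c that by blast
  have "\<bar>mixed Q c\<bar> \<le> expectation (\<lambda>\<omega>. \<bar>\<Prod>q\<in>Q. X (c q) \<omega>\<bar>)"
    unfolding mixed_def by (rule integral_abs_bound)
  also have "\<dots> \<le> expectation (\<lambda>\<omega>. \<Sum>q\<in>Q. \<bar>X (c q) \<omega>\<bar> ^ card Q)"
  proof (rule integral_mono)
    show "integrable M (\<lambda>\<omega>. \<bar>\<Prod>q\<in>Q. X (c q) \<omega>\<bar>)" by (intro integrable_abs mixed_integrable Q c)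
    show "integrable M (\<lambda>\<omega>. \<Sum>q\<in>Q. \<bar>X (c q) \<omega>\<bar> ^ card Q)"
      by (intro Bochner_Integration.integrable_sum abs_power_integrable cV)
    show "\<bar>\<Prod>q\<in>Q. X (c q) \<omega>\<bar> \<le> (\<Sum>q\<in>Q. \<bar>X (c q) \<omega>\<bar> ^ card Q)" for \<omega>
      unfolding abs_prod by (rule prod_abs_le_sum_power[OF Q False])
  qed
  also have "\<dots> = (\<Sum>q\<in>Q. expectation (\<lambda>\<omega>. \<bar>X (c q) \<omega>\<bar> ^ card Q))"
    by (intro Bochner_Integration.integral_sum abs_power_integrable cV)
  also have "\<dots> \<le> (\<Sum>q\<in>Q. \<bar>\<kappa> (card Q)\<bar>)"
    by (intro sum_mono order_trans[OF moment_bound[OF cV]]) auto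
  finally show ?thesis by simp
qed

lemma mixed_unique_zero:
  assumes Q: "finite Q" and c: "c ` Q \<subseteq> V" and x: "x \<in> Q" "\<And>y. y \<in> Q \<Longrightarrow> c y = c x \<Longrightarrow> y = x"
  shows "mixed Q c = 0"
proof -
  have "{q\<in>Q. c q = c x} = {x}" using x by auto
  hence "expectation (\<lambda>\<omega>. X (c x) \<omega> ^ card {q\<in>Q. c q = c x}) = 0" using mean_zero[of "c x"] x c by auto
  thus ?thesis unfolding mixed_eq[OF Q c] using Q x(1) by (intro prod_zero) auto
qed

lemma mixed_pairs_one:
  assumes Q: "finite Q" and c: "c ` Q \<subseteq> V" and two: "\<And>v. v \<in> c ` Q \<Longrightarrow> card {q\<in>Q. c q = v} = 2"
  shows "mixed Q c = 1"
  unfolding mixed_eq[OF Q c] using two variance_one c by (intro prod.neutral ballI) auto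

lemma mixed_Un_disjoint:
  assumes Q: "finite Q" "finite R" "Q \<inter> R = {}" and c: "c ` Q \<subseteq> V" "c ` R \<subseteq> V" and d: "c ` Q \<inter> c ` R = {}"
  shows "mixed (Q \<union> R) c = mixed Q c * mixed R c"
proof -
  have "mixed (Q \<union> R) c = (\<Prod>v\<in>c ` Q \<union> c ` R. expectation (\<lambda>\<omega>. X v \<omega> ^ card {q\<in>Q \<union> R. c q = v}))"
    using Q c by (subst mixed_eq) (auto simp: image_Un)
  also have "\<dots> = (\<Prod>v\<in>c ` Q. expectation (\<lambda>\<omega>. X v \<omega> ^ card {q\<in>Q \<union> R. c q = v})) *
      (\<Prod>v\<in>c ` R. expectation (\<lambda>\<omega>. X v \<omega> ^ card {q\<in>Q \<union> R. c q = v}))"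
    by (rule prod.union_disjoint) (use Q d in auto)
  also have "(\<Prod>v\<in>c ` Q. expectation (\<lambda>\<omega>. X v \<omega> ^ card {q\<in>Q \<union> R. c q = v})) = mixed Q c"
    unfolding mixed_eq[OF Q(1) c(1)]
  proof (intro prod.cong refl)
    fix v assume "v \<in> c ` Q"
    hence "{q\<in>Q \<union> R. c q = v} = {q\<in>Q. c q = v}" using d by blast
    thus "expectation (\<lambda>\<omega>. X v \<omega> ^ card {q\<in>Q \<union> R. c q = v}) = expectation (\<lambda>\<omega>. X v \<omega> ^ card {q\<in>Q. c q = v})" by simp
  qed
  also have "(\<Prod>v\<in>c ` R. expectation (\<lambda>\<omega>. X v \<omega> ^ card {q\<in>Q \<union> R. c q = v})) = mixed R c"
    unfolding mixed_eq[OF Q(2) c(2)]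
  proof (intro prod.cong refl)
    fix v assume "v \<in> c ` R"
    hence "{q\<in>Q \<union> R. c q = v} = {q\<in>R. c q = v}" using d by blast
    thus "expectation (\<lambda>\<omega>. X v \<omega> ^ card {q\<in>Q \<union> R. c q = v}) = expectation (\<lambda>\<omega>. X v \<omega> ^ card {q\<in>R. c q = v})" by simp
  qed
  finally show ?thesis .
qed

text \<open>The product along the j-th of several walks of length n.\<close>

definition word :: "nat \<Rightarrow> ('j \<times> nat \<Rightarrow> 'v) \<Rightarrow> 'j \<Rightarrow> 'w \<Rightarrow> real" where
  "word n c j \<omega> = (\<Prod>q<n. X (c (j, q)) \<omega>)"

abbreviation central_moment :: "'j set \<Rightarrow> nat \<Rightarrow> ('j \<times> nat \<Rightarrow> 'v) \<Rightarrow> real" where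
  "central_moment J n c \<equiv> expectation (\<lambda>\<omega>. \<Prod>j\<in>J. (word n c j \<omega> - expectation (word n c j)))"

lemma prod_words: "(\<Prod>j\<in>S. word n c j \<omega>) = (\<Prod>x\<in>S \<times> {..<n}. X (c x) \<omega>)"
  unfolding word_def by (simp add: prod.cartesian_product)

lemma
  assumes J: "finite J" and c: "c ` (J \<times> {..<n}) \<subseteq> V"
  shows centred_integrable: "integrable M (\<lambda>\<omega>. \<Prod>j\<in>J. (word n c j \<omega> - expectation (word n c j)))"
    and centred_expansion: "central_moment J n c =
       (\<Sum>S\<in>Pow J. mixed (S \<times> {..<n}) c * (\<Prod>j\<in>J - S. - mixed ({j} \<times> {..<n}) c))"
proof -
  have w: "expectation (word n c j) = mixed ({j} \<times> {..<n}) c" for j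
  proof -
    have "word n c j = (\<lambda>\<omega>. \<Prod>x\<in>{j} \<times> {..<n}. X (c x) \<omega>)"
      using prod_words[of n c _ "{j}"] by (intro ext) simp
    thus ?thesis by (simp add: mixed_def)
  qed
  have e: "(\<Prod>j\<in>J. (word n c j \<omega> - expectation (word n c j))) =
      (\<Sum>S\<in>Pow J. (\<Prod>x\<in>S \<times> {..<n}. X (c x) \<omega>) * (\<Prod>j\<in>J - S. - mixed ({j} \<times> {..<n}) c))" for \<omega>
    using prod_add[OF J, of "\<lambda>j. word n c j \<omega>" "\<lambda>j. - expectation (word n c j)"]
    unfolding prod_words w by simp
  have i: "integrable M (\<lambda>\<omega>. (\<Prod>x\<in>S \<times> {..<n}. X (c x) \<omega>) * (\<Prod>j\<in>J - S. - mixed ({j} \<times> {..<n}) c))"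
    if "S \<in> Pow J" for S
  proof (intro integrable_mult_left mixed_integrable)
    show "finite (S \<times> {..<n})" using that J finite_subset by blast
    show "c ` (S \<times> {..<n}) \<subseteq> V" using that c by blast
  qed
  show "integrable M (\<lambda>\<omega>. \<Prod>j\<in>J. (word n c j \<omega> - expectation (word n c j)))"
    unfolding e by (intro Bochner_Integration.integrable_sum i)
  show "central_moment J n c =
       (\<Sum>S\<in>Pow J. mixed (S \<times> {..<n}) c * (\<Prod>j\<in>J - S. - mixed ({j} \<times> {..<n}) c))"
    unfolding e by (subst Bochner_Integration.integral_sum[OF i]) (auto simp: mixed_def)
qed

text \<open>If a variable occurs only once, it contributes a factor 0 to each term of the expansion,
  in the joint mean or in the mean of its own word.\<close>

lemma centred_unique_zero:
  assumes J: "finite J" and c: "c ` (J \<times> {..<n}) \<subseteq> V" and x: "x \<in> J \<times> {..<n}"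
    "\<And>y. y \<in> J \<times> {..<n} \<Longrightarrow> c y = c x \<Longrightarrow> y = x"
  shows "central_moment J n c = 0"
  unfolding centred_expansion[OF J c]
proof (intro sum.neutral ballI)
  fix S assume S: "S \<in> Pow J"
  have fS: "finite S" using S J finite_subset by blast
  have z: "mixed (T \<times> {..<n}) c = 0" if "T \<subseteq> J" "fst x \<in> T" for T
  proof (rule mixed_unique_zero[where x = x])
    show "finite (T \<times> {..<n})" using that J finite_subset by blast
    show "c ` (T \<times> {..<n}) \<subseteq> V" using that c by blast
    show "x \<in> T \<times> {..<n}" using that x by (cases x) auto
    show "\<And>y. y \<in> T \<times> {..<n} \<Longrightarrow> c y = c x \<Longrightarrow> y = x" using that x by blast
  qed
  show "mixed (S \<times> {..<n}) c * (\<Prod>j\<in>J - S. - mixed ({j} \<times> {..<n}) c) = 0"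
  proof (cases "fst x \<in> S")
    case True thus ?thesis using z[of S] S by simp
  next
    case False
    have "(\<Prod>j\<in>J - S. - mixed ({j} \<times> {..<n}) c) = 0"
      using z[of "{fst x}"] x False J by (intro prod_zero) auto
    thus ?thesis by simp
  qed
qed

text \<open>The terms of the expansion for S and for \<open>insert j S\<close> cancel, since word j
  is independent of the others.\<close>

lemma centred_isolated_zero:
  assumes J: "finite J" and c: "c ` (J \<times> {..<n}) \<subseteq> V" and j: "j \<in> J"
    and iso: "\<And>q y. q < n \<Longrightarrow> y \<in> J \<times> {..<n} \<Longrightarrow> fst y \<noteq> j \<Longrightarrow> c y \<noteq> c (j, q)"
  shows "central_moment J n c = 0"
proof -
  \<comment> \<open>Subsets of J are paired according to whether they contain j.\<close>
  let ?K = "J - {j}"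
  let ?f = "\<lambda>S. mixed (S \<times> {..<n}) c * (\<Prod>i\<in>J - S. - mixed ({i} \<times> {..<n}) c)"
  have ins: "J = insert j ?K" using j by blast
  have "(\<Sum>S\<in>Pow J. ?f S) = (\<Sum>S\<in>Pow ?K \<union> insert j ` Pow ?K. ?f S)"
    by (subst (1) ins, subst Pow_insert) simp
  also have "\<dots> = (\<Sum>S\<in>Pow ?K. ?f S) + (\<Sum>S\<in>insert j ` Pow ?K. ?f S)"
    by (rule sum.union_disjoint) (use J in auto)
  also have "(\<Sum>S\<in>insert j ` Pow ?K. ?f S) = (\<Sum>S\<in>Pow ?K. ?f (insert j S))"
    by (subst sum.reindex) (auto intro!: inj_onI)
  also have "(\<Sum>S\<in>Pow ?K. ?f S) + (\<Sum>S\<in>Pow ?K. ?f (insert j S)) = (\<Sum>S\<in>Pow ?K. ?f S + ?f (insert j S))"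
    by (rule sum.distrib[symmetric])
  also have "\<dots> = 0"
  proof (intro sum.neutral ballI)
    fix S assume S: "S \<in> Pow ?K"
    have fS: "finite S" using S J by (meson Pow_iff finite_Diff finite_subset)
    have "mixed (insert j S \<times> {..<n}) c = mixed ({j} \<times> {..<n} \<union> S \<times> {..<n}) c"
      by (rule arg_cong[where f = "\<lambda>Q. mixed Q c"]) auto
    also have "\<dots> = mixed ({j} \<times> {..<n}) c * mixed (S \<times> {..<n}) c"
    proof (rule mixed_Un_disjoint)
      show "c ` ({j} \<times> {..<n}) \<inter> c ` (S \<times> {..<n}) = {}" using iso S by fastforce
    qed (use fS S j c in auto)
    finally have 1: "mixed (insert j S \<times> {..<n}) c = mixed ({j} \<times> {..<n}) c * mixed (S \<times> {..<n}) c" .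
    have 2: "J - S = insert j (J - insert j S)" using j S by blast
    have "(\<Prod>i\<in>J - S. - mixed ({i} \<times> {..<n}) c) = - mixed ({j} \<times> {..<n}) c * (\<Prod>i\<in>J - insert j S. - mixed ({i} \<times> {..<n}) c)"
      unfolding 2 using J by (subst prod.insert) auto
    thus "?f S + ?f (insert j S) = 0" unfolding 1 by simp
  qed
  finally show ?thesis unfolding centred_expansion[OF J c] .
qed

definition mixed_constant :: "nat \<Rightarrow> real" where
  "mixed_constant r = 1 + real r * \<bar>\<kappa> r\<bar>"

definition centred_constant :: "nat \<Rightarrow> nat \<Rightarrow> real" where
  "centred_constant l n = 2 ^ l * ((1 + (\<Sum>r\<le>l * n. mixed_constant r)) * (1 + mixed_constant n) ^ l)"

lemma abs_centred_le:
  assumes J: "finite J" and c: "c ` (J \<times> {..<n}) \<subseteq> V"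
  shows "\<bar>central_moment J n c\<bar> \<le> centred_constant (card J) n"
proof -
  have pos: "mixed_constant r \<ge> 0" for r by (simp add: mixed_constant_def)
  have "\<bar>\<Sum>S\<in>Pow J. mixed (S \<times> {..<n}) c * (\<Prod>j\<in>J - S. - mixed ({j} \<times> {..<n}) c)\<bar>
     \<le> (\<Sum>S\<in>Pow J. (1 + (\<Sum>r\<le>card J * n. mixed_constant r)) * (1 + mixed_constant n) ^ card J)"
  proof (rule order_trans[OF sum_abs], rule sum_mono)
    fix S assume S: "S \<in> Pow J"
    have fS: "finite S" using S J finite_subset by blast
    have "\<bar>mixed (S \<times> {..<n}) c\<bar> \<le> mixed_constant (card (S \<times> {..<n}))"
      unfolding mixed_constant_def by (rule abs_mixed_le) (use fS S c in auto)
    also have "\<dots> \<le> (\<Sum>r\<le>card J * n. mixed_constant r)"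
      by (rule member_le_sum) (use S J pos in \<open>auto simp: card_cartesian_product intro: mult_right_mono card_mono\<close>)
    finally have 1: "\<bar>mixed (S \<times> {..<n}) c\<bar> \<le> 1 + (\<Sum>r\<le>card J * n. mixed_constant r)" by simp
    have "\<bar>\<Prod>j\<in>J - S. - mixed ({j} \<times> {..<n}) c\<bar> \<le> (\<Prod>j\<in>J - S. 1 + mixed_constant n)"
      unfolding abs_prod
    proof (rule prod_mono, intro conjI)
      fix j assume "j \<in> J - S"
      hence "c ` ({j} \<times> {..<n}) \<subseteq> V" using c by blast
      from abs_mixed_le[OF _ this] show "\<bar>- mixed ({j} \<times> {..<n}) c\<bar> \<le> 1 + mixed_constant n"
        by (simp add: mixed_constant_def card_cartesian_product)
    qed simp
    also have "\<dots> \<le> (1 + mixed_constant n) ^ card J"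
      using pos[of n] J by (simp add: power_increasing card_mono)
    finally have 2: "\<bar>\<Prod>j\<in>J - S. - mixed ({j} \<times> {..<n}) c\<bar> \<le> (1 + mixed_constant n) ^ card J" .
    show "\<bar>mixed (S \<times> {..<n}) c * (\<Prod>j\<in>J - S. - mixed ({j} \<times> {..<n}) c)\<bar>
        \<le> (1 + (\<Sum>r\<le>card J * n. mixed_constant r)) * (1 + mixed_constant n) ^ card J"
      unfolding abs_mult using 1 2 by (rule mult_mono) (use pos in \<open>auto intro!: add_nonneg_nonneg sum_nonneg\<close>)
  qed
  also have "\<dots> = centred_constant (card J) n"
    unfolding centred_constant_def using J by (simp add: card_Pow)
  finally show ?thesis unfolding centred_expansion[OF J c] .
qed

end

section \<open>Walks whose steps cancel in pairs\<close>

text \<open>The fixed-point-free involution that matches each step with its only other occurrence,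
  with opposite sign.\<close>

definition step_matching :: "nat \<Rightarrow> (nat \<Rightarrow> nat) \<Rightarrow> (nat \<Rightarrow> nat) \<Rightarrow> bool" where
  "step_matching n I f \<longleftrightarrow>
     (\<forall>q<n. f q < n \<and> f q \<noteq> q \<and> f (f q) = q \<and> closed_step n I (f q) = - closed_step n I q \<and> closed_step n I q \<noteq> 0) \<and>
     (\<forall>q<n. \<forall>r<n. \<bar>closed_step n I r\<bar> = \<bar>closed_step n I q\<bar> \<longrightarrow> r = q \<or> r = f q)"

lemma step_matchingD:
  assumes "step_matching n I f"
  shows "q < n \<Longrightarrow> f q < n" "q < n \<Longrightarrow> f q \<noteq> q" "q < n \<Longrightarrow> f (f q) = q"
    "q < n \<Longrightarrow> closed_step n I (f q) = - closed_step n I q" "q < n \<Longrightarrow> closed_step n I q \<noteq> 0"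
    "q < n \<Longrightarrow> r < n \<Longrightarrow> \<bar>closed_step n I r\<bar> = \<bar>closed_step n I q\<bar> \<Longrightarrow> r = q \<or> r = f q"
  using conjunct1[OF assms[unfolded step_matching_def], rule_format, of q]
    conjunct2[OF assms[unfolded step_matching_def], rule_format, of q r]
  by (simp, simp, simp, simp, simp, blast)

lemma nondegenerate_matching:
  assumes rep: "repeated_steps n I" and nd: "\<not> degenerate_walk n I"
  shows "\<exists>f. step_matching n I f"
proof -
  let ?s = "closed_step n I"
  define f where "f q = (SOME r. r < n \<and> r \<noteq> q \<and> \<bar>?s r\<bar> = \<bar>?s q\<bar>)" for q
  have f: "f q < n \<and> f q \<noteq> q \<and> \<bar>?s (f q)\<bar> = \<bar>?s q\<bar>" if "q < n" for q
  proof -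
    have "\<exists>r. r < n \<and> r \<noteq> q \<and> \<bar>?s r\<bar> = \<bar>?s q\<bar>" using rep that unfolding repeated_def by auto
    thus ?thesis unfolding f_def by (rule someI_ex)
  qed
  have uniq: "r = q \<or> r = f q" if "q < n" "r < n" "\<bar>?s r\<bar> = \<bar>?s q\<bar>" for q r
  proof (rule ccontr)
    assume "\<not> (r = q \<or> r = f q)"
    hence "card {r, q, f q} = 3" using f[OF that(1)] by auto
    moreover have "{r, q, f q} \<subseteq> {..<n}" using f[OF that(1)] that by auto
    moreover have "\<bar>?s r\<bar> = \<bar>?s q\<bar>" "\<bar>?s q\<bar> = \<bar>?s (f q)\<bar>" using that f[OF that(1)] by auto
    ultimately show False using nd unfolding degenerate_walk_def by blast
  qed
  have neg: "?s (f q) = - ?s q" if "q < n" for q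
  proof -
    have "?s (f q) \<noteq> ?s q" using nd f[OF that] that unfolding degenerate_walk_def by blast
    thus ?thesis using f[OF that] by (auto simp: abs_eq_iff)
  qed
  have nz: "?s q \<noteq> 0" if "q < n" for q
  proof
    assume "?s q = 0"
    hence "?s (f q) = ?s q" using neg[OF that] by simp
    thus False using nd f[OF that] that unfolding degenerate_walk_def by blast
  qed
  have ff: "f (f q) = q" if "q < n" for q
  proof -
    have "q = f q \<or> q = f (f q)" using f[OF that] that by (intro uniq) auto
    thus ?thesis using f[OF that] by metis
  qed
  show ?thesis unfolding step_matching_def
    by (intro exI[of _ f] conjI allI impI) (use f ff neg nz uniq in auto)
qed

lemma nondegenerate_even:
  assumes rep: "repeated_steps n I" and nd: "\<not> degenerate_walk n I"
  shows "even n"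
proof -
  obtain f where "step_matching n I f" using nondegenerate_matching[OF rep nd] by blast
  note f = step_matchingD[OF this]
  let ?s = "\<lambda>q. \<bar>closed_step n I q\<bar>"
  have two: "card {x\<in>{..<n}. ?s x = v} = 2" if v: "v \<in> ?s ` {..<n}" for v
  proof -
    obtain q where q: "q < n" "v = ?s q" using v by auto
    have "{x\<in>{..<n}. ?s x = v} = {q, f q}" using f(6)[OF q(1)] f(1,4)[OF q(1)] q by auto
    thus ?thesis using f(2)[OF q(1)] by simp
  qed
  have "n = (\<Sum>v\<in>?s ` {..<n}. card {x\<in>{..<n}. ?s x = v})"
    using sum_card_fibres[of "{..<n}" ?s] by simp
  also have "\<dots> = 2 * card (?s ` {..<n})" using two by simp
  finally show ?thesis by (metis dvd_triv_left)
qed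

text \<open>The solutions of the linear system of \<open>\<pi>\<close> with values in
  \<open>{0..<m}\<close>; position q stands for the unknown with number \<open>q +
  1\<close>.\<close>

definition invariant_colourings :: "nat \<Rightarrow> nat \<Rightarrow> nat set set \<Rightarrow> (nat \<Rightarrow> nat) set" where
  "invariant_colourings m k \<pi> = {t \<in> walks (2 * k) m. \<forall>q<2*k. t q = t (partner \<pi> (Suc q) mod (2 * k))}"

lemma card_invariant_colourings:
  assumes \<pi>: "\<pi> \<in> pair_partitions k" and k: "k > 0"
  shows "card (invariant_colourings m k \<pi>) = m ^ (2 * k - system_rank k \<pi>)" "system_rank k \<pi> \<le> 2 * k"
proof -
  let ?\<sigma> = "\<lambda>q. partner \<pi> (Suc q) mod (2 * k)"
  have lt: "?\<sigma> q < 2 * k" for q using k by simp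
  have inj: "inj_on ?\<sigma> {..<2 * k}"
  proof (rule inj_onI)
    fix q r assume qr: "q \<in> {..<2 * k}" "r \<in> {..<2 * k}" "?\<sigma> q = ?\<sigma> r"
    have m: "Suc q \<in> {1..2 * k}" "Suc r \<in> {1..2 * k}" using qr by auto
    have b: "partner \<pi> (Suc q) \<in> {1..2 * k}" "partner \<pi> (Suc r) \<in> {1..2 * k}"
      using partner_in[OF \<pi> m(1)] partner_in[OF \<pi> m(2)] by auto
    have md: "x mod (2 * k) = (if x = 2 * k then 0 else x)" if "x \<in> {1..2 * k}" for x using that by auto
    have "partner \<pi> (Suc q) = partner \<pi> (Suc r)"
      using qr(3) b unfolding md[OF b(1)] md[OF b(2)] by (auto split: if_splits)
    hence "partner \<pi> (partner \<pi> (Suc q)) = partner \<pi> (partner \<pi> (Suc r))" by simp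
    thus "q = r" using partner_partner[OF \<pi> m(1)] partner_partner[OF \<pi> m(2)] by simp
  qed
  show "card (invariant_colourings m k \<pi>) = m ^ (2 * k - system_rank k \<pi>)" "system_rank k \<pi> \<le> 2 * k"
    using card_invariant_functions_rank(1)[OF lt inj, of m] card_invariant_functions_rank(2)[OF lt inj]
    unfolding invariant_colourings_def system_rank_def system_matrix_def by auto
qed

definition band_walks :: "nat \<Rightarrow> nat \<Rightarrow> int \<Rightarrow> (nat \<Rightarrow> nat) set" where
  "band_walks n N w = {I \<in> walks n N. \<forall>q<n. \<bar>closed_step n I q\<bar> \<le> w}"

lemma finite_walks: "finite (walks n N)"
  by (intro finite_PiE) auto

lemma finite_band_walks: "finite (band_walks n N w)"
  unfolding band_walks_def using finite_walks by simp

abbreviation walks_of_partition :: "nat \<Rightarrow> nat set set \<Rightarrow> nat \<Rightarrow> int \<Rightarrow> (nat \<Rightarrow> nat) set" where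
  "walks_of_partition k \<pi> \<equiv> labelled_pairing.paired_walks k (partner \<pi>)"

lemma walks_of_partition_iff:
  assumes "\<pi> \<in> pair_partitions k"
  shows "I \<in> walks_of_partition k \<pi> N w \<longleftrightarrow> I \<in> band_walks (2 * k) N w \<and>
     (\<forall>q<2*k. closed_step (2 * k) I (partner \<pi> (Suc q) - 1) = - closed_step (2 * k) I q)"
  unfolding labelled_pairing.paired_walks_def[OF labelled_pairing_of_partition[OF assms]] band_walks_def by blast

text \<open>The partition is read off from the matching, and any partition along which the steps
  cancel must match a position with the only other one of the same absolute step.\<close>

lemma nondegenerate_unique_partition:
  assumes fm: "step_matching (2 * k) I f" and I: "I \<in> band_walks (2 * k) N w"
  shows "\<exists>\<pi>\<in>pair_partitions k. (\<forall>q<2 * k. partner \<pi> (Suc q) = Suc (f q)) \<and> I \<in> walks_of_partition k \<pi> N w \<and>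
    (\<forall>\<rho>\<in>pair_partitions k. I \<in> walks_of_partition k \<rho> N w \<longrightarrow> \<rho> = \<pi>)"
proof -
  note f = step_matchingD[OF fm]
  have "\<exists>\<pi>\<in>pair_partitions k. \<forall>q\<in>{1..2 * k}. partner \<pi> q = Suc (f (q - 1))"
  proof (rule pair_partition_of_involution)
    fix q assume "q \<in> {1..2 * k}"
    then obtain r where r: "q = Suc r" "r < 2 * k" by (cases q) auto
    show "Suc (f (q - 1)) \<in> {1..2 * k} \<and> Suc (f (q - 1)) \<noteq> q \<and> Suc (f (Suc (f (q - 1)) - 1)) = q"
      using f(1-3)[OF r(2)] unfolding r(1) by simp
  qed
  then obtain \<pi> where \<pi>: "\<pi> \<in> pair_partitions k" "\<And>q. q \<in> {1..2 * k} \<Longrightarrow> partner \<pi> q = Suc (f (q - 1))" by blast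
  have pf: "partner \<pi> (Suc q) = Suc (f q)" if "q < 2 * k" for q using \<pi>(2)[of "Suc q"] that by simp
  show ?thesis
  proof (intro bexI[OF _ \<pi>(1)] conjI allI impI ballI)
    show "partner \<pi> (Suc q) = Suc (f q)" if "q < 2 * k" for q by (rule pf[OF that])
    show "I \<in> walks_of_partition k \<pi> N w"
      unfolding walks_of_partition_iff[OF \<pi>(1)] using I f(4) pf by simp
    fix \<rho> assume \<rho>: "\<rho> \<in> pair_partitions k" "I \<in> walks_of_partition k \<rho> N w"
    show "\<rho> = \<pi>"
    proof (rule pair_partition_eqI[OF \<rho>(1) \<pi>(1)])
      fix q assume q: "q \<in> {1..2 * k}"
      define r where "r = q - 1"
      have r: "r < 2 * k" "q = Suc r" using q by (auto simp: r_def)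
      let ?p = "partner \<rho> (Suc r)"
      have p: "?p \<in> {1..2 * k}" "?p \<noteq> Suc r"
        using partner_in[OF \<rho>(1) q] block_of_pair(2)[OF \<rho>(1) q] r by auto
      have "closed_step (2 * k) I (?p - 1) = - closed_step (2 * k) I r"
        using \<rho>(2) r unfolding walks_of_partition_iff[OF \<rho>(1)] by blast
      hence "?p - 1 = r \<or> ?p - 1 = f r" using p by (intro f(6)[OF r(1)]) auto
      hence "?p = Suc (f r)" using p by auto
      thus "partner \<rho> q = partner \<pi> q" using pf[OF r(1)] r by simp
    qed
  qed
qed

text \<open>The representative of an entry under \<open>A (- s) = (A s)\<^sup>T\<close>: nonnegative
  s, and the upper triangle for \<open>s = 0\<close>.\<close>

definition canonical_entry :: "int \<Rightarrow> nat \<Rightarrow> nat \<Rightarrow> int \<times> nat \<times> nat" where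
  "canonical_entry s i j = (if s < 0 then (- s, j, i) else if s = 0 then (0, min i j, max i j) else (s, i, j))"

lemma fst_canonical_entry: "fst (canonical_entry s i j) = \<bar>s\<bar>"
  by (simp add: canonical_entry_def)

text \<open>For opposite nonzero steps two factors are the same variable exactly if the inner
  indices are crossed. This is where the two equations of a block of the partition come
  from.\<close>

lemma canonical_entry_opposite:
  assumes "s \<noteq> 0"
  shows "canonical_entry (- s) i' j' = canonical_entry s i j \<longleftrightarrow> i' = j \<and> j' = i"
  using assms by (auto simp: canonical_entry_def)

text \<open>The index set of the independent family within the band. It is empty for a negative
  bandwidth.\<close>

definition band_index :: "nat \<Rightarrow> int \<Rightarrow> (int \<times> nat \<times> nat) set" where
  "band_index m w = {(s, i, j). 0 \<le> s \<and> s \<le> w \<and> i < m \<and> j < m \<and> (s = 0 \<longrightarrow> i \<le> j)}"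

lemma canonical_entry_in: "\<bar>s\<bar> \<le> w \<Longrightarrow> i < m \<Longrightarrow> j < m \<Longrightarrow> canonical_entry s i j \<in> band_index m w"
  by (auto simp: canonical_entry_def band_index_def)

definition entry_code :: "nat \<Rightarrow> (nat \<Rightarrow> nat) \<Rightarrow> (nat \<Rightarrow> nat) \<Rightarrow> nat \<Rightarrow> int \<times> nat \<times> nat" where
  "entry_code n I t q = canonical_entry (closed_step n I q) (t q) (t (Suc q mod n))"

lemma fst_entry_code: "fst (entry_code n I t q) = \<bar>closed_step n I q\<bar>"
  by (simp add: entry_code_def fst_canonical_entry)

lemma entry_code_in:
  assumes "I \<in> band_walks n N w" "t \<in> walks n m" "q < n"
  shows "entry_code n I t q \<in> band_index m w"
proof -
  have "Suc q mod n < n" using assms by auto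
  hence "t q < m" "t (Suc q mod n) < m" using PiE_mem[OF assms(2), of q] PiE_mem[OF assms(2), of "Suc q mod n"] assms(3) by auto
  thus ?thesis using assms unfolding entry_code_def band_walks_def by (intro canonical_entry_in) auto
qed

locale band_entries = independent_entries M X "band_index m w" \<kappa>
  for M :: "'w measure" and X :: "int \<times> nat \<times> nat \<Rightarrow> 'w \<Rightarrow> real" and m :: nat and w :: int and \<kappa> :: "nat \<Rightarrow> real"
begin

text \<open>If some absolute step occurs once, both sides are 0. Otherwise the steps determine one
  partition, and the variables coincide along it if and only if \<open>t\<close> solves its linear
  system. If it does, each variable occurs exactly twice and contributes its variance 1; if it does
  not, some variable occurs only once.\<close>

lemma mixed_entry_code:
  assumes k: "k > 0"
    and I: "I \<in> band_walks (2 * k) N w" and t: "t \<in> walks (2 * k) m"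
    and nd: "\<not> (repeated_steps (2 * k) I \<and> degenerate_walk (2 * k) I)"
  shows "mixed {..<2 * k} (entry_code (2 * k) I t)
    = (\<Sum>\<pi>\<in>pair_partitions k. if I \<in> walks_of_partition k \<pi> N w \<and> t \<in> invariant_colourings m k \<pi> then 1 else 0)"
    (is "mixed ?Q ?c = ?S")
proof -
  let ?n = "2 * k" and ?s = "closed_step (2 * k) I"
  have cV: "?c ` ?Q \<subseteq> band_index m w" using entry_code_in[OF I t] by auto
  show ?thesis
  proof (cases "repeated {..<?n} (\<lambda>q. \<bar>?s q\<bar>)")
    case False
    then obtain x where x: "x < ?n" "\<And>y. y < ?n \<Longrightarrow> y \<noteq> x \<Longrightarrow> \<bar>?s y\<bar> \<noteq> \<bar>?s x\<bar>"
      unfolding repeated_def by blast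
    have "mixed ?Q ?c = 0"
    proof (rule mixed_unique_zero[OF _ cV, where x = x])
      fix y assume "y \<in> ?Q" "?c y = ?c x"
      hence "\<bar>?s y\<bar> = \<bar>?s x\<bar>" using fst_entry_code[of ?n I t y] fst_entry_code[of ?n I t x] by simp
      thus "y = x" using x(2)[of y] \<open>y \<in> ?Q\<close> by auto
    qed (use x in auto)
    moreover have "I \<notin> walks_of_partition k \<pi> N w" if \<pi>: "\<pi> \<in> pair_partitions k" for \<pi>
    proof
      assume "I \<in> walks_of_partition k \<pi> N w"
      hence e: "?s (partner \<pi> (Suc x) - 1) = - ?s x" using x(1) unfolding walks_of_partition_iff[OF \<pi>] by blast
      have m: "Suc x \<in> {1..?n}" using x by simp
      have "partner \<pi> (Suc x) - 1 < ?n" "partner \<pi> (Suc x) - 1 \<noteq> x"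
        using partner_in[OF \<pi> m] block_of_pair(2)[OF \<pi> m] by auto
      from x(2)[OF this] e show False by simp
    qed
    ultimately show ?thesis by (simp add: sum.neutral)
  next
    case True
    hence nd': "\<not> degenerate_walk ?n I" using nd by blast
    obtain f where fm: "step_matching ?n I f" using nondegenerate_matching[OF True nd'] by blast
    note f = step_matchingD[OF fm]
    obtain \<pi> where \<pi>: "\<pi> \<in> pair_partitions k" and pf': "\<forall>q<?n. partner \<pi> (Suc q) = Suc (f q)"
      and I\<pi>: "I \<in> walks_of_partition k \<pi> N w"
      and uniq: "\<forall>\<rho>\<in>pair_partitions k. I \<in> walks_of_partition k \<rho> N w \<longrightarrow> \<rho> = \<pi>"
      using nondegenerate_unique_partition[OF fm I] by (elim bexE conjE) (rule that; assumption)
    note pf = pf'[rule_format]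
    have "?S = (\<Sum>\<rho>\<in>pair_partitions k. if \<rho> = \<pi> then (if t \<in> invariant_colourings m k \<pi> then 1 else 0) else 0)"
    proof (rule sum.cong[OF refl])
      fix \<rho> assume "\<rho> \<in> pair_partitions k"
      hence "I \<in> walks_of_partition k \<rho> N w \<longleftrightarrow> \<rho> = \<pi>" using uniq I\<pi> by blast
      thus "(if I \<in> walks_of_partition k \<rho> N w \<and> t \<in> invariant_colourings m k \<rho> then 1 else 0)
        = (if \<rho> = \<pi> then (if t \<in> invariant_colourings m k \<pi> then 1 else 0) else 0 :: real)" by auto
    qed
    also have "\<dots> = (if t \<in> invariant_colourings m k \<pi> then 1 else 0)"
      using \<pi> by (simp add: finite_pair_partitions)
    finally have S: "?S = (if t \<in> invariant_colourings m k \<pi> then 1 else 0)" .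
    have inv: "t \<in> invariant_colourings m k \<pi> \<longleftrightarrow> (\<forall>q<?n. t q = t (Suc (f q) mod ?n))"
      unfolding invariant_colourings_def using t by (simp add: pf)
    have ceq: "?c (f q) = ?c q \<longleftrightarrow> t (f q) = t (Suc q mod ?n) \<and> t (Suc (f q) mod ?n) = t q" if "q < ?n" for q
      unfolding entry_code_def f(4)[OF that] by (rule canonical_entry_opposite[OF f(5)[OF that]])
    have near: "r = q \<or> r = f q" if "q < ?n" "r < ?n" "?c r = ?c q" for q r
    proof (rule f(6)[OF that(1,2)])
      have "fst (?c r) = fst (?c q)" using that(3) by (rule arg_cong)
      thus "\<bar>?s r\<bar> = \<bar>?s q\<bar>" unfolding fst_entry_code .
    qed
    show ?thesis
    proof (cases "\<forall>q<?n. t q = t (Suc (f q) mod ?n)")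
      case inv_t: True
      have same: "?c (f q) = ?c q" if "q < ?n" for q
        unfolding ceq[OF that] using inv_t[rule_format, OF that] inv_t[rule_format, OF f(1)[OF that]] f(3)[OF that] by simp
      have "mixed ?Q ?c = 1"
      proof (rule mixed_pairs_one[OF _ cV])
        fix v assume "v \<in> ?c ` ?Q"
        then obtain q where q: "q < ?n" "v = ?c q" by (elim imageE) simp
        have "{r \<in> ?Q. ?c r = v} = {q, f q}"
        proof (intro subset_antisym subsetI)
          fix r assume "r \<in> {r \<in> ?Q. ?c r = v}"
          hence "r < ?n" "?c r = ?c q" using q(2) by simp_all
          thus "r \<in> {q, f q}" using near[OF q(1)] by blast
        next
          fix r assume "r \<in> {q, f q}"
          thus "r \<in> {r \<in> ?Q. ?c r = v}" using q same[OF q(1)] f(1)[OF q(1)] by (elim insertE emptyE) simp_all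
        qed
        thus "card {r \<in> ?Q. ?c r = v} = 2" using f(2)[OF q(1)] by simp
      qed simp
      moreover have "t \<in> invariant_colourings m k \<pi>" by (rule iffD2[OF inv inv_t])
      ultimately show ?thesis unfolding S by simp
    next
      case False
      then obtain q where q: "q < ?n" "t q \<noteq> t (Suc (f q) mod ?n)" by blast
      have "?c (f q) \<noteq> ?c q" unfolding ceq[OF q(1)] using q(2) by argo
      have "mixed ?Q ?c = 0"
      proof (rule mixed_unique_zero[OF _ cV, where x = q])
        fix y assume y: "y \<in> ?Q" "?c y = ?c q"
        hence "y = q \<or> y = f q" by (intro near[OF q(1)]) simp_all
        thus "y = q" using y(2) \<open>?c (f q) \<noteq> ?c q\<close> by blast
      qed (use q(1) in simp_all)
      moreover have "t \<notin> invariant_colourings m k \<pi>" unfolding inv by (rule False)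
      ultimately show ?thesis unfolding S by simp
    qed
  qed
qed

lemma mixed_entry_code_odd:
  assumes n: "odd n"
    and I: "I \<in> band_walks n N w" and t: "t \<in> walks n m"
    and nd: "\<not> (repeated_steps n I \<and> degenerate_walk n I)"
  shows "mixed {..<n} (entry_code n I t) = 0"
proof -
  let ?s = "closed_step n I"
  have cV: "entry_code n I t ` {..<n} \<subseteq> band_index m w" using entry_code_in[OF I t] by auto
  have "\<not> repeated {..<n} (\<lambda>q. \<bar>?s q\<bar>)" using nd n nondegenerate_even by blast
  then obtain x where x: "x < n" "\<And>y. y < n \<Longrightarrow> y \<noteq> x \<Longrightarrow> \<bar>?s y\<bar> \<noteq> \<bar>?s x\<bar>"
    unfolding repeated_def by blast
  show ?thesis
  proof (rule mixed_unique_zero[OF _ cV, where x = x])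
    fix y assume "y \<in> {..<n}" "entry_code n I t y = entry_code n I t x"
    hence "\<bar>?s y\<bar> = \<bar>?s x\<bar>" using fst_entry_code[of n I t y] fst_entry_code[of n I t x] by simp
    thus "y = x" using x(2)[of y] \<open>y \<in> {..<n}\<close> by auto
  qed (use x in auto)
qed

end

section \<open>Mean and fourth central moment of a trace\<close>

context band_entries begin

definition trace_sum :: "nat \<Rightarrow> nat \<Rightarrow> 'w \<Rightarrow> real" where
  "trace_sum n N \<omega> = (\<Sum>It\<in>band_walks n N w \<times> walks n m. \<Prod>q<n. X (entry_code n (fst It) (snd It) q) \<omega>)"

lemma entry_code_image:
  assumes "It \<in> band_walks n N w \<times> walks n m"
  shows "entry_code n (fst It) (snd It) ` {..<n} \<subseteq> band_index m w"
  using entry_code_in[of "fst It" n N w "snd It" m] assms by auto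

lemma expectation_trace_sum: "expectation (trace_sum n N) =
     (\<Sum>It\<in>band_walks n N w \<times> walks n m. mixed {..<n} (entry_code n (fst It) (snd It)))"
proof -
  have i: "integrable M (\<lambda>\<omega>. \<Prod>q<n. X (entry_code n (fst It) (snd It) q) \<omega>)"
    if "It \<in> band_walks n N w \<times> walks n m" for It
    by (rule mixed_integrable[OF _ entry_code_image[OF that]]) simp
  show "expectation (trace_sum n N) =
     (\<Sum>It\<in>band_walks n N w \<times> walks n m. mixed {..<n} (entry_code n (fst It) (snd It)))"
    unfolding trace_sum_def[abs_def] mixed_def by (rule Bochner_Integration.integral_sum[OF i])
qed

lemma card_walks: "card (walks n m) = m ^ n"
  by (simp add: card_PiE)

text \<open>A sum over all pairs of walks in which only the degenerate ones contribute is of lower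
  order.\<close>

lemma abs_sum_degenerate_le:
  fixes F :: "(nat \<Rightarrow> nat) \<times> (nat \<Rightarrow> nat) \<Rightarrow> real"
  assumes n: "n > 0" and N: "N > 0"
    and zero: "\<And>I t. I \<in> band_walks n N w \<Longrightarrow> t \<in> walks n m \<Longrightarrow>
       \<not> (repeated_steps n I \<and> degenerate_walk n I) \<Longrightarrow> F (I, t) = 0"
    and bd: "\<And>I t. I \<in> band_walks n N w \<Longrightarrow> t \<in> walks n m \<Longrightarrow> \<bar>F (I, t)\<bar> \<le> K"
  shows "\<bar>\<Sum>It\<in>band_walks n N w \<times> walks n m. F It\<bar>
    \<le> \<bar>K\<bar> * real (m ^ n * step_value_constant 1 n ((n + 1) div 2 - 1)) * real N ^ ((n + 1) div 2)"
proof -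
  let ?B = "{I \<in> walks n N. repeated_steps n I \<and> degenerate_walk n I}"
  have fB: "finite ?B" using finite_walks by simp
  have "(\<Sum>It\<in>band_walks n N w \<times> walks n m. F It) = (\<Sum>It\<in>(?B \<inter> band_walks n N w) \<times> walks n m. F It)"
  proof (rule sum.mono_neutral_right)
    show "finite (band_walks n N w \<times> walks n m)" using finite_band_walks finite_walks by simp
    show "\<forall>It\<in>band_walks n N w \<times> walks n m - (?B \<inter> band_walks n N w) \<times> walks n m. F It = 0"
    proof
      fix It assume It: "It \<in> band_walks n N w \<times> walks n m - (?B \<inter> band_walks n N w) \<times> walks n m"
      obtain I t where e: "It = (I, t)" by (cases It)
      have I: "I \<in> band_walks n N w" "t \<in> walks n m"
        using DiffD1[OF It] unfolding e by (rule SigmaD1, rule SigmaD2)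
      have "I \<notin> ?B"
      proof
        assume "I \<in> ?B"
        hence "It \<in> (?B \<inter> band_walks n N w) \<times> walks n m" unfolding e using I by (intro SigmaI IntI)
        thus False by (rule DiffD2[OF It])
      qed
      moreover have "I \<in> walks n N" using I(1) unfolding band_walks_def mem_Collect_eq by (rule conjunct1)
      ultimately have "\<not> (repeated_steps n I \<and> degenerate_walk n I)" by blast
      thus "F It = 0" unfolding e by (rule zero[OF I])
    qed
  qed auto
  hence "\<bar>\<Sum>It\<in>band_walks n N w \<times> walks n m. F It\<bar> = \<bar>\<Sum>It\<in>(?B \<inter> band_walks n N w) \<times> walks n m. F It\<bar>" by (rule arg_cong)
  also have "\<dots> \<le> (\<Sum>It\<in>(?B \<inter> band_walks n N w) \<times> walks n m. \<bar>K\<bar>)"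
  proof (rule order_trans[OF sum_abs], rule sum_mono)
    fix It assume It: "It \<in> (?B \<inter> band_walks n N w) \<times> walks n m"
    have "fst It \<in> band_walks n N w" "snd It \<in> walks n m" using It by (elim SigmaE, clarsimp)+
    hence "\<bar>F (fst It, snd It)\<bar> \<le> K" by (rule bd)
    thus "\<bar>F It\<bar> \<le> \<bar>K\<bar>" by simp
  qed
  also have "\<dots> = real (card (?B \<inter> band_walks n N w) * m ^ n) * \<bar>K\<bar>"
    by (simp add: card_cartesian_product card_walks)
  also have "\<dots> \<le> real (card ?B * m ^ n) * \<bar>K\<bar>"
    by (intro mult_right_mono of_nat_mono mult_right_mono card_mono fB) auto
  also have "\<dots> \<le> real (step_value_constant 1 n ((n + 1) div 2 - 1) * N ^ ((n + 1) div 2) * m ^ n) * \<bar>K\<bar>"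
    by (intro mult_right_mono of_nat_mono card_degenerate_walks[OF n N]) auto
  finally show ?thesis by (simp add: mult_ac)
qed

lemma abs_mixed_entry_code_le:
  assumes "I \<in> band_walks n N w" "t \<in> walks n m"
  shows "\<bar>mixed {..<n} (entry_code n I t)\<bar> \<le> mixed_constant n"
proof -
  have "entry_code n I t ` {..<n} \<subseteq> band_index m w"
    using entry_code_image[of "(I, t)" n N, OF SigmaI[OF assms]] unfolding fst_conv snd_conv .
  from abs_mixed_le[OF finite_lessThan this] show ?thesis
    unfolding mixed_constant_def card_lessThan .
qed

lemma expectation_trace_sum_odd:
  assumes n: "odd n" and N: "N > 0"
  shows "\<bar>expectation (trace_sum n N)\<bar>
    \<le> \<bar>mixed_constant n\<bar> * real (m ^ n * step_value_constant 1 n ((n + 1) div 2 - 1)) * real N ^ ((n + 1) div 2)"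
  unfolding expectation_trace_sum
proof (rule abs_sum_degenerate_le[OF odd_pos[OF n] N])
  fix I t assume It: "I \<in> band_walks n N w" "t \<in> walks n m"
  show "\<bar>mixed {..<n} (entry_code n (fst (I, t)) (snd (I, t)))\<bar> \<le> mixed_constant n"
    unfolding fst_conv snd_conv by (rule abs_mixed_entry_code_le[OF It])
  assume "\<not> (repeated_steps n I \<and> degenerate_walk n I)"
  thus "mixed {..<n} (entry_code n (fst (I, t)) (snd (I, t))) = 0"
    unfolding fst_conv snd_conv by (rule mixed_entry_code_odd[OF n It])
qed

text \<open>The mean is compared with the number of pairs of a walk cancelling along a partition and
  a solution of its linear system; the two differ only on degenerate walks.\<close>

lemma expectation_trace_sum_even:
  assumes k: "k > 0" and N: "N > 0"
  shows "\<bar>expectation (trace_sum (2 * k) N) -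
      (\<Sum>\<pi>\<in>pair_partitions k. real (card (walks_of_partition k \<pi> N w)) * real (card (invariant_colourings m k \<pi>)))\<bar>
    \<le> \<bar>mixed_constant (2 * k) + real (card (pair_partitions k))\<bar> * real (m ^ (2 * k) * step_value_constant 1 (2 * k) (k - 1)) * real N ^ k"
proof -
  let ?D = "band_walks (2 * k) N w \<times> walks (2 * k) m"
  let ?g = "\<lambda>It. \<Sum>\<pi>\<in>pair_partitions k. if fst It \<in> walks_of_partition k \<pi> N w \<and> snd It \<in> invariant_colourings m k \<pi> then 1 else 0 :: real"
  have "(\<Sum>\<pi>\<in>pair_partitions k. real (card (walks_of_partition k \<pi> N w)) * real (card (invariant_colourings m k \<pi>)))
      = (\<Sum>\<pi>\<in>pair_partitions k. \<Sum>It\<in>?D. if fst It \<in> walks_of_partition k \<pi> N w \<and> snd It \<in> invariant_colourings m k \<pi> then 1 else 0)"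
  proof (intro sum.cong refl)
    fix \<pi> assume \<pi>: "\<pi> \<in> pair_partitions k"
    have fD: "finite ?D" using finite_band_walks finite_walks by (rule finite_cartesian_product)
    have "(\<Sum>It\<in>?D. if fst It \<in> walks_of_partition k \<pi> N w \<and> snd It \<in> invariant_colourings m k \<pi> then 1 else 0 :: real)
       = (\<Sum>It\<in>?D \<inter> {It. fst It \<in> walks_of_partition k \<pi> N w \<and> snd It \<in> invariant_colourings m k \<pi>}. 1)"
      unfolding sum.inter_restrict[OF fD] mem_Collect_eq ..
    also have "?D \<inter> {It. fst It \<in> walks_of_partition k \<pi> N w \<and> snd It \<in> invariant_colourings m k \<pi>}
       = walks_of_partition k \<pi> N w \<times> invariant_colourings m k \<pi>"
    proof (intro subset_antisym subsetI)
      fix It assume "It \<in> ?D \<inter> {It. fst It \<in> walks_of_partition k \<pi> N w \<and> snd It \<in> invariant_colourings m k \<pi>}"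
      thus "It \<in> walks_of_partition k \<pi> N w \<times> invariant_colourings m k \<pi>" by (simp add: mem_Times_iff)
    next
      fix It assume "It \<in> walks_of_partition k \<pi> N w \<times> invariant_colourings m k \<pi>"
      hence It: "fst It \<in> walks_of_partition k \<pi> N w" "snd It \<in> invariant_colourings m k \<pi>" by (simp_all add: mem_Times_iff)
      have "fst It \<in> band_walks (2 * k) N w" using It(1) unfolding walks_of_partition_iff[OF \<pi>] by (rule conjunct1)
      moreover have "snd It \<in> walks (2 * k) m" using It(2) unfolding invariant_colourings_def mem_Collect_eq by (rule conjunct1)
      ultimately show "It \<in> ?D \<inter> {It. fst It \<in> walks_of_partition k \<pi> N w \<and> snd It \<in> invariant_colourings m k \<pi>}"
        using It unfolding Int_iff mem_Times_iff mem_Collect_eq by blast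
    qed
    finally show "real (card (walks_of_partition k \<pi> N w)) * real (card (invariant_colourings m k \<pi>))
       = (\<Sum>It\<in>?D. if fst It \<in> walks_of_partition k \<pi> N w \<and> snd It \<in> invariant_colourings m k \<pi> then 1 else 0)"
      by (simp add: card_cartesian_product)
  qed
  also have "\<dots> = (\<Sum>It\<in>?D. ?g It)" by (rule sum.swap)
  finally have main: "expectation (trace_sum (2 * k) N) -
      (\<Sum>\<pi>\<in>pair_partitions k. real (card (walks_of_partition k \<pi> N w)) * real (card (invariant_colourings m k \<pi>)))
     = (\<Sum>It\<in>?D. mixed {..<2 * k} (entry_code (2 * k) (fst It) (snd It)) - ?g It)"
    unfolding expectation_trace_sum by (simp add: sum_subtractf)
  have e: "(2 * k + 1) div 2 = k" by simp
  have "\<bar>\<Sum>It\<in>?D. mixed {..<2 * k} (entry_code (2 * k) (fst It) (snd It)) - ?g It\<bar>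
    \<le> \<bar>mixed_constant (2 * k) + real (card (pair_partitions k))\<bar> * real (m ^ (2 * k) * step_value_constant 1 (2 * k) ((2 * k + 1) div 2 - 1))
       * real N ^ ((2 * k + 1) div 2)"
  proof (rule abs_sum_degenerate_le)
    fix I t assume It: "I \<in> band_walks (2 * k) N w" "t \<in> walks (2 * k) m"
    show "mixed {..<2 * k} (entry_code (2 * k) (fst (I, t)) (snd (I, t))) - ?g (I, t) = 0"
      if "\<not> (repeated_steps (2 * k) I \<and> degenerate_walk (2 * k) I)"
      using mixed_entry_code[OF k It that] by simp
    have "\<bar>?g (I, t)\<bar> \<le> (\<Sum>\<pi>\<in>pair_partitions k. 1)"
      by (rule order_trans[OF sum_abs], rule sum_mono) auto
    thus "\<bar>mixed {..<2 * k} (entry_code (2 * k) (fst (I, t)) (snd (I, t))) - ?g (I, t)\<bar>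
       \<le> mixed_constant (2 * k) + real (card (pair_partitions k))"
      using abs_mixed_entry_code_le[OF It] by simp
  qed (use k N in auto)
  thus ?thesis unfolding main e .
qed

text \<open>The inner indices contribute a factor that does not depend on N.\<close>

lemma card_linked_walk_families:
  fixes J :: "nat set"
  assumes n: "n > 0" and N: "N > 0" and J4: "J = {..<4}"
  shows "card {g \<in> PiE J (\<lambda>_. band_walks n N w \<times> walks n m).
      repeated (J \<times> {..<n}) (\<lambda>x. \<bar>family_step n (restrict (\<lambda>j. fst (g j)) J) x\<bar>) \<and>
      linked n J (\<lambda>x. \<bar>family_step n (restrict (\<lambda>j. fst (g j)) J) x\<bar>)}
    \<le> step_value_constant 4 n (2 * n - 2) * N ^ (2 * n + 2) * (m ^ n) ^ 4" (is "card ?G \<le> _")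
proof -
  define P where "P h \<longleftrightarrow> repeated (J \<times> {..<n}) (\<lambda>x. \<bar>family_step n h x\<bar>) \<and> linked n J (\<lambda>x. \<bar>family_step n h x\<bar>)" for h
  define S where "S = {h \<in> PiE J (\<lambda>_. walks n N). P h}"
  define I where "I g = restrict (\<lambda>j. fst (g j)) J" for g :: "nat \<Rightarrow> (nat \<Rightarrow> nat) \<times> (nat \<Rightarrow> nat)"
  define T where "T g = restrict (\<lambda>j. snd (g j)) J" for g :: "nat \<Rightarrow> (nat \<Rightarrow> nat) \<times> (nat \<Rightarrow> nat)"
  have J: "finite J" "card J = 4" unfolding J4 by simp_all
  have G: "?G = {g \<in> PiE J (\<lambda>_. band_walks n N w \<times> walks n m). P (I g)}" unfolding P_def I_def ..
  have finS: "finite S"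
    unfolding S_def by (rule finite_subset[OF Collect_restrict finite_PiE[OF J(1) finite_walks]])
  have fin: "finite (S \<times> PiE J (\<lambda>_. walks n m))"
    by (rule finite_cartesian_product[OF finS finite_PiE[OF J(1) finite_walks]])
  have "inj_on (\<lambda>g. (I g, T g)) {g \<in> PiE J (\<lambda>_. band_walks n N w \<times> walks n m). P (I g)}"
  proof (rule inj_onI)
    fix g g' assume g: "g \<in> {g \<in> PiE J (\<lambda>_. band_walks n N w \<times> walks n m). P (I g)}"
      "g' \<in> {g \<in> PiE J (\<lambda>_. band_walks n N w \<times> walks n m). P (I g)}" and eq: "(I g, T g) = (I g', T g')"
    show "g = g'"
    proof (rule PiE_ext)
      show "g \<in> PiE J (\<lambda>_. band_walks n N w \<times> walks n m)" "g' \<in> PiE J (\<lambda>_. band_walks n N w \<times> walks n m)"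
        using g by blast+
      fix j assume j: "j \<in> J"
      have "I g j = I g' j" "T g j = T g' j" using eq by simp_all
      thus "g j = g' j" using j by (simp add: prod_eq_iff I_def T_def)
    qed
  qed
  moreover have "(\<lambda>g. (I g, T g)) ` {g \<in> PiE J (\<lambda>_. band_walks n N w \<times> walks n m). P (I g)} \<subseteq> S \<times> PiE J (\<lambda>_. walks n m)"
  proof (intro image_subsetI SigmaI)
    fix g assume g: "g \<in> {g \<in> PiE J (\<lambda>_. band_walks n N w \<times> walks n m). P (I g)}"
    have gj: "g j \<in> band_walks n N w \<times> walks n m" if "j \<in> J" for j
      using PiE_mem[OF _ that] g by blast
    have "I g \<in> PiE J (\<lambda>_. walks n N)"
      unfolding I_def restrict_PiE_iff
    proof
      fix j assume "j \<in> J"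
      hence "fst (g j) \<in> band_walks n N w" using gj unfolding mem_Times_iff by blast
      thus "fst (g j) \<in> walks n N" unfolding band_walks_def by blast
    qed
    thus "I g \<in> S" unfolding S_def using g by blast
    show "T g \<in> PiE J (\<lambda>_. walks n m)"
      unfolding T_def restrict_PiE_iff using gj unfolding mem_Times_iff by blast
  qed
  ultimately have "card ?G \<le> card (S \<times> PiE J (\<lambda>_. walks n m))"
    unfolding G using fin by (rule card_inj_on_le)
  also have "\<dots> = card S * (m ^ n) ^ 4"
    by (simp add: card_cartesian_product card_PiE[OF J(1)] card_walks J(2))
  also have "card S \<le> step_value_constant 4 n (2 * n - 2) * N ^ (2 * n + 2)"
    unfolding S_def P_def J4 by (rule card_linked_families[OF n N])
  finally show ?thesis by simp
qed

lemma
  assumes n: "n > 0" and N: "N > 0"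
  shows fourth_central_integrable: "integrable M (\<lambda>\<omega>. (trace_sum n N \<omega> - expectation (trace_sum n N)) ^ 4)"
    and fourth_central_moment_le: "expectation (\<lambda>\<omega>. (trace_sum n N \<omega> - expectation (trace_sum n N)) ^ 4)
    \<le> \<bar>centred_constant 4 n\<bar> * real (step_value_constant 4 n (2 * n - 2) * (m ^ n) ^ 4) * real N ^ (2 * n + 2)"
proof -
  define J where "J = {..<4::nat}"
  have J: "finite J" "card J = 4" unfolding J_def by simp_all
  let ?D = "band_walks n N w \<times> walks n m"
  let ?P = "PiE J (\<lambda>_. ?D)"
  define c where "c g = (\<lambda>(j, q). entry_code n (fst (g j)) (snd (g j)) q)" for g :: "nat \<Rightarrow> (nat \<Rightarrow> nat) \<times> (nat \<Rightarrow> nat)"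
  define Z where "Z g \<omega> = (\<Prod>j\<in>J. (word n (c g) j \<omega> - expectation (word n (c g) j)))" for g \<omega>
  have fD: "finite ?D" using finite_band_walks finite_walks by simp
  have gj: "g j \<in> ?D" if "g \<in> ?P" "j \<in> J" for g j using PiE_mem[OF that] .
  have cV: "c g ` (J \<times> {..<n}) \<subseteq> band_index m w" if g: "g \<in> ?P" for g
  proof (intro image_subsetI)
    fix x assume x: "x \<in> J \<times> {..<n}"
    obtain j q where jq: "x = (j, q)" "j \<in> J" "q < n" using x by (elim SigmaE) simp
    have "entry_code n (fst (g j)) (snd (g j)) q \<in> entry_code n (fst (g j)) (snd (g j)) ` {..<n}"
      using jq(3) by (intro imageI) simp
    thus "c g x \<in> band_index m w"
      using entry_code_image[OF gj[OF g jq(2)]] unfolding c_def jq(1) prod.case by (rule subsetD[rotated])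
  qed
  have wd: "word n (c g) j \<omega> = (\<Prod>q<n. X (entry_code n (fst (g j)) (snd (g j)) q) \<omega>)" for g j \<omega>
    by (simp add: word_def c_def)
  have wi: "expectation (word n (c g) j) = mixed {..<n} (entry_code n (fst (g j)) (snd (g j)))" for g j
    unfolding mixed_def by (intro Bochner_Integration.integral_cong refl) (rule wd)
  have expand: "(trace_sum n N \<omega> - expectation (trace_sum n N)) ^ 4 = (\<Sum>g\<in>?P. Z g \<omega>)" for \<omega>
  proof -
    have "trace_sum n N \<omega> - expectation (trace_sum n N) =
        (\<Sum>It\<in>?D. (\<Prod>q<n. X (entry_code n (fst It) (snd It) q) \<omega>) - mixed {..<n} (entry_code n (fst It) (snd It)))"
      unfolding expectation_trace_sum trace_sum_def by (simp add: sum_subtractf)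
    hence "(trace_sum n N \<omega> - expectation (trace_sum n N)) ^ 4 =
        (\<Prod>j\<in>J. \<Sum>It\<in>?D. (\<Prod>q<n. X (entry_code n (fst It) (snd It) q) \<omega>) - mixed {..<n} (entry_code n (fst It) (snd It)))"
      unfolding prod_constant J(2) by (rule arg_cong)
    also have "\<dots> = (\<Sum>g\<in>?P. \<Prod>j\<in>J. (\<Prod>q<n. X (entry_code n (fst (g j)) (snd (g j)) q) \<omega>) - mixed {..<n} (entry_code n (fst (g j)) (snd (g j))))"
      by (rule prod_sum_PiE[OF J(1) fD])
    finally show ?thesis unfolding Z_def wi wd .
  qed
  have Zi: "integrable M (Z g)" if "g \<in> ?P" for g
    unfolding Z_def[abs_def] by (rule centred_integrable[OF J(1) cV[OF that]])
  show "integrable M (\<lambda>\<omega>. (trace_sum n N \<omega> - expectation (trace_sum n N)) ^ 4)"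
    unfolding expand by (rule Bochner_Integration.integrable_sum[OF Zi])
  let ?s = "\<lambda>g x. \<bar>family_step n (restrict (\<lambda>j. fst (g j)) J) x\<bar>"
  let ?G = "{g \<in> ?P. repeated (J \<times> {..<n}) (?s g) \<and> linked n J (?s g)}"
  have fP: "finite ?P" by (rule finite_PiE[OF J(1) fD])
  have cs: "fst (c g x) = ?s g x" if "x \<in> J \<times> {..<n}" for g x
    using that by (auto simp: c_def fst_entry_code family_step_def)
  have zero: "expectation (Z g) = 0" if g: "g \<in> ?P" "g \<notin> ?G" for g
  proof (cases "repeated (J \<times> {..<n}) (?s g)")
    case False
    then obtain x where x: "x \<in> J \<times> {..<n}" "\<And>y. y \<in> J \<times> {..<n} \<Longrightarrow> y \<noteq> x \<Longrightarrow> ?s g y \<noteq> ?s g x"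
      unfolding repeated_def by blast
    show ?thesis unfolding Z_def[abs_def]
    proof (rule centred_unique_zero[OF J(1) cV[OF g(1)] x(1)])
      fix y assume y: "y \<in> J \<times> {..<n}" "c g y = c g x"
      hence "?s g y = ?s g x" using cs[OF y(1), of g] cs[OF x(1), of g] by simp
      thus "y = x" using x(2)[OF y(1)] by blast
    qed
  next
    case True
    hence "\<not> linked n J (?s g)" using g by blast
    then obtain j where j: "j \<in> J" "\<And>q y. q < n \<Longrightarrow> y \<in> J \<times> {..<n} \<Longrightarrow> fst y \<noteq> j \<Longrightarrow> ?s g y \<noteq> ?s g (j, q)"
      unfolding linked_def by blast
    show ?thesis unfolding Z_def[abs_def]
    proof (rule centred_isolated_zero[OF J(1) cV[OF g(1)] j(1)])
      fix q y assume qy: "q < n" "y \<in> J \<times> {..<n}" "fst y \<noteq> j"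
      have m: "(j, q) \<in> J \<times> {..<n}" using j qy by simp
      show "c g y \<noteq> c g (j, q)"
      proof
        assume "c g y = c g (j, q)"
        hence "?s g y = ?s g (j, q)" using cs[OF qy(2), of g] cs[OF m, of g] by simp
        thus False using j(2)[OF qy] by blast
      qed
    qed
  qed
  have "expectation (\<lambda>\<omega>. (trace_sum n N \<omega> - expectation (trace_sum n N)) ^ 4) = (\<Sum>g\<in>?P. expectation (Z g))"
    unfolding expand by (rule Bochner_Integration.integral_sum[OF Zi])
  also have "\<dots> = (\<Sum>g\<in>?G. expectation (Z g))"
    by (rule sum.mono_neutral_right[OF fP]) (use zero in blast)+
  also have "\<dots> \<le> (\<Sum>g\<in>?G. \<bar>centred_constant 4 n\<bar>)"
  proof (rule sum_mono)
    fix g assume "g \<in> ?G"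
    hence g: "g \<in> ?P" by simp
    have "\<bar>expectation (Z g)\<bar> \<le> centred_constant 4 n"
      using abs_centred_le[OF J(1) cV[OF g]] unfolding Z_def[abs_def] J(2) .
    thus "expectation (Z g) \<le> \<bar>centred_constant 4 n\<bar>" by simp
  qed
  also have "\<dots> = real (card ?G) * \<bar>centred_constant 4 n\<bar>" by simp
  also have "\<dots> \<le> real (step_value_constant 4 n (2 * n - 2) * N ^ (2 * n + 2) * (m ^ n) ^ 4) * \<bar>centred_constant 4 n\<bar>"
    by (intro mult_right_mono of_nat_mono card_linked_walk_families[OF n N J_def]) simp
  finally show "expectation (\<lambda>\<omega>. (trace_sum n N \<omega> - expectation (trace_sum n N)) ^ 4)
    \<le> \<bar>centred_constant 4 n\<bar> * real (step_value_constant 4 n (2 * n - 2) * (m ^ n) ^ 4) * real N ^ (2 * n + 2)"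
    by (simp add: mult_ac)
qed

end

section \<open>Limiting moments\<close>

text \<open>The sum of the fourth central moments is finite, so almost surely the fourth powers of
  the deviations are summable and tend to 0.\<close>

lemma (in prob_space) AE_tendsto_of_fourth_moment:
  fixes Z :: "nat \<Rightarrow> 'a \<Rightarrow> real"
  assumes int: "\<And>N. N > 0 \<Longrightarrow> integrable M (\<lambda>\<omega>. (Z N \<omega> - expectation (Z N)) ^ 4)"
    and bd: "\<And>N. N > 0 \<Longrightarrow> expectation (\<lambda>\<omega>. (Z N \<omega> - expectation (Z N)) ^ 4) \<le> C / real N ^ 2"
    and lim: "(\<lambda>N. expectation (Z N)) \<longlonglongrightarrow> z"
  shows "AE \<omega> in M. (\<lambda>N. Z N \<omega>) \<longlonglongrightarrow> z"
proof -
  \<comment> \<open>The shift by one skips \<open>N = 0\<close>, where no bound is assumed.\<close>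
  define Y where "Y N \<omega> = (Z (Suc N) \<omega> - expectation (Z (Suc N))) ^ 4" for N \<omega>
  have Yi: "integrable M (Y N)" for N unfolding Y_def[abs_def] by (rule int) simp
  have Y0: "Y N \<omega> \<ge> 0" for N \<omega> by (simp add: Y_def)
  have Yb: "(\<integral>\<^sup>+\<omega>. ennreal (Y N \<omega>) \<partial>M) \<le> ennreal (\<bar>C\<bar> * (1 / real (Suc N) ^ 2))" for N
  proof -
    have "(\<integral>\<^sup>+\<omega>. ennreal (Y N \<omega>) \<partial>M) = ennreal (expectation (Y N))"
      by (rule nn_integral_eq_integral[OF Yi]) (simp add: Y0)
    also have "expectation (Y N) \<le> C / real (Suc N) ^ 2" unfolding Y_def[abs_def] by (rule bd) simp
    also have "\<dots> \<le> \<bar>C\<bar> * (1 / real (Suc N) ^ 2)" by (simp add: divide_right_mono)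
    finally show ?thesis by (simp add: ennreal_leI)
  qed
  have sm: "summable (\<lambda>N. \<bar>C\<bar> * (1 / real (Suc N) ^ 2))"
    using inverse_power_summable[of 2, where 'a = real] summable_Suc_iff[of "\<lambda>n. inverse (real n ^ 2)"]
    by (intro summable_mult) (simp add: inverse_eq_divide)
  have "(\<integral>\<^sup>+\<omega>. (\<Sum>N. ennreal (Y N \<omega>)) \<partial>M) = (\<Sum>N. \<integral>\<^sup>+\<omega>. ennreal (Y N \<omega>) \<partial>M)"
    using Yi by (intro nn_integral_suminf) auto
  also have "\<dots> \<le> (\<Sum>N. ennreal (\<bar>C\<bar> * (1 / real (Suc N) ^ 2)))"
    by (intro suminf_le Yb) auto
  also have "\<dots> = ennreal (\<Sum>N. \<bar>C\<bar> * (1 / real (Suc N) ^ 2))"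
    by (rule suminf_ennreal2[OF _ sm]) auto
  also have "\<dots> < \<infinity>" by simp
  finally have fin: "(\<integral>\<^sup>+\<omega>. (\<Sum>N. ennreal (Y N \<omega>)) \<partial>M) \<noteq> \<infinity>" by simp
  have "AE \<omega> in M. (\<Sum>N. ennreal (Y N \<omega>)) \<noteq> \<infinity>"
    by (rule nn_integral_PInf_AE[OF _ fin]) (use Yi in measurable)
  thus ?thesis
  proof eventually_elim
    case (elim \<omega>)
    have "summable (\<lambda>N. Y N \<omega>)"
      by (rule summable_suminf_not_top) (use Y0 elim in auto)
    hence "(\<lambda>N. Y N \<omega>) \<longlonglongrightarrow> 0" by (rule summable_LIMSEQ_zero)
    hence "(\<lambda>N. root 4 (Y N \<omega>)) \<longlonglongrightarrow> root 4 0" by (rule tendsto_real_root)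
    moreover have "root 4 (Y N \<omega>) = \<bar>Z (Suc N) \<omega> - expectation (Z (Suc N))\<bar>" for N
    proof -
      have "Y N \<omega> = \<bar>Z (Suc N) \<omega> - expectation (Z (Suc N))\<bar> ^ 4" by (simp add: Y_def power_even_abs)
      thus ?thesis by (simp only:) (rule real_root_power_cancel, auto)
    qed
    ultimately have "(\<lambda>N. \<bar>Z (Suc N) \<omega> - expectation (Z (Suc N))\<bar>) \<longlonglongrightarrow> 0" by simp
    hence "(\<lambda>N. Z (Suc N) \<omega> - expectation (Z (Suc N))) \<longlonglongrightarrow> 0" by (rule tendsto_rabs_zero_cancel)
    from tendsto_add[OF this LIMSEQ_Suc[OF lim]] have "(\<lambda>N. Z (Suc N) \<omega>) \<longlonglongrightarrow> z" by simp
    thus ?case by (rule LIMSEQ_imp_Suc)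
  qed
qed

lemma (in labelled_pairing) region_indicator_integral_bounds:
  "\<bar>LINT y|coord_measure. region_indicator b y\<bar> \<le> 2 ^ k"
proof -
  interpret product_sigma_finite "\<lambda>_::nat. lborel :: real measure" ..
  let ?B = "PiE {0..k} (\<lambda>l. if l = 0 then {0..1} else {-1..1::real})"
  have B: "?B \<in> sets coord_measure" by (intro sets_PiM_I_finite) auto
  have "{0..k} = insert 0 {1..k}" by auto
  have e: "emeasure coord_measure ?B = ennreal (2 ^ k)"
  proof -
    have "emeasure coord_measure ?B = (\<Prod>l\<in>{0..k}. emeasure lborel (if l = 0 then {0..1} else {-1..1::real}))"
      by (intro emeasure_PiM) auto
    also have "\<dots> = (\<Prod>l\<in>{1..k}. emeasure lborel {-1..1::real})"
      unfolding \<open>{0..k} = insert 0 {1..k}\<close> by simp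
    also have "\<dots> = ennreal (2 ^ k)" using ennreal_power[of 2 k] by simp
    finally show ?thesis .
  qed
  have "\<bar>LINT y|coord_measure. region_indicator b y\<bar> \<le> (LINT y|coord_measure. \<bar>region_indicator b y\<bar>)"
    by (rule integral_abs_bound)
  also have "\<dots> \<le> (LINT y|coord_measure. indicator ?B y)"
  proof (rule integral_mono_AE')
    show "integrable coord_measure (indicator ?B :: _ \<Rightarrow> real)"
      by (rule integrable_real_indicator[OF B]) (simp add: e)
    show "AE y in coord_measure. \<bar>region_indicator b y\<bar> \<le> indicator ?B y"
    proof (rule AE_I2)
      fix y
      have "\<bar>\<Prod>j = 1..2 * k. indicator {0..1} (y 0 + b * (\<Sum>i = 1..j. of_int (e i) * y (lab i))) :: real\<bar> \<le> (\<Prod>j = 1..2 * k. 1)"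
        unfolding abs_prod by (rule prod_mono) (auto simp: indicator_def)
      thus "\<bar>region_indicator b y\<bar> \<le> indicator ?B y"
        unfolding region_indicator_def abs_mult by (auto simp: indicator_def)
    qed
  qed auto
  also have "\<dots> = 2 ^ k" using B by (simp add: measure_def e)
  finally show ?thesis .
qed

text \<open>The domain and the integrand of the limiting integral in terms of the labelled pairing
  of \<open>\<pi>\<close>.\<close>

lemma partition_integral_eq:
  assumes "\<pi> \<in> pair_partitions k"
  shows "partition_integral b k \<pi> = (LINT y|(\<Pi>\<^sub>M l\<in>{0..k}. lborel).
    labelled_pairing.region_indicator k (\<lambda>q. if q = Min (block_of \<pi> q) then 1 else - 1) (label \<pi>) b y)"
  unfolding labelled_pairing.region_indicator_def[OF labelled_pairing_of_partition[OF assms]]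
    partition_integral_def set_lebesgue_integral_def
  by (intro Bochner_Integration.integral_cong refl)
     (simp add: pair_sign_def if_distrib[of real_of_int] cong: if_cong)

lemma abs_partition_integral_le:
  "\<pi> \<in> pair_partitions k \<Longrightarrow> \<bar>partition_integral b k \<pi>\<bar> \<le> 2 ^ k"
  unfolding partition_integral_eq
  by (rule labelled_pairing.region_indicator_integral_bounds[OF labelled_pairing_of_partition])

lemma card_walks_of_partition_tendsto:
  assumes \<pi>: "\<pi> \<in> pair_partitions k" and k: "k > 0" and b: "b > 0"
    and w: "(\<lambda>N. real_of_int (w N) / real N) \<longlonglongrightarrow> b"
  shows "(\<lambda>N. real (card (walks_of_partition k \<pi> N (w N))) / (real N * (b * real N) ^ k)) \<longlonglongrightarrow> partition_integral b k \<pi>"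
  unfolding partition_integral_eq[OF \<pi>]
    labelled_pairing.card_paired_walks[OF labelled_pairing_of_partition[OF \<pi>] k]
  by (rule labelled_pairing.card_lattice_points_tendsto[OF labelled_pairing_of_partition[OF \<pi>] b w])

lemma fact_double_ge: "real k ^ k * fact k \<le> fact (2 * k)"
proof -
  have "real k ^ j * fact k \<le> fact (k + j)" for j
  proof (induction j)
    case (Suc j)
    have "real k ^ Suc j * fact k = real k * (real k ^ j * fact k)" by simp
    also have "\<dots> \<le> real (k + Suc j) * fact (k + j)"
      by (rule mult_mono) (use Suc in auto)
    finally show ?case by simp
  qed simp
  from this[of k] show ?thesis by (simp add: mult_2)
qed

text \<open>Each summand is at most \<open>m ^ k 2 ^ k\<close>, the exponent of m being at most k
  and the domain of integration having volume \<open>2 ^ k\<close>.\<close>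

lemma abs_limit_moment_le:
  assumes m: "m \<ge> 1" and b: "0 < b" "b \<le> 1" and k: "k > 0"
  shows "\<bar>limit_moment m b k\<bar> \<le> (4 * real m * real k) ^ k"
proof -
  have t: "\<bar>real m powi (int k - 1 - int (system_rank k \<pi>)) * partition_integral b k \<pi>\<bar> \<le> real m ^ k * 2 ^ k"
    if \<pi>: "\<pi> \<in> pair_partitions k" for \<pi>
  proof -
    have "real m powi (int k - 1 - int (system_rank k \<pi>)) \<le> real m powi int k"
      using m by (intro power_int_increasing) auto
    thus ?thesis unfolding abs_mult
      using abs_partition_integral_le[OF \<pi>, of b] m by (intro mult_mono) auto
  qed
  have "\<bar>\<Sum>\<pi>\<in>pair_partitions k. real m powi (int k - 1 - int (system_rank k \<pi>)) * partition_integral b k \<pi>\<bar>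
     \<le> (\<Sum>\<pi>\<in>pair_partitions k. real m ^ k * 2 ^ k)"
    by (rule order_trans[OF sum_abs], rule sum_mono) (rule t)
  also have "\<dots> = real (card (pair_partitions k)) * (real m ^ k * 2 ^ k)" by simp
  also have "\<dots> \<le> real ((2 * k) ^ k) * (real m ^ k * 2 ^ k)"
    by (intro mult_right_mono of_nat_mono card_pair_partitions_le) auto
  also have "\<dots> = (2 * real k * (real m * 2)) ^ k"
    by (simp only: power_mult_distrib of_nat_power of_nat_mult of_nat_numeral)
  also have "2 * real k * (real m * 2) = 4 * real m * real k" by simp
  finally have s: "\<bar>\<Sum>\<pi>\<in>pair_partitions k. real m powi (int k - 1 - int (system_rank k \<pi>)) * partition_integral b k \<pi>\<bar>
     \<le> (4 * real m * real k) ^ k" .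
  have "1 / (2 - b) ^ k \<le> 1" using b one_le_power[of "2 - b" k] by simp
  hence "\<bar>limit_moment m b k\<bar> \<le> 1 * (4 * real m * real k) ^ k"
    unfolding limit_moment_def abs_mult using s b by (intro mult_mono) auto
  thus ?thesis by simp
qed

text \<open>All moments of the limit: the odd ones vanish by symmetry, and the moment of order 0 is
  the total mass.\<close>

definition limit_moment_sequence :: "nat \<Rightarrow> real \<Rightarrow> nat \<Rightarrow> real" where
  "limit_moment_sequence m b j = (if odd j then 0 else if j = 0 then 1 else limit_moment m b (j div 2))"

text \<open>From \<open>(2k)! \<ge> k ^ k k!\<close> the terms are at most \<open>(4 m t\<^sup>2) ^
  k / k!\<close>.\<close>

lemma limit_moment_sequence_growth:
  assumes m: "m \<ge> 1" and b: "0 < b" "b \<le> 1"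
  shows "(\<lambda>k. t ^ (2 * k) / fact (2 * k) * limit_moment_sequence m b (2 * k)) \<longlonglongrightarrow> 0"
proof (rule Lim_null_comparison)
  show "(\<lambda>k. (4 * real m * t\<^sup>2) ^ k / fact k) \<longlonglongrightarrow> 0"
    using summable_LIMSEQ_zero[OF summable_exp[of "4 * real m * t\<^sup>2"]] by (simp add: divide_inverse mult.commute)
  show "\<forall>\<^sub>F k in sequentially. norm (t ^ (2 * k) / fact (2 * k) * limit_moment_sequence m b (2 * k))
     \<le> (4 * real m * t\<^sup>2) ^ k / fact k"
    using eventually_gt_at_top[of 0]
  proof eventually_elim
    case (elim k)
    have l: "\<bar>limit_moment_sequence m b (2 * k)\<bar> \<le> (4 * real m * real k) ^ k"
      using abs_limit_moment_le[OF m b elim] elim by (simp add: limit_moment_sequence_def)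
    have f: "0 < real k ^ k * fact k" using elim by simp
    have "norm (t ^ (2 * k) / fact (2 * k) * limit_moment_sequence m b (2 * k))
        = t ^ (2 * k) / fact (2 * k) * \<bar>limit_moment_sequence m b (2 * k)\<bar>"
      by (simp add: abs_mult power_even_abs)
    also have "\<dots> \<le> t ^ (2 * k) / (real k ^ k * fact k) * (4 * real m * real k) ^ k"
      using l f fact_double_ge[of k] by (intro mult_mono divide_left_mono) auto
    also have "\<dots> = (4 * real m * t\<^sup>2) ^ k / fact k"
    proof -
      have p: "real k ^ k \<noteq> 0" using elim by simp
      have "t ^ (2 * k) / (real k ^ k * fact k) * ((4 * real m) ^ k * real k ^ k) = (4 * real m) ^ k * t ^ (2 * k) / fact k"
        using p by simp
      thus ?thesis unfolding power_mult_distrib[of "4 * real m" "real k"] power_mult_distrib[of "4 * real m" "t\<^sup>2"] power_mult .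
    qed
    finally show ?case .
  qed
qed

text \<open>Symmetry gives the odd moments; conversely the reflected measure has the same moments
  and these determine it.\<close>

lemma symmetric_with_even_moments_iff:
  assumes m: "m \<ge> 1" and b: "0 < b" "b \<le> 1"
  shows "symmetric_with_even_moments \<nu> (limit_moment m b) \<longleftrightarrow> has_moments \<nu> (limit_moment_sequence m b)"
proof
  assume s: "symmetric_with_even_moments \<nu> (limit_moment m b)"
  hence rd: "real_distribution \<nu>" and sym: "distr \<nu> borel uminus = \<nu>"
    and even: "\<And>k. k \<ge> 1 \<Longrightarrow> integrable \<nu> (\<lambda>x. x ^ (2 * k)) \<and> (LINT x|\<nu>. x ^ (2 * k)) = limit_moment m b k"
    unfolding symmetric_with_even_moments_def by auto
  interpret real_distribution \<nu> by fact
  have int: "integrable \<nu> (\<lambda>x. x ^ j)" for j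
  proof (cases "j = 0")
    case False
    show ?thesis
    proof (rule Bochner_Integration.integrable_bound[where f = "\<lambda>x. 1 + x ^ (2 * j)"])
      show "integrable \<nu> (\<lambda>x. 1 + x ^ (2 * j))" using even[of j] False by auto
      show "AE x in \<nu>. norm (x ^ j) \<le> norm (1 + x ^ (2 * j))"
      proof (rule AE_I2)
        fix x :: real
        have "2 * \<bar>x ^ j\<bar> \<le> 1 + \<bar>x ^ j\<bar>\<^sup>2" using sum_squares_bound[of 1 "\<bar>x ^ j\<bar>"] by simp
        moreover have "\<bar>x ^ j\<bar>\<^sup>2 = x ^ (2 * j)" by (simp add: power_mult[symmetric] mult.commute)
        ultimately show "norm (x ^ j) \<le> norm (1 + x ^ (2 * j))" by simp
      qed
    qed auto
  qed simp
  have odd: "(LINT x|\<nu>. x ^ j) = 0" if "odd j" for j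
  proof -
    have "(LINT x|\<nu>. x ^ j) = (LINT x|distr \<nu> borel uminus. x ^ j)" unfolding sym ..
    also have "\<dots> = (LINT x|\<nu>. (- x) ^ j)" by (rule integral_distr) auto
    also have "\<dots> = - (LINT x|\<nu>. x ^ j)" using that by simp
    finally show ?thesis by simp
  qed
  have "(LINT x|\<nu>. x ^ j) = limit_moment_sequence m b j" for j
  proof (cases "odd j \<or> j = 0")
    case True thus ?thesis using odd prob_space by (auto simp: limit_moment_sequence_def)
  next
    case False
    then obtain k where "j = 2 * k" "k \<ge> 1" by (auto elim!: evenE)
    thus ?thesis using even[of k] by (simp add: limit_moment_sequence_def)
  qed
  thus "has_moments \<nu> (limit_moment_sequence m b)" unfolding has_moments_def using rd int by blast
next
  assume h: "has_moments \<nu> (limit_moment_sequence m b)"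
  interpret real_distribution \<nu> using h by (simp add: has_moments_def)
  have int: "integrable \<nu> (\<lambda>x. x ^ j)" and mom: "(LINT x|\<nu>. x ^ j) = limit_moment_sequence m b j" for j
    using h by (auto simp: has_moments_def)
  have "has_moments (distr \<nu> borel uminus) (limit_moment_sequence m b)"
    unfolding has_moments_def
  proof (intro conjI allI)
    show "real_distribution (distr \<nu> borel uminus)" by (rule real_distribution_distr) simp
    fix j
    have e: "(\<lambda>x::real. (- x) ^ j) = (\<lambda>x. (-1) ^ j * x ^ j)" by (rule ext) (rule power_minus)
    show "integrable (distr \<nu> borel uminus) (\<lambda>x. x ^ j)"
      by (subst integrable_distr_eq) (auto simp: e int)
    have "(LINT x|distr \<nu> borel uminus. x ^ j) = (LINT x|\<nu>. (- x) ^ j)" by (rule integral_distr) auto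
    also have "\<dots> = (-1) ^ j * limit_moment_sequence m b j" unfolding e using mom by simp
    also have "\<dots> = limit_moment_sequence m b j" by (simp add: limit_moment_sequence_def)
    finally show "(LINT x|distr \<nu> borel uminus. x ^ j) = limit_moment_sequence m b j" .
  qed
  hence sym: "distr \<nu> borel uminus = \<nu>"
    by (rule moments_determine[OF limit_moment_sequence_growth[OF m b] _ h])
  show "symmetric_with_even_moments \<nu> (limit_moment m b)"
    unfolding symmetric_with_even_moments_def
  proof (intro conjI allI impI real_distribution_axioms sym int)
    fix k :: nat assume "1 \<le> k"
    thus "(LINT x|\<nu>. x ^ (2 * k)) = limit_moment m b k"
      unfolding mom by (simp add: limit_moment_sequence_def)
  qed
qed

section \<open>Almost sure convergence for the band matrices\<close>

lemma trace_power_smult: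
  fixes B :: "real mat"
  assumes "B \<in> carrier_mat d d"
  shows "trace_mat ((c \<cdot>\<^sub>m B) ^\<^sub>m n) = c ^ n * trace_mat (B ^\<^sub>m n)"
proof -
  have "(c \<cdot>\<^sub>m B) ^\<^sub>m n = c ^ n \<cdot>\<^sub>m B ^\<^sub>m n"
  proof (induction n)
    case (Suc n)
    have Bn: "B ^\<^sub>m n \<in> carrier_mat d d" using assms by simp
    have "(c \<cdot>\<^sub>m B) ^\<^sub>m Suc n = (c ^ n \<cdot>\<^sub>m B ^\<^sub>m n) * (c \<cdot>\<^sub>m B)" using Suc by simp
    also have "\<dots> = c ^ Suc n \<cdot>\<^sub>m B ^\<^sub>m Suc n"
      using Bn assms by (intro eq_matI) (auto simp: scalar_prod_def sum_distrib_left mult_ac intro!: sum.cong)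
    finally show ?case .
  qed (use assms in \<open>auto intro!: eq_matI\<close>)
  moreover have "B ^\<^sub>m n \<in> carrier_mat d d" using assms by simp
  ultimately show ?thesis using assms by (simp add: trace_mat_def sum_distrib_left)
qed

context block_toeplitz_band_model begin

definition entry_variable :: "nat \<Rightarrow> nat \<Rightarrow> int \<times> nat \<times> nat \<Rightarrow> 'w \<Rightarrow> real" where
  "entry_variable m N = (\<lambda>(s, i, j) \<omega>. A m N s \<omega> $$ (i, j))"

text \<open>Finite by assumption, and the same for all N. This uniformity makes the error terms
  below comparable for different N.\<close>

definition moment_constant :: "nat \<Rightarrow> nat \<Rightarrow> real" where
  "moment_constant m k = enn2real (moment_sup M bw A k m)"

lemma entry_moments:
  assumes m: "1 \<le> m" and N: "1 \<le> N" and v: "\<bar>s\<bar> \<le> bw N" "i < m" "j < m"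
  shows "integrable M (\<lambda>\<omega>. A m N s \<omega> $$ (i, j) ^ k)"
    and "expectation (\<lambda>\<omega>. \<bar>A m N s \<omega> $$ (i, j)\<bar> ^ k) \<le> moment_constant m k"
proof -
  let ?x = "\<lambda>\<omega>. A m N s \<omega> $$ (i, j)"
  have meas[measurable]: "?x \<in> borel_measurable M" by (rule entry_measurable[OF m N v])
  have le: "(\<integral>\<^sup>+\<omega>. ennreal (\<bar>?x \<omega>\<bar> ^ k) \<partial>M) \<le> moment_sup M bw A k m"
    unfolding moment_sup_def by (rule SUP_upper2[of "(N, s, i, j)"]) (use N v in auto)
  have fin: "moment_sup M bw A k m < \<infinity>" by (rule moments_finite[OF m])
  have int: "integrable M (\<lambda>\<omega>. \<bar>?x \<omega>\<bar> ^ k)"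
  proof (rule integrableI_bounded)
    have "(\<integral>\<^sup>+\<omega>. ennreal (norm (\<bar>?x \<omega>\<bar> ^ k)) \<partial>M) = (\<integral>\<^sup>+\<omega>. ennreal (\<bar>?x \<omega>\<bar> ^ k) \<partial>M)" by simp
    thus "(\<integral>\<^sup>+\<omega>. ennreal (norm (\<bar>?x \<omega>\<bar> ^ k)) \<partial>M) < \<infinity>" using le fin by (metis order.strict_trans1)
  qed measurable
  show "integrable M (\<lambda>\<omega>. ?x \<omega> ^ k)"
    by (rule Bochner_Integration.integrable_bound[OF int]) (auto simp: power_abs)
  have "expectation (\<lambda>\<omega>. \<bar>?x \<omega>\<bar> ^ k) = enn2real (\<integral>\<^sup>+\<omega>. ennreal (\<bar>?x \<omega>\<bar> ^ k) \<partial>M)"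
    by (rule integral_eq_nn_integral) auto
  also have "\<dots> \<le> moment_constant m k"
    unfolding moment_constant_def using le fin by (intro enn2real_mono) auto
  finally show "expectation (\<lambda>\<omega>. \<bar>?x \<omega>\<bar> ^ k) \<le> moment_constant m k" .
qed

text \<open>Restricting the independent family to the band is what makes the variances equal to
  1.\<close>

lemma band_entries_model:
  assumes m: "1 \<le> m" and N: "1 \<le> N"
  shows "band_entries M (entry_variable m N) m (bw N) (moment_constant m)"
proof
  have range: "\<bar>s\<bar> \<le> bw N \<and> i < m \<and> j < m" if "(s, i, j) \<in> band_index m (bw N)" for s i j
    using that by (auto simp: band_index_def)
  show "indep_vars (\<lambda>_. borel) (entry_variable m N) (band_index m (bw N))"
    unfolding entry_variable_def
    by (rule indep_vars_subset[OF entry_indep[OF m N]]) (auto simp: band_index_def)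
  fix v k assume "v \<in> band_index m (bw N)"
  then obtain s i j where v: "v = (s, i, j)" "\<bar>s\<bar> \<le> bw N" "i < m" "j < m"
    using range by (cases v) auto
  show "integrable M (\<lambda>\<omega>. entry_variable m N v \<omega> ^ k)"
    "expectation (\<lambda>\<omega>. \<bar>entry_variable m N v \<omega>\<bar> ^ k) \<le> moment_constant m k"
    using entry_moments[OF m N v(2-4)] by (simp_all add: v(1) entry_variable_def)
  show "expectation (entry_variable m N v) = 0"
    using entry_mean[OF m N v(2-4)] by (simp add: v(1) entry_variable_def)
  show "expectation (\<lambda>\<omega>. entry_variable m N v \<omega> ^ 2) = 1"
    using entry_variance[OF m N v(2-4)] by (simp add: v(1) entry_variable_def)
qed

lemma entry_canonical:
  assumes m: "1 \<le> m" and N: "1 \<le> N" and \<omega>: "\<omega> \<in> space M" and ij: "i < m" "j < m"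
  shows "A m N s \<omega> $$ (i, j) = entry_variable m N (canonical_entry s i j) \<omega>"
proof -
  have sym: "A m N (- r) \<omega> $$ (a, b) = A m N r \<omega> $$ (b, a)" if "a < m" "b < m" for r a b
    using block_transpose[OF m N \<omega>, of r] block_carrier[OF m N \<omega>, of r] that by simp
  show ?thesis
    using sym[OF ij, of "- s"] sym[OF ij, of 0]
    by (auto simp: canonical_entry_def entry_variable_def min_def max_def)
qed

lemma trace_power_eq_trace_sum:
  assumes m: "1 \<le> m" and N: "1 \<le> N" and \<omega>: "\<omega> \<in> space M" and n: "n > 0"
  shows "trace_mat (block_toeplitz m N (\<lambda>s. A m N s \<omega>) ^\<^sub>m n)
    = band_entries.trace_sum (entry_variable m N) m (bw N) n N \<omega>"
proof -
  interpret band_entries M "entry_variable m N" m "bw N" "moment_constant m" by (rule band_entries_model[OF m N])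
  have "trace_mat (block_toeplitz m N (\<lambda>s. A m N s \<omega>) ^\<^sub>m n) =
    (\<Sum>It\<in>walks n N \<times> walks n m. \<Prod>q<n. A m N (closed_step n (fst It) q) \<omega> $$ (snd It q, snd It (Suc q mod n)))"
    using trace_block_toeplitz_power[OF n, of m N "\<lambda>s. A m N s \<omega>"] m by (simp add: case_prod_beta)
  also have "\<dots> = (\<Sum>It\<in>band_walks n N (bw N) \<times> walks n m. \<Prod>q<n. A m N (closed_step n (fst It) q) \<omega> $$ (snd It q, snd It (Suc q mod n)))"
  proof (rule sum.mono_neutral_right)
    show "finite (walks n N \<times> walks n m)" by (intro finite_cartesian_product finite_walks)
    show "band_walks n N (bw N) \<times> walks n m \<subseteq> walks n N \<times> walks n m"
      unfolding band_walks_def by blast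
    show "\<forall>It\<in>walks n N \<times> walks n m - band_walks n N (bw N) \<times> walks n m.
       (\<Prod>q<n. A m N (closed_step n (fst It) q) \<omega> $$ (snd It q, snd It (Suc q mod n))) = 0"
    proof
      fix It assume It: "It \<in> walks n N \<times> walks n m - band_walks n N (bw N) \<times> walks n m"
      have It1: "fst It \<in> walks n N" "snd It \<in> walks n m" using DiffD1[OF It] by (simp_all only: mem_Times_iff)
      have "fst It \<notin> band_walks n N (bw N)"
      proof
        assume "fst It \<in> band_walks n N (bw N)"
        hence "It \<in> band_walks n N (bw N) \<times> walks n m" using It1(2) by (simp only: mem_Times_iff)
        thus False by (rule DiffD2[OF It])
      qed
      then obtain q where q: "q < n" "bw N < \<bar>closed_step n (fst It) q\<bar>"
        using It1(1) unfolding band_walks_def by auto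
      have "Suc q mod n < n" using n by simp
      hence "snd It q < m" "snd It (Suc q mod n) < m"
        using PiE_mem[OF It1(2), of q] PiE_mem[OF It1(2), of "Suc q mod n"] q(1) by simp_all
      hence "A m N (closed_step n (fst It) q) \<omega> $$ (snd It q, snd It (Suc q mod n)) = 0"
        unfolding block_outside[OF m N q(2) \<omega>] by simp
      thus "(\<Prod>q<n. A m N (closed_step n (fst It) q) \<omega> $$ (snd It q, snd It (Suc q mod n))) = 0"
        using q(1) by (intro prod_zero) auto
    qed
  qed
  also have "\<dots> = trace_sum n N \<omega>"
    unfolding trace_sum_def
  proof (intro sum.cong prod.cong refl)
    fix It q assume It: "It \<in> band_walks n N (bw N) \<times> walks n m" and q: "q \<in> {..<n}"
    have t: "snd It \<in> walks n m" using It by (simp only: mem_Times_iff)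
    have "Suc q mod n < n" using n by simp
    hence "snd It q < m" "snd It (Suc q mod n) < m"
      using PiE_mem[OF t, of q] PiE_mem[OF t, of "Suc q mod n"] q by simp_all
    thus "A m N (closed_step n (fst It) q) \<omega> $$ (snd It q, snd It (Suc q mod n)) =
       entry_variable m N (entry_code n (fst It) (snd It) q) \<omega>"
      unfolding entry_code_def by (rule entry_canonical[OF m N \<omega>])
  qed
  finally show ?thesis .
qed

lemma block_toeplitz_symmetric:
  assumes m: "1 \<le> m" and N: "1 \<le> N" and \<omega>: "\<omega> \<in> space M" and pq: "p < m * N" "q < m * N"
  shows "block_toeplitz m N (\<lambda>s. A m N s \<omega>) $$ (p, q) = block_toeplitz m N (\<lambda>s. A m N s \<omega>) $$ (q, p)"
proof -
  let ?s = "int (p div m) - int (q div m)"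
  have "A m N (- ?s) \<omega> $$ (q mod m, p mod m) = A m N ?s \<omega> $$ (p mod m, q mod m)"
    using block_transpose[OF m N \<omega>, of ?s] block_carrier[OF m N \<omega>, of ?s] m by simp
  thus ?thesis using pq by (simp add: block_toeplitz_def)
qed

end

lemma zeroth_moment: "(LINT x|eigenvalue_distribution B. x ^ 0) = 1"
proof -
  interpret real_distribution "eigenvalue_distribution B" by (rule real_distribution_eigenvalue_distribution)
  show ?thesis using prob_space by simp
qed

context block_toeplitz_band_model begin

abbreviation trace_rv :: "nat \<Rightarrow> nat \<Rightarrow> nat \<Rightarrow> 'w \<Rightarrow> real" where
  "trace_rv m n N \<equiv> band_entries.trace_sum (entry_variable m N) m (bw N) n N"

definition scaled_model :: "nat \<Rightarrow> real \<Rightarrow> nat \<Rightarrow> 'w \<Rightarrow> real mat" where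
  "scaled_model m b N \<omega> = (1 / sqrt (real m * (2 - b) * b * real N)) \<cdot>\<^sub>m block_toeplitz m N (\<lambda>s. A m N s \<omega>)"

text \<open>The factor between the trace of the n-th power of the unscaled matrix and the n-th
  moment of the scaled one.\<close>

definition moment_scale :: "nat \<Rightarrow> real \<Rightarrow> nat \<Rightarrow> nat \<Rightarrow> real" where
  "moment_scale m b n N = (1 / sqrt (real m * (2 - b) * b * real N)) ^ n / (real m * real N)"

lemma moment_scaled_model:
  assumes m: "1 \<le> m" and N: "1 \<le> N" and \<omega>: "\<omega> \<in> space M"
  shows "integrable (eigenvalue_distribution (scaled_model m b N \<omega>)) (\<lambda>x. x ^ n)"
    and "n > 0 \<Longrightarrow> (LINT x|eigenvalue_distribution (scaled_model m b N \<omega>). x ^ n) = moment_scale m b n N * trace_rv m n N \<omega>"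
proof -
  let ?T = "block_toeplitz m N (\<lambda>s. A m N s \<omega>)" and ?c = "1 / sqrt (real m * (2 - b) * b * real N)"
  have T: "?T \<in> carrier_mat (m * N) (m * N)" by (rule block_toeplitz_carrier)
  have X: "scaled_model m b N \<omega> \<in> carrier_mat (m * N) (m * N)" unfolding scaled_model_def using T by simp
  have sym: "scaled_model m b N \<omega> $$ (p, q) = scaled_model m b N \<omega> $$ (q, p)" if "p < m * N" "q < m * N" for p q
    unfolding scaled_model_def using T that block_toeplitz_symmetric[OF m N \<omega> that] by simp
  have pos: "m * N > 0" using m N by simp
  show "integrable (eigenvalue_distribution (scaled_model m b N \<omega>)) (\<lambda>x. x ^ n)"
    by (rule moment_eigenvalue_distribution(1)[OF X sym pos])
  assume n: "n > 0"
  have "(LINT x|eigenvalue_distribution (scaled_model m b N \<omega>). x ^ n) = trace_mat (scaled_model m b N \<omega> ^\<^sub>m n) / real (m * N)"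
    by (rule moment_eigenvalue_distribution(2)[OF X sym pos])
  also have "trace_mat (scaled_model m b N \<omega> ^\<^sub>m n) = ?c ^ n * trace_rv m n N \<omega>"
    unfolding scaled_model_def trace_power_smult[OF T] trace_power_eq_trace_sum[OF m N \<omega> n] ..
  finally show "(LINT x|eigenvalue_distribution (scaled_model m b N \<omega>). x ^ n) = moment_scale m b n N * trace_rv m n N \<omega>"
    unfolding moment_scale_def by simp
qed

lemma trace_rv_even_bound:
  assumes m: "1 \<le> m" and k: "k > 0"
  shows "\<exists>C. \<forall>N\<ge>1. \<bar>expectation (trace_rv m (2 * k) N) - (\<Sum>\<pi>\<in>pair_partitions k.
      real (card (walks_of_partition k \<pi> N (bw N))) * real (card (invariant_colourings m k \<pi>)))\<bar> \<le> C * real N ^ k"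
  by (rule exI, intro allI impI, rule band_entries.expectation_trace_sum_even[OF band_entries_model[OF m] k]) auto

lemma trace_rv_odd_bound:
  assumes m: "1 \<le> m" and n: "odd n"
  shows "\<exists>C. \<forall>N\<ge>1. \<bar>expectation (trace_rv m n N)\<bar> \<le> C * real N ^ ((n + 1) div 2)"
  by (rule exI, intro allI impI, rule band_entries.expectation_trace_sum_odd[OF band_entries_model[OF m] n]) auto

lemma trace_rv_fourth_bound:
  assumes m: "1 \<le> m" and n: "n > 0"
  shows "\<exists>C. \<forall>N\<ge>1. expectation (\<lambda>\<omega>. (trace_rv m n N \<omega> - expectation (trace_rv m n N)) ^ 4) \<le> C * real N ^ (2 * n + 2)"
  by (rule exI, intro allI impI, rule band_entries.fourth_central_moment_le[OF band_entries_model[OF m] n]) auto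

text \<open>With \<open>D = m (2 - b) b\<close>, the powers of N cancel in the main term, and m
  appears with exponent \<open>(2k - rank) - (k + 1)\<close>.\<close>

lemma scaled_mean_even_tendsto:
  assumes m: "1 \<le> m" and k: "k > 0" and b: "0 < b" "b \<le> 1"
    and w: "(\<lambda>N. real_of_int (bw N) / real N) \<longlonglongrightarrow> b"
  shows "(\<lambda>N. moment_scale m b (2 * k) N * expectation (trace_rv m (2 * k) N)) \<longlonglongrightarrow> limit_moment m b k"
proof -
  define D where "D = real m * (2 - b) * b"
  have D: "D > 0" using m b by (simp add: D_def)
  define main where "main N = (\<Sum>\<pi>\<in>pair_partitions k.
      real (card (walks_of_partition k \<pi> N (bw N))) * real (card (invariant_colourings m k \<pi>)))" for N
  obtain C where C: "\<And>N. 1 \<le> N \<Longrightarrow> \<bar>expectation (trace_rv m (2 * k) N) - main N\<bar> \<le> C * real N ^ k"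
    using trace_rv_even_bound[OF m k] unfolding main_def by blast
  have scale: "moment_scale m b (2 * k) N = 1 / ((D * real N) ^ k * (real m * real N))" for N
  proof -
    have "(1 / sqrt (D * real N)) ^ (2 * k) = 1 / (D * real N) ^ k"
      using D by (simp add: power_mult power_divide)
    thus ?thesis unfolding moment_scale_def D_def by simp
  qed
  let ?q = "\<lambda>\<pi> N. real (card (walks_of_partition k \<pi> N (bw N))) / (real N * (b * real N) ^ k)"
  let ?c = "\<lambda>\<pi>. real (m ^ (2 * k - system_rank k \<pi>)) / (real m * (real m * (2 - b)) ^ k)"
  have main_eq: "moment_scale m b (2 * k) N * main N = (\<Sum>\<pi>\<in>pair_partitions k. ?c \<pi> * ?q \<pi> N)" for N
  proof -
    have d: "(D * real N) ^ k * (real m * real N) = (real m * (real m * (2 - b)) ^ k) * (real N * (b * real N) ^ k)"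
    proof -
      have "D * real N = (real m * (2 - b)) * (b * real N)" by (simp add: D_def)
      hence "(D * real N) ^ k = (real m * (2 - b)) ^ k * (b * real N) ^ k" by (simp only: power_mult_distrib)
      thus ?thesis by simp
    qed
    show ?thesis unfolding main_def sum_distrib_left scale d
      by (intro sum.cong refl) (simp add: card_invariant_colourings(1)[OF _ k])
  qed
  have "(\<lambda>N. \<Sum>\<pi>\<in>pair_partitions k. ?c \<pi> * ?q \<pi> N) \<longlonglongrightarrow> (\<Sum>\<pi>\<in>pair_partitions k. ?c \<pi> * partition_integral b k \<pi>)"
    by (intro tendsto_sum tendsto_mult_left card_walks_of_partition_tendsto k b(1) w)
  also have "(\<Sum>\<pi>\<in>pair_partitions k. ?c \<pi> * partition_integral b k \<pi>) = limit_moment m b k"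
    unfolding limit_moment_def sum_distrib_left
  proof (rule sum.cong[OF refl])
    fix \<pi> assume \<pi>: "\<pi> \<in> pair_partitions k"
    have r: "system_rank k \<pi> \<le> 2 * k" by (rule card_invariant_colourings(2)[OF \<pi> k])
    have e: "int k - 1 - int (system_rank k \<pi>) = int (2 * k - system_rank k \<pi>) - int (k + 1)"
      using r by simp
    have "real m powi (int k - 1 - int (system_rank k \<pi>)) = real m ^ (2 * k - system_rank k \<pi>) / real m ^ (k + 1)"
      unfolding e using m by (subst power_int_diff) (simp_all only: power_int_of_nat, simp)
    thus "?c \<pi> * partition_integral b k \<pi>
        = 1 / (2 - b) ^ k * (real m powi (int k - 1 - int (system_rank k \<pi>)) * partition_integral b k \<pi>)"
      by (simp add: power_mult_distrib)
  qed
  finally have lim: "(\<lambda>N. moment_scale m b (2 * k) N * main N) \<longlonglongrightarrow> limit_moment m b k"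
    unfolding main_eq .
  have "(\<lambda>N. moment_scale m b (2 * k) N * (expectation (trace_rv m (2 * k) N) - main N)) \<longlonglongrightarrow> 0"
  proof (rule Lim_null_comparison)
    have "(\<lambda>N. C / (D ^ k * real m) * (1 / real N)) \<longlonglongrightarrow> C / (D ^ k * real m) * 0"
      by (intro tendsto_mult_left lim_1_over_n)
    thus "(\<lambda>N. C / (D ^ k * real m) * (1 / real N)) \<longlonglongrightarrow> 0" by simp
    show "\<forall>\<^sub>F N in sequentially. norm (moment_scale m b (2 * k) N * (expectation (trace_rv m (2 * k) N) - main N))
       \<le> C / (D ^ k * real m) * (1 / real N)"
      using eventually_ge_at_top[of 1]
    proof eventually_elim
      case (elim N)
      have s: "moment_scale m b (2 * k) N \<ge> 0" unfolding scale using D by simp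
      have "norm (moment_scale m b (2 * k) N * (expectation (trace_rv m (2 * k) N) - main N))
         \<le> moment_scale m b (2 * k) N * (C * real N ^ k)"
        unfolding real_norm_def abs_mult using s C[OF elim] by (simp add: mult_left_mono)
      also have "\<dots> = C / (D ^ k * real m) * (1 / real N)"
        unfolding scale using elim by (simp add: power_mult_distrib)
      finally show ?case .
    qed
  qed
  from tendsto_add[OF lim this] show ?thesis by (simp add: algebra_simps)
qed

text \<open>For odd order no walk has its steps matched in pairs, and the bound for the degenerate
  walks falls short of the normalisation by \<open>sqrt N\<close>.\<close>

lemma scaled_mean_odd_tendsto:
  assumes m: "1 \<le> m" and n: "odd n" and b: "0 < b" "b \<le> 1"
  shows "(\<lambda>N. moment_scale m b n N * expectation (trace_rv m n N)) \<longlonglongrightarrow> 0"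
proof -
  define D where "D = real m * (2 - b) * b"
  have D: "D > 0" using m b by (simp add: D_def)
  obtain j where j: "n = 2 * j + 1" using n by (elim oddE)
  obtain C where C: "\<And>N. 1 \<le> N \<Longrightarrow> \<bar>expectation (trace_rv m n N)\<bar> \<le> C * real N ^ ((n + 1) div 2)"
    using trace_rv_odd_bound[OF m n] by blast
  have half: "(n + 1) div 2 = j + 1" using j by simp
  show ?thesis
  proof (rule Lim_null_comparison)
    have "(\<lambda>N. inverse (sqrt (real N))) \<longlonglongrightarrow> 0"
      by (rule tendsto_inverse_0_at_top[OF filterlim_compose[OF sqrt_at_top filterlim_real_sequentially]])
    hence "(\<lambda>N. C / (D ^ j * sqrt D * real m) * inverse (sqrt (real N))) \<longlonglongrightarrow> C / (D ^ j * sqrt D * real m) * 0"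
      by (rule tendsto_mult_left)
    thus "(\<lambda>N. C / (D ^ j * sqrt D * real m) * inverse (sqrt (real N))) \<longlonglongrightarrow> 0" by simp
    show "\<forall>\<^sub>F N in sequentially. norm (moment_scale m b n N * expectation (trace_rv m n N))
       \<le> C / (D ^ j * sqrt D * real m) * inverse (sqrt (real N))"
      using eventually_ge_at_top[of 1]
    proof eventually_elim
      case (elim N)
      have scale: "moment_scale m b n N = 1 / ((D * real N) ^ j * (sqrt D * sqrt (real N)) * (real m * real N))"
      proof -
        have "(1 / sqrt (D * real N)) ^ n = 1 / ((D * real N) ^ j * (sqrt D * sqrt (real N)))"
        proof -
          have "(1 / sqrt (D * real N)) ^ n = ((1 / sqrt (D * real N))\<^sup>2) ^ j * (1 / sqrt (D * real N))"
            unfolding j by (simp add: power_add power_mult)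
          also have "(1 / sqrt (D * real N))\<^sup>2 = 1 / (D * real N)" using D by (simp add: power_divide)
          finally show ?thesis by (simp add: power_divide real_sqrt_mult)
        qed
        thus ?thesis unfolding moment_scale_def D_def by simp
      qed
      have s: "moment_scale m b n N \<ge> 0" unfolding scale using D by simp
      have "norm (moment_scale m b n N * expectation (trace_rv m n N)) \<le> moment_scale m b n N * (C * real N ^ (j + 1))"
        unfolding real_norm_def abs_mult using s C[OF elim] unfolding half by (simp add: mult_left_mono)
      also have "\<dots> = C / (D ^ j * sqrt D * real m) * inverse (sqrt (real N))"
        unfolding scale using elim D m by (simp add: power_mult_distrib field_simps)
      finally show ?case .
    qed
  qed
qed

text \<open>The fourth central moment of the trace is at most of order \<open>N ^ (2n + 2)\<close>
  and is divided by \<open>N ^ (2n + 4)\<close>.\<close>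

lemma AE_moment_tendsto:
  assumes m: "1 \<le> m" and b: "0 < b" "b \<le> 1"
    and w: "(\<lambda>N. real_of_int (bw N) / real N) \<longlonglongrightarrow> b"
  shows "AE \<omega> in M. (\<lambda>N. LINT x|eigenvalue_distribution (scaled_model m b N \<omega>). x ^ n) \<longlonglongrightarrow> limit_moment_sequence m b n"
proof (cases "n = 0")
  case True
  thus ?thesis using zeroth_moment by (simp add: limit_moment_sequence_def)
next
  case False
  hence n: "n > 0" by simp
  define D where "D = real m * (2 - b) * b"
  have D: "D > 0" using m b by (simp add: D_def)
  define Z where "Z N \<omega> = moment_scale m b n N * trace_rv m n N \<omega>" for N \<omega>
  have EZ: "expectation (Z N) = moment_scale m b n N * expectation (trace_rv m n N)" for N
    unfolding Z_def[abs_def] by simp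
  obtain C where C: "\<And>N. 1 \<le> N \<Longrightarrow> expectation (\<lambda>\<omega>. (trace_rv m n N \<omega> - expectation (trace_rv m n N)) ^ 4) \<le> C * real N ^ (2 * n + 2)"
    using trace_rv_fourth_bound[OF m n] by blast
  have dev: "(Z N \<omega> - expectation (Z N)) ^ 4 = moment_scale m b n N ^ 4 * (trace_rv m n N \<omega> - expectation (trace_rv m n N)) ^ 4" for N \<omega>
    unfolding EZ unfolding Z_def right_diff_distrib[symmetric] power_mult_distrib ..
  have "AE \<omega> in M. (\<lambda>N. Z N \<omega>) \<longlonglongrightarrow> limit_moment_sequence m b n"
  proof (rule AE_tendsto_of_fourth_moment)
    fix N :: nat assume "N > 0"
    hence N: "1 \<le> N" by simp
    have int: "integrable M (\<lambda>\<omega>. (trace_rv m n N \<omega> - expectation (trace_rv m n N)) ^ 4)"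
      by (rule band_entries.fourth_central_integrable[OF band_entries_model[OF m N] n]) (use N in simp)
    show "integrable M (\<lambda>\<omega>. (Z N \<omega> - expectation (Z N)) ^ 4)"
      unfolding dev by (rule integrable_mult_right[OF int])
    have "expectation (\<lambda>\<omega>. (Z N \<omega> - expectation (Z N)) ^ 4)
        = moment_scale m b n N ^ 4 * expectation (\<lambda>\<omega>. (trace_rv m n N \<omega> - expectation (trace_rv m n N)) ^ 4)"
      unfolding dev by simp
    also have "\<dots> \<le> moment_scale m b n N ^ 4 * (C * real N ^ (2 * n + 2))"
      using C[OF N] by (intro mult_left_mono) auto
    also have "moment_scale m b n N ^ 4 = 1 / ((D * real N) ^ (2 * n) * (real m * real N) ^ 4)"
    proof -
      have "((1 / sqrt (D * real N)) ^ n) ^ 4 = ((1 / sqrt (D * real N))\<^sup>2) ^ (2 * n)"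
        by (simp flip: power_mult add: mult.commute)
      also have "(1 / sqrt (D * real N))\<^sup>2 = 1 / (D * real N)" using D by (simp add: power_divide)
      finally show ?thesis unfolding moment_scale_def D_def[symmetric] by (simp add: power_divide power_mult_distrib)
    qed
    also have "1 / ((D * real N) ^ (2 * n) * (real m * real N) ^ 4) * (C * real N ^ (2 * n + 2))
        = (C / (D ^ (2 * n) * real m ^ 4)) / real N ^ 2"
    proof -
      have x: "real N ^ (2 * n) \<noteq> 0" "real N ^ 2 \<noteq> 0" and x4: "real N ^ 4 = real N ^ 2 * real N ^ 2"
        using N by (simp_all flip: power_add)
      have "1 / ((D * real N) ^ (2 * n) * (real m * real N) ^ 4) * (C * real N ^ (2 * n + 2))
        = C * (real N ^ (2 * n) * real N ^ 2) / ((D ^ (2 * n) * real N ^ (2 * n)) * (real m ^ 4 * (real N ^ 2 * real N ^ 2)))"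
        by (simp only: power_mult_distrib power_add x4 times_divide_eq_left mult_1_left)
      also have "\<dots> = (C / (D ^ (2 * n) * real m ^ 4)) / real N ^ 2"
      proof -
        have "C * (u * v) / ((E * u) * (F * (v * v))) = (C / (E * F)) / v" if "u \<noteq> 0" "v \<noteq> 0" for u v E F :: real
          using that by simp
        thus ?thesis using x by blast
      qed
      finally show ?thesis .
    qed
    finally show "expectation (\<lambda>\<omega>. (Z N \<omega> - expectation (Z N)) ^ 4) \<le> (C / (D ^ (2 * n) * real m ^ 4)) / real N ^ 2" .
  next
    show "(\<lambda>N. expectation (Z N)) \<longlonglongrightarrow> limit_moment_sequence m b n"
    proof (cases "odd n")
      case True
      thus ?thesis unfolding EZ using scaled_mean_odd_tendsto[OF m True b] by (simp add: limit_moment_sequence_def)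
    next
      case False
      then obtain k where k: "n = 2 * k" by (auto elim: evenE)
      hence "k > 0" using n by simp
      from scaled_mean_even_tendsto[OF m this b w] show ?thesis
        unfolding EZ k using \<open>k > 0\<close> by (simp add: limit_moment_sequence_def)
    qed
  qed
  moreover have "AE \<omega> in M. \<omega> \<in> space M" by (rule AE_space)
  ultimately show ?thesis
  proof eventually_elim
    case (elim \<omega>)
    have "\<forall>\<^sub>F N in sequentially. Z N \<omega> = (LINT x|eigenvalue_distribution (scaled_model m b N \<omega>). x ^ n)"
      using eventually_ge_at_top[of 1]
    proof eventually_elim
      case (elim N)
      show ?case unfolding Z_def by (rule moment_scaled_model(2)[OF m elim \<open>\<omega> \<in> space M\<close> n, symmetric])
    qed
    from Lim_transform_eventually[OF elim(1) this] show ?case .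
  qed
qed

text \<open>The sequence is shifted by one because the matrix for \<open>N = 0\<close> is empty and
  its eigenvalue distribution is a default value.\<close>

lemma AE_weak_limit:
  assumes m: "1 \<le> m" and b: "0 < b" "b \<le> 1"
    and w: "(\<lambda>N. real_of_int (bw N) / real N) \<longlonglongrightarrow> b"
  shows "AE \<omega> in M. \<exists>\<nu>. has_moments \<nu> (limit_moment_sequence m b) \<and>
    weak_conv_m (\<lambda>N. eigenvalue_distribution (scaled_model m b N \<omega>)) \<nu>"
proof -
  have "AE \<omega> in M. \<forall>n. (\<lambda>N. LINT x|eigenvalue_distribution (scaled_model m b N \<omega>). x ^ n) \<longlonglongrightarrow> limit_moment_sequence m b n"
    unfolding AE_all_countable using AE_moment_tendsto[OF m b w] by blast
  moreover have "AE \<omega> in M. \<omega> \<in> space M" by (rule AE_space)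
  ultimately show ?thesis
  proof eventually_elim
    case (elim \<omega>)
    let ?\<mu> = "\<lambda>N. eigenvalue_distribution (scaled_model m b N \<omega>)"
    have "\<exists>\<nu>. has_moments \<nu> (limit_moment_sequence m b) \<and> weak_conv_m (\<lambda>N. ?\<mu> (Suc N)) \<nu>"
    proof (rule moment_convergence_theorem[OF limit_moment_sequence_growth[OF m b]])
      show "real_distribution (?\<mu> (Suc N))" for N by (rule real_distribution_eigenvalue_distribution)
      show "integrable (?\<mu> (Suc N)) (\<lambda>x. x ^ j)" for N j
        by (rule moment_scaled_model(1)[OF m _ elim(2)]) simp
      show "(\<lambda>N. LINT x|?\<mu> (Suc N). x ^ j) \<longlonglongrightarrow> limit_moment_sequence m b j" for j
        using elim(1) by (intro LIMSEQ_Suc) blast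
    qed
    then obtain \<nu> where \<nu>: "has_moments \<nu> (limit_moment_sequence m b)" "weak_conv_m (\<lambda>N. ?\<mu> (Suc N)) \<nu>" by blast
    have "weak_conv_m ?\<mu> \<nu>"
      unfolding weak_conv_m_def weak_conv_def
    proof (intro allI impI)
      fix x assume "isCont (cdf \<nu>) x"
      hence "(\<lambda>N. cdf (?\<mu> (Suc N)) x) \<longlonglongrightarrow> cdf \<nu> x"
        using \<nu>(2) unfolding weak_conv_m_def weak_conv_def by blast
      thus "(\<lambda>N. cdf (?\<mu> N) x) \<longlonglongrightarrow> cdf \<nu> x" by (rule LIMSEQ_imp_Suc)
    qed
    with \<nu>(1) show ?case by blast
  qed
qed

end

theorem theorem4p2:
  fixes M :: "'w measure"
    and bw :: "nat \<Rightarrow> int"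
    and A :: "nat \<Rightarrow> nat \<Rightarrow> int \<Rightarrow> 'w \<Rightarrow> real mat"
    and m :: nat
    and b :: real
  assumes "block_toeplitz_band_model M bw A"
    and "1 \<le> m"
    and "0 < b" and "b \<le> 1"
    and "(\<lambda>N. real_of_int (bw N) / real N) \<longlonglongrightarrow> b"
  shows "\<exists>\<gamma>. symmetric_with_even_moments \<gamma> (limit_moment m b) \<and>
    (\<forall>\<nu>. symmetric_with_even_moments \<nu> (limit_moment m b) \<longrightarrow> \<nu> = \<gamma>) \<and>
    (AE \<omega> in M. weak_conv_m
      (\<lambda>N. eigenvalue_distribution
        ((1 / sqrt (real m * (2 - b) * b * real N)) \<cdot>\<^sub>m block_toeplitz m N (\<lambda>s. A m N s \<omega>))) \<gamma>)"
proof -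
  interpret block_toeplitz_band_model M bw A by fact
  have AE: "AE \<omega> in M. \<exists>\<nu>. has_moments \<nu> (limit_moment_sequence m b) \<and>
      weak_conv_m (\<lambda>N. eigenvalue_distribution (scaled_model m b N \<omega>)) \<nu>"
    by (rule AE_weak_limit) fact+
  have unique: "\<nu> = \<rho>" if "has_moments \<nu> (limit_moment_sequence m b)" "has_moments \<rho> (limit_moment_sequence m b)" for \<nu> \<rho>
    by (rule moments_determine[OF limit_moment_sequence_growth[OF assms(2-4)] that])
  have "\<exists>\<gamma>. has_moments \<gamma> (limit_moment_sequence m b)"
  proof (rule ccontr)
    assume "\<not> ?thesis"
    with AE have "AE \<omega> in M. False" by simp
    thus False by simp
  qed
  then obtain \<gamma> where \<gamma>: "has_moments \<gamma> (limit_moment_sequence m b)" by blast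
  from AE have "AE \<omega> in M. weak_conv_m (\<lambda>N. eigenvalue_distribution (scaled_model m b N \<omega>)) \<gamma>"
    by eventually_elim (metis unique \<gamma>)
  thus ?thesis
    unfolding symmetric_with_even_moments_iff[OF assms(2-4)] scaled_model_def
    using \<gamma> unique by (intro exI[of _ \<gamma>]) simp
qed

end
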